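(* Let $\mathcal I=[0,b)$, $X=\{x_n\}_{n=1}^\infty$, $d_n=x_n-x_{n-1}$ and $\alpha=\{\alpha_n\}_{n=1}^\infty\subset\mathbb R$ be as in the context, and put $r_n=\sqrt{d_n+d_{n+1}}$, $n\in\mathbb N$. Assume that $\sum_{n=1}^\infty d_n^2<\infty$, and that $\alpha$ and $X$ satisfy one of the following conditions: (i) $\displaystyle\sum_{n=2}^\infty|\alpha_n|\,d_nd_{n+1}r_{n-1}r_{n+1}=\infty$. (ii) There exists a constant $C_1>0$ such that $$\alpha_n+\frac1{d_n}\left(1+\frac{r_n}{r_{n-1}}\right)+\frac1{d_{n+1}}\left(1+\frac{r_n}{r_{n+1}}\right)\le C_1(d_n+d_{n+1}),\qquad n\ge2 .$$ (iii) There exists a constant $C_2>0$ such that $$\alpha_n+\frac1{d_n}\left(1-\frac{r_n}{r_{n-1}}\right)+\frac1{d_{n+1}}\left(1-\frac{r_n}{r_{n+1}}\right)\ge-C_2(d_n+d_{n+1}),\qquad n\ge2 .$$ Then the operator $\mathrm H_{X,\alpha}$ is self-adjoint in $L^2(\mathcal I)$.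
   Context: Let $\mathcal I=[0,b)$, $0<b\le+\infty$, and $X=\{x_n\}_{n=1}^\infty$, $x_0=0$, with $0=x_0<x_1<x_2<\dots<b$ and $\lim_nx_n=b$; $d_n=x_n-x_{n-1}$. $W^{2,2}(\mathcal I\setminus X)=\{f\in L^2(\mathcal I): f,f'\in AC_{loc}(\mathcal I\setminus X),\ f''\in L^2(\mathcal I)\}$, and $W^{2,2}_{\mathrm{comp}}(\mathcal I\setminus X)$ is the set of its elements whose support is compact in $\mathcal I=[0,b)$. $\mathrm H_{X,\alpha}$ is the closure in $L^2(\mathcal I)$ of the symmetric operator $-\mathrm d^2/\mathrm dx^2$ with domain $$\{f\in W^{2,2}_{\mathrm{comp}}(\mathcal I\setminus X): f'(0)=0,\ f(x_n+)=f(x_n-),\ f'(x_n+)-f'(x_n-)=\alpha_nf(x_n),\ n\in\mathbb N\}.$$ *)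

theory Defs
  imports "HOL-Analysis.Analysis"
begin

section \<open>Operators in \<open>L\<^sup>2\<close>\<close>

text \<open>
  Elements of the complex Hilbert space \<open>L\<^sup>2(M)\<close> are handled through representatives.
  A linear operator is given by its graph, a set of pairs of representatives.
\<close>

definition L2 :: "'a measure \<Rightarrow> ('a \<Rightarrow> complex) set" where
  "L2 M = {f. f \<in> borel_measurable M \<and> integrable M (\<lambda>t. (cmod (f t))\<^sup>2)}"

definition L2_inner :: "'a measure \<Rightarrow> ('a \<Rightarrow> complex) \<Rightarrow> ('a \<Rightarrow> complex) \<Rightarrow> complex" where
  "L2_inner M f g = (LINT t|M. f t * cnj (g t))"

definition L2_dist :: "'a measure \<Rightarrow> ('a \<Rightarrow> complex) \<Rightarrow> ('a \<Rightarrow> complex) \<Rightarrow> real" where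
  "L2_dist M f g = sqrt (LINT t|M. (cmod (f t - g t))\<^sup>2)"

type_synonym 'a op_graph = "(('a \<Rightarrow> complex) \<times> ('a \<Rightarrow> complex)) set"

text \<open>
  The closure and the adjoint contain, with a pair \<open>(f, g)\<close>, every pair in
  \<open>L\<^sup>2(M) \<times> L\<^sup>2(M)\<close> that agrees with it almost everywhere.
\<close>

definition op_closure :: "'a measure \<Rightarrow> 'a op_graph \<Rightarrow> 'a op_graph" where
  "op_closure M A =
    {(f, g). f \<in> L2 M \<and> g \<in> L2 M \<and>
       (\<exists>F G. (\<forall>k::nat. (F k, G k) \<in> A) \<and>
          (\<lambda>k. L2_dist M (F k) f) \<longlonglongrightarrow> 0 \<and> (\<lambda>k. L2_dist M (G k) g) \<longlonglongrightarrow> 0)}"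

definition op_adjoint :: "'a measure \<Rightarrow> 'a op_graph \<Rightarrow> 'a op_graph" where
  "op_adjoint M A =
    {(u, v). u \<in> L2 M \<and> v \<in> L2 M \<and> (\<forall>(f, g)\<in>A. L2_inner M g u = L2_inner M f v)}"

definition densely_defined :: "'a measure \<Rightarrow> 'a op_graph \<Rightarrow> bool" where
  "densely_defined M A \<longleftrightarrow> (\<forall>h\<in>L2 M. \<forall>e>0. \<exists>(f, g)\<in>A. L2_dist M f h < e)"

text \<open>
  If \<open>A\<close> is densely defined, its adjoint is single-valued up to null sets and linear,
  so the equation below also makes \<open>A\<close> the graph of a linear operator.
\<close>

definition self_adjoint :: "'a measure \<Rightarrow> 'a op_graph \<Rightarrow> bool" where
  "self_adjoint M A \<longleftrightarrow> densely_defined M A \<and> op_adjoint M A = A"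


section \<open>Absolute continuity and Sobolev spaces\<close>

definition abs_cont_on :: "real \<Rightarrow> real \<Rightarrow> (real \<Rightarrow> complex) \<Rightarrow> bool" where
  "abs_cont_on a c f \<longleftrightarrow>
    (\<forall>e>0. \<exists>\<delta>>0. \<forall>D s. D division_of s \<and> s \<subseteq> {a..c} \<and> (\<Sum>K\<in>D. Sup K - Inf K) < \<delta>
       \<longrightarrow> (\<Sum>K\<in>D. cmod (f (Sup K) - f (Inf K))) < e)"

definition AC_loc :: "real set \<Rightarrow> (real \<Rightarrow> complex) set" where
  "AC_loc S = {f. \<forall>a c. a \<le> c \<and> {a..c} \<subseteq> S \<longrightarrow> abs_cont_on a c f}"

text \<open>The interval \<open>[0, b)\<close>, where \<open>b\<close> may be infinite, and the set of interaction points.\<close>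

definition Ival :: "ereal \<Rightarrow> real set" where
  "Ival b = {t. 0 \<le> t \<and> ereal t < b}"

definition pts :: "(nat \<Rightarrow> real) \<Rightarrow> real set" where
  "pts x = x ` {1..}"

text \<open>
  \<open>W22_with I X f f1 f2\<close>: \<open>f\<close> belongs to \<open>W\<^sup>2\<^sup>,\<^sup>2(I - X)\<close>, with first derivative \<open>f1\<close> and
  second derivative \<open>f2\<close>. An \<open>f\<close> in \<open>AC_loc (I - X)\<close> whose derivative is locally absolutely
  continuous is differentiable everywhere on \<open>I - X\<close>, one-sidedly at \<open>0\<close>;
  \<open>f1\<close> itself is only differentiable almost everywhere.
  The values of \<open>f\<close> at the points of \<open>X\<close> are irrelevant.
\<close>

definition W22_with ::
    "real set \<Rightarrow> real set \<Rightarrow> (real \<Rightarrow> complex) \<Rightarrow> (real \<Rightarrow> complex) \<Rightarrow> (real \<Rightarrow> complex) \<Rightarrow> bool" where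
  "W22_with I X f f1 f2 \<longleftrightarrow>
     f \<in> L2 (lebesgue_on I) \<and> f \<in> AC_loc (I - X) \<and> f1 \<in> AC_loc (I - X) \<and>
     (\<forall>t\<in>I - X. (f has_vector_derivative f1 t) (at t within I - X)) \<and>
     (AE t in lebesgue_on I. (f1 has_vector_derivative f2 t) (at t within I - X)) \<and>
     f2 \<in> L2 (lebesgue_on I)"

definition comp_supp :: "real set \<Rightarrow> real set \<Rightarrow> (real \<Rightarrow> complex) \<Rightarrow> bool" where
  "comp_supp I X f \<longleftrightarrow>
     compact (closure {t \<in> I - X. f t \<noteq> 0}) \<and> closure {t \<in> I - X. f t \<noteq> 0} \<subseteq> I"


section \<open>The Hamiltonian with \<open>\<delta>\<close>-interactions\<close>

text \<open>
  The graph of \<open>- d\<^sup>2/dx\<^sup>2\<close> before taking the closure. In the interface condition at \<open>x n\<close>,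
  \<open>c\<close> is the common one-sided limit of \<open>f\<close>, denoted \<open>f(x\<^sub>n)\<close> in the jump condition,
  and \<open>p\<close>, \<open>q\<close> are the left and right limits of the derivative. The value \<open>\<alpha> 0\<close> is not used.
\<close>

definition H0_delta :: "ereal \<Rightarrow> (nat \<Rightarrow> real) \<Rightarrow> (nat \<Rightarrow> real) \<Rightarrow> real op_graph" where
  "H0_delta b x \<alpha> =
    {(f, \<lambda>t. - f2 t) | f f2. \<exists>f1.
       W22_with (Ival b) (pts x) f f1 f2 \<and> comp_supp (Ival b) (pts x) f \<and>
       f1 0 = 0 \<and>
       (\<forall>n\<ge>1. \<exists>c p q.
          (f \<longlongrightarrow> c) (at_left (x n)) \<and> (f \<longlongrightarrow> c) (at_right (x n)) \<and>
          (f1 \<longlongrightarrow> p) (at_left (x n)) \<and> (f1 \<longlongrightarrow> q) (at_right (x n)) \<and>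
          q - p = of_real (\<alpha> n) * c)}"

definition H_delta :: "ereal \<Rightarrow> (nat \<Rightarrow> real) \<Rightarrow> (nat \<Rightarrow> real) \<Rightarrow> real op_graph" where
  "H_delta b x \<alpha> = op_closure (lebesgue_on (Ival b)) (H0_delta b x \<alpha>)"

text \<open>Meaningful for \<open>n \<ge> 1\<close> only.\<close>

definition gap :: "(nat \<Rightarrow> real) \<Rightarrow> nat \<Rightarrow> real" where
  "gap x n = x n - x (n - 1)"

definition rad :: "(nat \<Rightarrow> real) \<Rightarrow> nat \<Rightarrow> real" where
  "rad x n = sqrt (gap x n + gap x (n + 1))"

end

(*
  The closure of a linear symmetric graph A is self-adjoint as soon as the adjoint of A is symmetric:
  a pair in the adjoint, minus its projection onto the closure of A in L2 x L2, is some (e, h)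
  orthogonal to A, so that (h, -e) lies in the adjoint too, and symmetry gives |h|^2 = -|e|^2.

  Testing against piecewise smooth functions shows that the adjoint consists of the functions that are
  W^{2,2} on every cell [x_n, x_{n+1}] and satisfy all interface conditions. By Green's formula its
  symmetry means that the Wronskian at x_n of any two such functions tends to 0. Up to errors that are
  square summable with the weight r_n, the values f(x_n) satisfy
    alpha_n f_n = (f_{n+1} - f_n) / d_{n+1} - (f_n - f_{n-1}) / d_n,
  and the discrete Wronskians W_n of two such sequences converge. Under (i) the series of
  |alpha_n| d_n d_{n+1} r_{n-1} r_{n+1} |W_n| converges, so the limit is 0. Under (ii) or (iii) there is a
  solution y of the recursion with alpha_n shifted by a multiple of r_n^2 for which r_n |y_n| increases;
  if the limit of W_n were not 0, a Gronwall argument would make r_n y_n square summable.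
*)

theory Submission
  imports Defs
begin

section \<open>Square integrable functions\<close>

text \<open>The weight r_n is forced by the two cells that meet at x_n. On a cell of length L, sqrt
  L times an end point value of f, and 1 / sqrt L times the error of replacing f' by the difference
  quotient, are bounded by the L2 norms of f and f'' on that cell, and these norms are square
  summable over the cells. So f_n is at most gamma_n / r_n and its defect in the recursion at most
  r_n gamma_n, with gamma square summable; a value times a defect is summable, which is why the
  Wronskians converge. A shift of alpha_n by a multiple of r_n^2 = d_n + d_{n+1} changes the defect
  by a multiple of r_n^2 f_n, again at most r_n gamma_n: hence the room on the right-hand sides of
  (ii) and (iii). Their left-hand sides are such that, when they vanish, 1 / r_n, with alternating
  signs for (ii), solves the recursion exactly. Elements of L2 are representatives, and values on X
  carry no information. Functions in the maximal domain are therefore replaced by a family of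
  functions, one on each closed cell, whose end point values exist by construction.\<close>

lemma L2D:
  assumes "f \<in> L2 M"
  shows "f \<in> borel_measurable M" "integrable M (\<lambda>t. (cmod (f t))\<^sup>2)"
  using assms by (auto simp: L2_def)

lemma norm_mult_le_sum_squares: "cmod a * cmod b \<le> (cmod a)\<^sup>2 + (cmod b)\<^sup>2"
  using sum_squares_bound[of "cmod a" "cmod b"] zero_le_power2[of "cmod a"] zero_le_power2[of "cmod b"]
  by linarith

lemma norm_add_square_le: "(cmod (a + b))\<^sup>2 \<le> 2 * (cmod a)\<^sup>2 + 2 * (cmod b)\<^sup>2"
proof -
  have "(cmod (a + b))\<^sup>2 \<le> (cmod a + cmod b)\<^sup>2"
    by (simp add: norm_triangle_ineq power_mono)
  also have "\<dots> \<le> 2 * (cmod a)\<^sup>2 + 2 * (cmod b)\<^sup>2"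
    using sum_squares_bound[of "cmod a" "cmod b"] by (simp add: power2_sum)
  finally show ?thesis .
qed

lemma L2_zero [simp]: "(\<lambda>_. 0) \<in> L2 M"
  by (simp add: L2_def)

lemma L2_add:
  assumes f: "f \<in> L2 M" and g: "g \<in> L2 M"
  shows "(\<lambda>t. f t + g t) \<in> L2 M"
proof -
  have [measurable]: "f \<in> borel_measurable M" "g \<in> borel_measurable M"
    using assms by (auto dest: L2D)
  have "integrable M (\<lambda>t. (cmod (f t + g t))\<^sup>2)"
  proof (rule Bochner_Integration.integrable_bound)
    show "integrable M (\<lambda>t. 2 * (cmod (f t))\<^sup>2 + 2 * (cmod (g t))\<^sup>2)"
      using L2D[OF f] L2D[OF g] by simp
    show "AE t in M. norm ((cmod (f t + g t))\<^sup>2) \<le> norm (2 * (cmod (f t))\<^sup>2 + 2 * (cmod (g t))\<^sup>2)"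
      using norm_add_square_le by (auto simp: abs_of_nonneg)
  qed measurable
  then show ?thesis by (simp add: L2_def)
qed

lemma L2_cmult:
  assumes f: "f \<in> L2 M"
  shows "(\<lambda>t. c * f t) \<in> L2 M"
  using L2D[OF f] by (auto simp: L2_def norm_mult power_mult_distrib)

lemma L2_uminus: "f \<in> L2 M \<Longrightarrow> (\<lambda>t. - f t) \<in> L2 M"
  using L2_cmult[of f M "-1"] by simp

lemma L2_diff: "f \<in> L2 M \<Longrightarrow> g \<in> L2 M \<Longrightarrow> (\<lambda>t. f t - g t) \<in> L2 M"
  using L2_add[OF _ L2_uminus, of f M g] by simp

lemma borel_measurable_cnj [measurable (raw)]:
  "f \<in> borel_measurable M \<Longrightarrow> (\<lambda>t. cnj (f t)) \<in> borel_measurable M"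
  by (rule measurable_compose[OF _ borel_measurable_continuous_onI]) (auto intro: continuous_intros)

lemma L2_cnj: "f \<in> L2 M \<Longrightarrow> (\<lambda>t. cnj (f t)) \<in> L2 M"
  by (auto simp: L2_def intro: borel_measurable_cnj)

lemma L2_mult_cnj_integrable:
  assumes f: "f \<in> L2 M" and g: "g \<in> L2 M"
  shows "integrable M (\<lambda>t. f t * cnj (g t))"
proof (rule Bochner_Integration.integrable_bound)
  show "integrable M (\<lambda>t. (cmod (f t))\<^sup>2 + (cmod (g t))\<^sup>2)"
    using L2D[OF f] L2D[OF g] by simp
  show "(\<lambda>t. f t * cnj (g t)) \<in> borel_measurable M"
    using L2D[OF f] L2D[OF g] by (intro borel_measurable_times borel_measurable_cnj)
  show "AE t in M. norm (f t * cnj (g t)) \<le> norm ((cmod (f t))\<^sup>2 + (cmod (g t))\<^sup>2)"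
    by (simp add: norm_mult norm_mult_le_sum_squares)
qed

lemma L2_mult_integrable: "f \<in> L2 M \<Longrightarrow> g \<in> L2 M \<Longrightarrow> integrable M (\<lambda>t. f t * g t)"
  using L2_mult_cnj_integrable[OF _ L2_cnj, of f M g] by simp

section \<open>Norm and inner product\<close>

definition L2_norm :: "'a measure \<Rightarrow> ('a \<Rightarrow> complex) \<Rightarrow> real" where
  "L2_norm M f = sqrt (LINT t|M. (cmod (f t))\<^sup>2)"

lemma L2_norm_nonneg [simp]: "0 \<le> L2_norm M f"
  by (simp add: L2_norm_def)

lemma L2_norm_square: "(L2_norm M f)\<^sup>2 = (LINT t|M. (cmod (f t))\<^sup>2)"
  by (simp add: L2_norm_def)

lemma L2_dist_eq: "L2_dist M f g = L2_norm M (\<lambda>t. f t - g t)"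
  by (simp add: L2_dist_def L2_norm_def)

lemma L2_inner_self: "L2_inner M f f = of_real ((L2_norm M f)\<^sup>2)"
proof -
  have "L2_inner M f f = (LINT t|M. complex_of_real ((cmod (f t))\<^sup>2))"
    unfolding L2_inner_def by (intro Bochner_Integration.integral_cong refl complex_norm_square[symmetric])
  then show ?thesis by (simp only: L2_norm_square integral_complex_of_real)
qed

text \<open>The quadratic is evaluated at its vertex. The bound serves twice: for Cauchy-Schwarz,
  and to turn near-minimality of a distance into near-orthogonality.\<close>

lemma discriminant_bound:
  fixes A B C :: real
  assumes A: "0 \<le> A" and q: "\<And>s. 0 \<le> A * s\<^sup>2 + 2 * C * s + B"
  shows "C\<^sup>2 \<le> A * B"
proof (cases "A = 0")
  case True
  have "C = 0"
  proof (rule ccontr)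
    assume "C \<noteq> 0"
    \<comment> \<open>At this point the affine function takes the value -1.\<close>
    with q[of "- (B + 1) / (2 * C)"] True show False by simp
  qed
  then show ?thesis using True by simp
next
  case False
  with A have "A > 0" by simp
  have "0 \<le> A * (- C / A)\<^sup>2 + 2 * C * (- C / A) + B" by (rule q)
  also have "\<dots> = B - C\<^sup>2 / A" using \<open>A > 0\<close> by (simp add: power2_eq_square field_simps)
  finally show ?thesis using \<open>A > 0\<close> by (simp add: field_simps)
qed

lemma L2_Cauchy_Schwarz_norm:
  assumes f: "f \<in> L2 M" and g: "g \<in> L2 M"
  shows "(LINT t|M. cmod (f t) * cmod (g t)) \<le> L2_norm M f * L2_norm M g"
proof -
  have i: "integrable M (\<lambda>t. cmod (f t) * cmod (g t))"
    using integrable_norm[OF L2_mult_cnj_integrable[OF f g]] by (simp add: norm_mult)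
  have "(LINT t|M. cmod (f t) * cmod (g t))\<^sup>2 \<le> (L2_norm M f)\<^sup>2 * (L2_norm M g)\<^sup>2"
  proof (rule discriminant_bound)
    fix s :: real
    have "0 \<le> (LINT t|M. (s * cmod (f t) + cmod (g t))\<^sup>2)" by simp
    also have "\<dots> = (LINT t|M. s\<^sup>2 * (cmod (f t))\<^sup>2 + (2 * s * (cmod (f t) * cmod (g t)) + (cmod (g t))\<^sup>2))"
      by (rule Bochner_Integration.integral_cong) (auto simp: power2_eq_square algebra_simps)
    also have "\<dots> = (L2_norm M f)\<^sup>2 * s\<^sup>2 + 2 * (LINT t|M. cmod (f t) * cmod (g t)) * s + (L2_norm M g)\<^sup>2"
      using i L2D[OF f] L2D[OF g] by (simp add: L2_norm_square mult_ac)
    finally show "0 \<le> (L2_norm M f)\<^sup>2 * s\<^sup>2 + 2 * (LINT t|M. cmod (f t) * cmod (g t)) * s + (L2_norm M g)\<^sup>2" .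
  qed simp
  then have "(LINT t|M. cmod (f t) * cmod (g t))\<^sup>2 \<le> (L2_norm M f * L2_norm M g)\<^sup>2"
    by (simp add: power_mult_distrib)
  then show ?thesis by (rule power2_le_imp_le) simp
qed

lemma L2_inner_bound:
  assumes f: "f \<in> L2 M" and g: "g \<in> L2 M"
  shows "cmod (L2_inner M f g) \<le> L2_norm M f * L2_norm M g"
proof -
  have "cmod (L2_inner M f g) \<le> (LINT t|M. cmod (f t * cnj (g t)))"
    unfolding L2_inner_def by (rule integral_norm_bound)
  also have "\<dots> \<le> L2_norm M f * L2_norm M g"
    using L2_Cauchy_Schwarz_norm[OF f g] by (simp add: norm_mult)
  finally show ?thesis .
qed

lemma L2_inner_diff_left:
  "f \<in> L2 M \<Longrightarrow> g \<in> L2 M \<Longrightarrow> h \<in> L2 M \<Longrightarrow>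
    L2_inner M (\<lambda>t. f t - g t) h = L2_inner M f h - L2_inner M g h"
  by (simp add: L2_inner_def left_diff_distrib L2_mult_cnj_integrable)

lemma L2_inner_diff_right:
  "f \<in> L2 M \<Longrightarrow> g \<in> L2 M \<Longrightarrow> h \<in> L2 M \<Longrightarrow>
    L2_inner M h (\<lambda>t. f t - g t) = L2_inner M h f - L2_inner M h g"
  by (simp add: L2_inner_def right_diff_distrib L2_mult_cnj_integrable)

lemma L2_inner_uminus_right: "L2_inner M h (\<lambda>t. - f t) = - L2_inner M h f"
  by (simp add: L2_inner_def)

lemma L2_inner_cnj_commute: "L2_inner M f g = cnj (L2_inner M g f)"
proof -
  have "cnj (L2_inner M g f) = (LINT t|M. cnj (g t * cnj (f t)))"
    unfolding L2_inner_def by (rule Bochner_Integration.integral_cnj[symmetric])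
  then show ?thesis by (simp add: L2_inner_def mult.commute)
qed

lemma L2_inner_tendsto_left:
  assumes "\<And>k. F k \<in> L2 M" "f \<in> L2 M" "h \<in> L2 M"
    and "(\<lambda>k. L2_dist M (F k) f) \<longlonglongrightarrow> 0"
  shows "(\<lambda>k. L2_inner M (F k) h) \<longlonglongrightarrow> L2_inner M f h"
proof (rule LIM_zero_cancel, rule Lim_null_comparison)
  show "(\<lambda>k. L2_dist M (F k) f * L2_norm M h) \<longlonglongrightarrow> 0"
    using tendsto_mult_right[OF assms(4), of "L2_norm M h"] by simp
  show "\<forall>\<^sub>F k in sequentially. norm (L2_inner M (F k) h - L2_inner M f h) \<le> L2_dist M (F k) f * L2_norm M h"
  proof (rule always_eventually, rule allI)
    fix k
    have "L2_inner M (F k) h - L2_inner M f h = L2_inner M (\<lambda>t. F k t - f t) h"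
      using assms by (simp add: L2_inner_diff_left)
    also have "cmod \<dots> \<le> L2_norm M (\<lambda>t. F k t - f t) * L2_norm M h"
      by (intro L2_inner_bound L2_diff assms)
    finally show "norm (L2_inner M (F k) h - L2_inner M f h) \<le> L2_dist M (F k) f * L2_norm M h"
      by (simp add: L2_dist_eq)
  qed
qed

lemma L2_norm_cong_AE:
  assumes "AE t in M. f t = g t" "f \<in> borel_measurable M" "g \<in> borel_measurable M"
  shows "L2_norm M f = L2_norm M g"
  unfolding L2_norm_def
  by (rule arg_cong[where f = sqrt], rule integral_cong_AE) (use assms in auto)

lemma L2_norm_eq_0_imp_AE:
  assumes f: "f \<in> L2 M" and "L2_norm M f = 0"
  shows "AE t in M. f t = 0"
proof -
  have "(LINT t|M. (cmod (f t))\<^sup>2) = 0" using assms(2) L2_norm_square[of M f] by simp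
  then have "AE t in M. (cmod (f t))\<^sup>2 = 0"
    using integral_nonneg_eq_0_iff_AE[OF L2D(2)[OF f]] by simp
  then show ?thesis by simp
qed

text \<open>Makes minimising sequences Cauchy: if \<open>f\<close> and \<open>g\<close> are both
  nearly as close to \<open>u\<close> as possible, their midpoint cannot be much closer, so
  \<open>f\<close> and \<open>g\<close> are close to each other.\<close>

lemma L2_parallelogram:
  assumes f: "f \<in> L2 M" and g: "g \<in> L2 M" and u: "u \<in> L2 M"
  shows "(L2_norm M (\<lambda>t. f t - g t))\<^sup>2 + 4 * (L2_norm M (\<lambda>t. u t - (f t + g t) / 2))\<^sup>2
     = 2 * (L2_norm M (\<lambda>t. u t - f t))\<^sup>2 + 2 * (L2_norm M (\<lambda>t. u t - g t))\<^sup>2"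
proof -
  have pw: "(cmod (a - b))\<^sup>2 + 4 * (cmod (c - (a + b) / 2))\<^sup>2
      = 2 * (cmod (c - a))\<^sup>2 + 2 * (cmod (c - b))\<^sup>2" for a b c :: complex
    unfolding cmod_power2 by (simp add: power2_eq_square) (simp add: field_simps)
  have m: "(\<lambda>t. u t - (f t + g t) / 2) \<in> L2 M"
    using L2_diff[OF u L2_cmult[OF L2_add[OF f g], of "1/2"]] by simp
  note i = L2D(2)[OF L2_diff[OF f g]] L2D(2)[OF m] L2D(2)[OF L2_diff[OF u f]] L2D(2)[OF L2_diff[OF u g]]
  have "(L2_norm M (\<lambda>t. f t - g t))\<^sup>2 + 4 * (L2_norm M (\<lambda>t. u t - (f t + g t) / 2))\<^sup>2
     = (LINT t|M. (cmod (f t - g t))\<^sup>2 + 4 * (cmod (u t - (f t + g t) / 2))\<^sup>2)"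
    using i by (simp add: L2_norm_square)
  also have "\<dots> = (LINT t|M. 2 * (cmod (u t - f t))\<^sup>2 + 2 * (cmod (u t - g t))\<^sup>2)"
    by (simp only: pw)
  also have "\<dots> = 2 * (L2_norm M (\<lambda>t. u t - f t))\<^sup>2 + 2 * (L2_norm M (\<lambda>t. u t - g t))\<^sup>2"
    using i by (simp add: L2_norm_square)
  finally show ?thesis .
qed

lemma L2_norm_diff_cmult_square:
  assumes e: "e \<in> L2 M" and s: "s \<in> L2 M"
  shows "(L2_norm M (\<lambda>t. e t - z * s t))\<^sup>2
    = (L2_norm M e)\<^sup>2 - 2 * Re (z * L2_inner M s e) + (cmod z)\<^sup>2 * (L2_norm M s)\<^sup>2"
proof -
  have pw: "(cmod (a - z * b))\<^sup>2 = (cmod a)\<^sup>2 - 2 * Re (z * (b * cnj a)) + (cmod z)\<^sup>2 * (cmod b)\<^sup>2" for a b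
    unfolding cmod_power2 by (simp add: power2_eq_square algebra_simps)
  have i: "integrable M (\<lambda>t. z * (s t * cnj (e t)))"
    using L2_mult_cnj_integrable[OF s e] by simp
  have "(LINT t|M. Re (z * (s t * cnj (e t)))) = Re (z * L2_inner M s e)"
    using i integral_Re[OF i] by (simp add: L2_inner_def del: times_complex.sel)
  moreover have "integrable M (\<lambda>t. Re (z * (s t * cnj (e t))))"
    using i by (rule integrable_Re)
  ultimately show ?thesis
    using L2D(2)[OF e] L2D(2)[OF s] by (simp add: L2_norm_square pw del: times_complex.sel)
qed

section \<open>A criterion for self-adjointness of the closure\<close>

text \<open>Riesz-Fischer for representatives: a subsequence with geometrically small steps
  converges almost everywhere, and Fatou's lemma gives norm convergence of the whole
  sequence.\<close>

lemma L2_complete: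
  assumes F: "\<And>k. F k \<in> L2 M"
    and cauchy: "\<And>e. e > 0 \<Longrightarrow> \<exists>N::nat. \<forall>m\<ge>N. \<forall>n\<ge>N. L2_dist M (F m) (F n) < e"
  obtains f where "f \<in> L2 M" "(\<lambda>k. L2_dist M (F k) f) \<longlonglongrightarrow> 0"
proof -
  have [measurable]: "F k \<in> borel_measurable M" for k
    using L2D[OF F] by simp
  have "\<forall>k. \<exists>N. \<forall>m\<ge>N. \<forall>n\<ge>N. L2_dist M (F m) (F n) < (1/2) ^ k"
    using cauchy by simp
  then obtain K where K: "\<And>k m n. m \<ge> K k \<Longrightarrow> n \<ge> K k \<Longrightarrow> L2_dist M (F m) (F n) < (1/2) ^ k"
    by metis
  \<comment> \<open>The partial sums of \<open>K\<close> give both \<open>r k \<ge> K k\<close> and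
    \<open>r (Suc k) \<ge> K k\<close> without monotonicity of \<open>K\<close>; the summand
    \<open>k\<close> makes \<open>r\<close> tend to infinity.\<close>
  define r where "r k = k + (\<Sum>j\<le>k. K j)" for k
  have rK: "r k \<ge> K k" for k
    unfolding r_def using member_le_sum[of k "{..k}" K] by simp
  have rS: "r (Suc k) \<ge> K k" for k
    unfolding r_def using member_le_sum[of k "{..Suc k}" K] by simp
  have rid: "r k \<ge> k" for k by (simp add: r_def)
  define \<Delta> where "\<Delta> k t = F (r (Suc k)) t - F (r k) t" for k t
  have [measurable]: "\<Delta> k \<in> borel_measurable M" for k unfolding \<Delta>_def by measurable
  have \<Delta>: "\<Delta> k \<in> L2 M" for k unfolding \<Delta>_def by (intro L2_diff F)
  have \<Delta>n: "L2_norm M (\<Delta> k) \<le> (1/2) ^ k" for k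
    using K[OF rS rK, of k] by (simp add: L2_dist_eq \<Delta>_def[abs_def] less_imp_le)
  have "(\<integral>\<^sup>+ t. (\<Sum>k. ennreal (2 ^ k * (cmod (\<Delta> k t))\<^sup>2)) \<partial>M)
      = (\<Sum>k. \<integral>\<^sup>+ t. ennreal (2 ^ k * (cmod (\<Delta> k t))\<^sup>2) \<partial>M)"
    by (rule nn_integral_suminf) measurable
  also have "\<dots> \<le> (\<Sum>k. ennreal ((1/2) ^ k))"
  proof (intro suminf_le allI)
    fix k
    have "(\<integral>\<^sup>+ t. ennreal (2 ^ k * (cmod (\<Delta> k t))\<^sup>2) \<partial>M) = ennreal (LINT t|M. 2 ^ k * (cmod (\<Delta> k t))\<^sup>2)"
      by (rule nn_integral_eq_integral) (use L2D[OF \<Delta>] in auto)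
    also have "(LINT t|M. 2 ^ k * (cmod (\<Delta> k t))\<^sup>2) = 2 ^ k * (L2_norm M (\<Delta> k))\<^sup>2"
      by (simp add: L2_norm_square)
    also have "\<dots> \<le> 2 ^ k * ((1/2) ^ k)\<^sup>2"
      by (intro mult_left_mono power_mono \<Delta>n) auto
    also have "\<dots> = (1/2) ^ k"
      by (simp add: power2_eq_square power_divide)
    finally show "(\<integral>\<^sup>+ t. ennreal (2 ^ k * (cmod (\<Delta> k t))\<^sup>2) \<partial>M) \<le> ennreal ((1/2) ^ k)"
      by (simp add: ennreal_leI)
  qed auto
  also have "\<dots> < \<infinity>"
    by (subst suminf_ennreal2) (auto intro!: summable_geometric)
  finally have "AE t in M. (\<Sum>k. ennreal (2 ^ k * (cmod (\<Delta> k t))\<^sup>2)) \<noteq> \<infinity>"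
    by (intro nn_integral_noteq_infinite) auto
  then have conv: "AE t in M. convergent (\<lambda>k. F (r k) t)"
  proof (rule AE_mp, intro AE_I2 impI)
    fix t assume fin: "(\<Sum>k. ennreal (2 ^ k * (cmod (\<Delta> k t))\<^sup>2)) \<noteq> \<infinity>"
    define S where "S = (\<Sum>k. ennreal (2 ^ k * (cmod (\<Delta> k t))\<^sup>2))"
    have "S \<noteq> top" using fin by (simp only: S_def infinity_ennreal_def not_False_eq_True)
    then obtain C where C: "C \<ge> 0" "S = ennreal C" by (cases S rule: ennreal_cases) auto
    \<comment> \<open>The weight \<open>2 ^ k\<close> pays off here: finiteness of the weighted sum
      bounds the k-th step by a multiple of 2^(-k/2), a summable geometric sequence.\<close>
    have bd: "2 ^ k * (cmod (\<Delta> k t))\<^sup>2 \<le> C" for k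
    proof -
      have "(\<Sum>j\<in>{k}. ennreal (2 ^ j * (cmod (\<Delta> j t))\<^sup>2)) \<le> S"
        unfolding S_def by (rule sum_le_suminf) auto
      with C show ?thesis by (simp only: sum.insert finite.emptyI sum.empty empty_iff not_False_eq_True add_0_right ennreal_le_iff)
    qed
    have bd\<Delta>: "norm (\<Delta> k t) \<le> sqrt C * (1 / sqrt 2) ^ k" for k
    proof (rule power2_le_imp_le)
      have eq: "(sqrt C * (1 / sqrt 2) ^ k)\<^sup>2 = C * ((1 / sqrt 2)\<^sup>2) ^ k"
        using C by (simp add: power_mult_distrib power_mult[symmetric] mult.commute)
      show "(cmod (\<Delta> k t))\<^sup>2 \<le> (sqrt C * (1 / sqrt 2) ^ k)\<^sup>2"
        unfolding eq using bd[of k] by (simp add: power_divide field_simps)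
    qed (use C in auto)
    have "summable (\<lambda>k. sqrt C * (1 / sqrt 2) ^ k)"
      by (intro summable_mult summable_geometric) simp
    then have "summable (\<lambda>k. \<Delta> k t)"
      by (rule summable_comparison_test'[where N = 0]) (rule bd\<Delta>)
    then have "(\<lambda>n. (\<Sum>k<n. \<Delta> k t)) \<longlonglongrightarrow> (\<Sum>k. \<Delta> k t)"
      by (rule summable_LIMSEQ)
    moreover have "(\<Sum>k<n. \<Delta> k t) = F (r n) t - F (r 0) t" for n
      unfolding \<Delta>_def by (rule sum_lessThan_telescope)
    ultimately have "(\<lambda>n. F (r n) t - F (r 0) t) \<longlonglongrightarrow> (\<Sum>k. \<Delta> k t)" by simp
    then have "(\<lambda>n. F (r n) t - F (r 0) t + F (r 0) t) \<longlonglongrightarrow> (\<Sum>k. \<Delta> k t) + F (r 0) t"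
      by (intro tendsto_add tendsto_const)
    then show "convergent (\<lambda>k. F (r k) t)"
      by (auto simp: convergent_def)
  qed
  \<comment> \<open>Where the subsequence diverges, \<open>lim\<close> is an unspecified value; this
    concerns a null set only.\<close>
  define f where "f t = lim (\<lambda>k. F (r k) t)" for t
  have fm [measurable]: "f \<in> borel_measurable M"
    unfolding f_def by (rule borel_measurable_lim_metric) measurable
  have lim: "AE t in M. (\<lambda>k. F (r k) t) \<longlonglongrightarrow> f t"
    using conv by eventually_elim (simp add: f_def convergent_LIMSEQ_iff)
  have close: "(\<lambda>t. F m t - f t) \<in> L2 M \<and> L2_dist M (F m) f \<le> (1/2) ^ k" if m: "m \<ge> K k" for m k
  proof -
    have "(\<integral>\<^sup>+ t. ennreal ((cmod (F m t - f t))\<^sup>2) \<partial>M)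
        = (\<integral>\<^sup>+ t. liminf (\<lambda>j. ennreal ((cmod (F m t - F (r j) t))\<^sup>2)) \<partial>M)"
    proof (rule nn_integral_cong_AE)
      show "AE t in M. ennreal ((cmod (F m t - f t))\<^sup>2)
          = liminf (\<lambda>j. ennreal ((cmod (F m t - F (r j) t))\<^sup>2))"
        using lim
      proof eventually_elim
        case (elim t)
        have "(\<lambda>j. ennreal ((cmod (F m t - F (r j) t))\<^sup>2)) \<longlonglongrightarrow> ennreal ((cmod (F m t - f t))\<^sup>2)"
          by (intro tendsto_ennrealI tendsto_intros elim)
        then show ?case
          by (intro lim_imp_Liminf[symmetric] trivial_limit_sequentially)
      qed
    qed
    also have "\<dots> \<le> liminf (\<lambda>j. \<integral>\<^sup>+ t. ennreal ((cmod (F m t - F (r j) t))\<^sup>2) \<partial>M)"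
      by (rule nn_integral_liminf) measurable
    also have "\<dots> \<le> ennreal (((1/2) ^ k)\<^sup>2)"
    proof (rule Liminf_le, simp)
      show "\<forall>\<^sub>F j in sequentially. (\<integral>\<^sup>+ t. ennreal ((cmod (F m t - F (r j) t))\<^sup>2) \<partial>M) \<le> ennreal (((1/2) ^ k)\<^sup>2)"
      proof (rule eventually_sequentiallyI[where c = "K k"])
        fix j assume "j \<ge> K k"
        then have j: "r j \<ge> K k" using rid[of j] by simp
        have "(\<integral>\<^sup>+ t. ennreal ((cmod (F m t - F (r j) t))\<^sup>2) \<partial>M) = ennreal ((L2_dist M (F m) (F (r j)))\<^sup>2)"
          unfolding L2_dist_eq L2_norm_square
          by (rule nn_integral_eq_integral) (use L2D[OF L2_diff[OF F F]] in auto)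
        also have "\<dots> \<le> ennreal (((1/2) ^ k)\<^sup>2)"
          using K[OF m j] by (intro ennreal_leI power_mono) (auto simp: L2_dist_eq)
        finally show "(\<integral>\<^sup>+ t. ennreal ((cmod (F m t - F (r j) t))\<^sup>2) \<partial>M) \<le> ennreal (((1/2) ^ k)\<^sup>2)" .
      qed
    qed
    finally have le: "(\<integral>\<^sup>+ t. ennreal ((cmod (F m t - f t))\<^sup>2) \<partial>M) \<le> ennreal (((1/2) ^ k)\<^sup>2)" .
    have int: "integrable M (\<lambda>t. (cmod (F m t - f t))\<^sup>2)"
      by (rule integrableI_nonneg) (use le in \<open>auto simp: order_le_less_trans[OF le]\<close>)
    then have L: "(\<lambda>t. F m t - f t) \<in> L2 M" by (simp add: L2_def)
    have "ennreal ((L2_dist M (F m) f)\<^sup>2) \<le> ennreal (((1/2) ^ k)\<^sup>2)"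
      unfolding L2_dist_eq L2_norm_square using le nn_integral_eq_integral[OF int] by simp
    then have "(L2_dist M (F m) f)\<^sup>2 \<le> ((1/2) ^ k)\<^sup>2"
      by (simp add: ennreal_le_iff)
    then have "L2_dist M (F m) f \<le> (1/2) ^ k"
      by (rule power2_le_imp_le) simp
    with L show ?thesis by simp
  qed
  show thesis
  proof
    have "(\<lambda>t. F (K 0) t - f t) \<in> L2 M"
      using close[of 0 "K 0"] by auto
    from L2_diff[OF F[of "K 0"] this] show "f \<in> L2 M" by simp
    show "(\<lambda>k. L2_dist M (F k) f) \<longlonglongrightarrow> 0"
    proof (rule LIMSEQ_I)
      fix e :: real assume "e > 0"
      then obtain k where k: "(1/2) ^ k < e" using real_arch_pow_inv[of e "1/2"] by auto
      show "\<exists>no. \<forall>n\<ge>no. norm (L2_dist M (F n) f - 0) < e"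
      proof (intro exI[of _ "K k"] allI impI)
        fix n assume "n \<ge> K k"
        with close[of k n] k show "norm (L2_dist M (F n) f - 0) < e"
          by (simp add: L2_dist_eq)
      qed
    qed
  qed
qed

section \<open>Projection onto the closure of a graph\<close>

definition linear_graph :: "'a measure \<Rightarrow> 'a op_graph \<Rightarrow> bool" where
  "linear_graph M A \<longleftrightarrow> A \<subseteq> L2 M \<times> L2 M \<and> A \<noteq> {} \<and>
     (\<forall>(f, g)\<in>A. \<forall>(f', g')\<in>A. \<forall>c c'. (\<lambda>t. c * f t + c' * f' t, \<lambda>t. c * g t + c' * g' t) \<in> A)"

lemma linear_graphD:
  assumes "linear_graph M A"
  shows "(f, g) \<in> A \<Longrightarrow> f \<in> L2 M" "(f, g) \<in> A \<Longrightarrow> g \<in> L2 M"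
    and "(f, g) \<in> A \<Longrightarrow> (f', g') \<in> A \<Longrightarrow> (\<lambda>t. c * f t + c' * f' t, \<lambda>t. c * g t + c' * g' t) \<in> A"
proof -
  show "(f, g) \<in> A \<Longrightarrow> f \<in> L2 M" "(f, g) \<in> A \<Longrightarrow> g \<in> L2 M"
    using assms by (auto simp: linear_graph_def)
  show "(\<lambda>t. c * f t + c' * f' t, \<lambda>t. c * g t + c' * g' t) \<in> A" if "(f, g) \<in> A" "(f', g') \<in> A"
    using assms that unfolding linear_graph_def by fast
qed

lemma linear_graphI:
  assumes "A \<subseteq> L2 M \<times> L2 M" "A \<noteq> {}"
    and "\<And>f g f' g' c c'. (f, g) \<in> A \<Longrightarrow> (f', g') \<in> A \<Longrightarrow>
      (\<lambda>t. c * f t + c' * f' t, \<lambda>t. c * g t + c' * g' t) \<in> A"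
  shows "linear_graph M A"
  unfolding linear_graph_def using assms by (intro conjI ballI) (auto split: prod.split)

text \<open>The limit \<open>(P, Q)\<close> is the point nearest to \<open>(u, v)\<close> in the
  closure of \<open>A\<close>. Orthogonality is derived along the minimising sequence, whose members
  can be varied inside \<open>A\<close>: a slack of 1 / (k + 1) in the squared distance leaves an
  inner product of order 1 / sqrt (k + 1).\<close>

lemma L2_graph_projection:
  assumes lin: "linear_graph M A" and u: "u \<in> L2 M" and v: "v \<in> L2 M"
  obtains F G P Q where "\<And>k::nat. (F k, G k) \<in> A" "P \<in> L2 M" "Q \<in> L2 M"
    "(\<lambda>k. L2_dist M (F k) P) \<longlonglongrightarrow> 0" "(\<lambda>k. L2_dist M (G k) Q) \<longlonglongrightarrow> 0"
    "\<And>f g. (f, g) \<in> A \<Longrightarrow> L2_inner M f (\<lambda>t. u t - P t) + L2_inner M g (\<lambda>t. v t - Q t) = 0"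
proof -
  define \<Phi> where "\<Phi> f g = (L2_norm M (\<lambda>t. u t - f t))\<^sup>2 + (L2_norm M (\<lambda>t. v t - g t))\<^sup>2" for f g
  define d where "d = Inf ((\<lambda>(f, g). \<Phi> f g) ` A)"
  have ne: "(\<lambda>(f, g). \<Phi> f g) ` A \<noteq> {}" using lin by (simp add: linear_graph_def)
  have bdd: "bdd_below ((\<lambda>(f, g). \<Phi> f g) ` A)"
    by (rule bdd_belowI[of _ 0]) (auto simp: \<Phi>_def)
  have dle: "d \<le> \<Phi> f g" if "(f, g) \<in> A" for f g
    unfolding d_def by (rule cInf_lower[OF _ bdd]) (use that in force)
  have "\<exists>p. p \<in> A \<and> \<Phi> (fst p) (snd p) < d + inverse (real (Suc k))" for k
  proof -
    have "Inf ((\<lambda>(f, g). \<Phi> f g) ` A) < d + inverse (real (Suc k))" unfolding d_def by simp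
    then show ?thesis using cInf_less_iff[OF ne bdd] by fastforce
  qed
  then obtain p where p: "\<And>k. p k \<in> A" "\<And>k. \<Phi> (fst (p k)) (snd (p k)) < d + inverse (real (Suc k))"
    by metis
  define F where "F k = fst (p k)" for k
  define G where "G k = snd (p k)" for k
  have FG: "(F k, G k) \<in> A" for k using p(1)[of k] by (simp add: F_def G_def)
  note FL = linear_graphD(1)[OF lin FG] and GL = linear_graphD(2)[OF lin FG]
  have \<Phi>k: "\<Phi> (F k) (G k) < d + inverse (real (Suc k))" for k
    using p(2)[of k] by (simp add: F_def G_def)
  have mid: "(L2_dist M (F m) (F n))\<^sup>2 + (L2_dist M (G m) (G n))\<^sup>2
      \<le> 2 * inverse (real (Suc m)) + 2 * inverse (real (Suc n))" for m n
  proof -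
    have "(\<lambda>t. (1/2) * F m t + (1/2) * F n t, \<lambda>t. (1/2) * G m t + (1/2) * G n t) \<in> A"
      by (rule linear_graphD(3)[OF lin FG FG])
    then have "d \<le> \<Phi> (\<lambda>t. (F m t + F n t) / 2) (\<lambda>t. (G m t + G n t) / 2)"
      using dle by (simp add: add_divide_distrib)
    then show ?thesis
      using L2_parallelogram[OF FL[of m] FL[of n] u] L2_parallelogram[OF GL[of m] GL[of n] v] \<Phi>k[of m] \<Phi>k[of n]
      unfolding \<Phi>_def L2_dist_eq by linarith
  qed
  have small: "\<exists>N::nat. \<forall>m\<ge>N. \<forall>n\<ge>N. 2 * inverse (real (Suc m)) + 2 * inverse (real (Suc n)) < e\<^sup>2"
    if "e > 0" for e :: real
  proof -
    obtain N where N: "inverse (real (Suc N)) < e\<^sup>2 / 4"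
      using reals_Archimedean[of "e\<^sup>2 / 4"] \<open>e > 0\<close> by auto
    have lt: "inverse (real (Suc m)) < e\<^sup>2 / 4" if "m \<ge> N" for m
    proof -
      have "inverse (real (Suc m)) \<le> inverse (real (Suc N))"
        by (rule le_imp_inverse_le) (use that in auto)
      with N show ?thesis by linarith
    qed
    then have "2 * inverse (real (Suc m)) + 2 * inverse (real (Suc n)) < e\<^sup>2" if "m \<ge> N" "n \<ge> N" for m n
      using lt[OF that(1)] lt[OF that(2)] by linarith
    then show ?thesis by blast
  qed
  have cF: "\<exists>N::nat. \<forall>m\<ge>N. \<forall>n\<ge>N. L2_dist M (F m) (F n) < e"
    and cG: "\<exists>N::nat. \<forall>m\<ge>N. \<forall>n\<ge>N. L2_dist M (G m) (G n) < e" if e: "e > 0" for e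
  proof -
    obtain N where N: "\<And>m n. m \<ge> N \<Longrightarrow> n \<ge> N \<Longrightarrow> 2 * inverse (real (Suc m)) + 2 * inverse (real (Suc n)) < e\<^sup>2"
      using small[OF e] by blast
    have "(L2_dist M (F m) (F n))\<^sup>2 < e\<^sup>2" "(L2_dist M (G m) (G n))\<^sup>2 < e\<^sup>2" if "m \<ge> N" "n \<ge> N" for m n
      using mid[of m n] N[OF that] zero_le_power2[of "L2_dist M (F m) (F n)"]
        zero_le_power2[of "L2_dist M (G m) (G n)"] by linarith+
    then have "L2_dist M (F m) (F n) < e" "L2_dist M (G m) (G n) < e" if "m \<ge> N" "n \<ge> N" for m n
      using that e power2_less_imp_less[of _ e] by (meson less_imp_le)+
    then show "\<exists>N::nat. \<forall>m\<ge>N. \<forall>n\<ge>N. L2_dist M (F m) (F n) < e"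
      "\<exists>N::nat. \<forall>m\<ge>N. \<forall>n\<ge>N. L2_dist M (G m) (G n) < e" by blast+
  qed
  obtain P where P: "P \<in> L2 M" "(\<lambda>k. L2_dist M (F k) P) \<longlonglongrightarrow> 0"
    using L2_complete[where F = F and M = M, OF FL cF] by blast
  obtain Q where Q: "Q \<in> L2 M" "(\<lambda>k. L2_dist M (G k) Q) \<longlonglongrightarrow> 0"
    using L2_complete[where F = G and M = M, OF GL cG] by blast
  show thesis
  proof (rule that[OF FG P(1) Q(1) P(2) Q(2)])
    fix f g assume fg: "(f, g) \<in> A"
    note fL = linear_graphD(1)[OF lin fg] and gL = linear_graphD(2)[OF lin fg]
    define B where "B = (L2_norm M f)\<^sup>2 + (L2_norm M g)\<^sup>2"
    define c where "c k = L2_inner M f (\<lambda>t. u t - F k t) + L2_inner M g (\<lambda>t. v t - G k t)" for k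
    have "(cmod (c k))\<^sup>2 \<le> B * inverse (real (Suc k))" for k
    proof -
      have "0 \<le> (B * (cmod (c k))\<^sup>2) * s\<^sup>2 + 2 * (- (cmod (c k))\<^sup>2) * s + inverse (real (Suc k))" for s :: real
      proof -
        \<comment> \<open>The factor \<open>cnj (c k)\<close> makes \<open>z * c k\<close> real, so
          that a quadratic in the real variable \<open>s\<close> captures the complex inner
          product.\<close>
        define z where "z = of_real s * cnj (c k)"
        have zc: "Re (z * c k) = s * (cmod (c k))\<^sup>2"
          by (simp add: z_def mult.assoc complex_norm_square[symmetric] mult.commute[of "cnj (c k)"] del: of_real_power)
        have zz: "(cmod z)\<^sup>2 = s\<^sup>2 * (cmod (c k))\<^sup>2"
          by (simp add: z_def norm_mult power_mult_distrib)
        have "(\<lambda>t. 1 * F k t + z * f t, \<lambda>t. 1 * G k t + z * g t) \<in> A"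
          by (rule linear_graphD(3)[OF lin FG fg])
        then have "d \<le> \<Phi> (\<lambda>t. F k t + z * f t) (\<lambda>t. G k t + z * g t)"
          using dle by simp
        also have "\<dots> = (L2_norm M (\<lambda>t. (u t - F k t) - z * f t))\<^sup>2 + (L2_norm M (\<lambda>t. (v t - G k t) - z * g t))\<^sup>2"
          by (simp add: \<Phi>_def algebra_simps)
        also have "\<dots> = \<Phi> (F k) (G k) - 2 * Re (z * c k) + (cmod z)\<^sup>2 * B"
          unfolding L2_norm_diff_cmult_square[OF L2_diff[OF u FL] fL] L2_norm_diff_cmult_square[OF L2_diff[OF v GL] gL]
          by (simp add: \<Phi>_def c_def B_def algebra_simps)
        also have "\<dots> < d + inverse (real (Suc k)) - 2 * (s * (cmod (c k))\<^sup>2) + s\<^sup>2 * (cmod (c k))\<^sup>2 * B"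
          using \<Phi>k[of k] by (simp add: zc zz del: times_complex.sel)
        finally show ?thesis by (simp add: algebra_simps)
      qed
      \<comment> \<open>The quadratic and the linear coefficient both carry the factor |c_k|^2,
        which is cancelled below.\<close>
      then have "(- (cmod (c k))\<^sup>2)\<^sup>2 \<le> (B * (cmod (c k))\<^sup>2) * inverse (real (Suc k))"
        by (rule discriminant_bound[rotated]) (simp add: B_def)
      then have "(cmod (c k))\<^sup>2 * (cmod (c k))\<^sup>2 \<le> (cmod (c k))\<^sup>2 * (B * inverse (real (Suc k)))"
        by (simp add: power2_eq_square mult_ac)
      note le = this
      show ?thesis
      proof (cases "c k = 0")
        case True
        then show ?thesis by (simp add: B_def)
      next
        case False
        then have "0 < (cmod (c k))\<^sup>2" by simp
        with le show ?thesis by (rule mult_left_le_imp_le)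
      qed
    qed
    moreover have "(\<lambda>k. B * inverse (real (Suc k))) \<longlonglongrightarrow> 0"
      using tendsto_mult_left[OF LIMSEQ_inverse_real_of_nat, of B] by simp
    ultimately have "(\<lambda>k. (cmod (c k))\<^sup>2) \<longlonglongrightarrow> 0"
      by (intro tendsto_sandwich[of "\<lambda>_. 0" "\<lambda>k. (cmod (c k))\<^sup>2" sequentially "\<lambda>k. B * inverse (real (Suc k))" 0])
         (auto simp del: of_nat_Suc)
    then have c0: "c \<longlonglongrightarrow> 0"
      using tendsto_real_sqrt[of "\<lambda>k. (cmod (c k))\<^sup>2" 0 sequentially] by (simp add: tendsto_norm_zero_iff)
    have fP: "(\<lambda>k. L2_inner M f (F k)) \<longlonglongrightarrow> L2_inner M f P"
      using tendsto_cnj[OF L2_inner_tendsto_left[OF FL P(1) fL P(2)]]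
      by (simp flip: L2_inner_cnj_commute)
    have gQ: "(\<lambda>k. L2_inner M g (G k)) \<longlonglongrightarrow> L2_inner M g Q"
      using tendsto_cnj[OF L2_inner_tendsto_left[OF GL Q(1) gL Q(2)]]
      by (simp flip: L2_inner_cnj_commute)
    have "c \<longlonglongrightarrow> (L2_inner M f u - L2_inner M f P) + (L2_inner M g v - L2_inner M g Q)"
      unfolding c_def L2_inner_diff_right[OF u FL fL] L2_inner_diff_right[OF v GL gL]
      by (intro tendsto_intros fP gQ)
    with c0 have "(L2_inner M f u - L2_inner M f P) + (L2_inner M g v - L2_inner M g Q) = 0"
      using LIMSEQ_unique by blast
    then show "L2_inner M f (\<lambda>t. u t - P t) + L2_inner M g (\<lambda>t. v t - Q t) = 0"
      by (simp add: L2_inner_diff_right u v P Q fL gL)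
  qed
qed

text \<open>\<open>D\<close> is meant to be a concretely described set that is only known to contain
  \<open>A\<close> and its adjoint; symmetry on \<open>D\<close> then makes the adjoint symmetric.
  The last assumption yields density: a function h orthogonal to the domain of \<open>A\<close>
  gives the pair (0, h) in the adjoint.\<close>

theorem self_adjoint_closureI:
  fixes M :: "'a measure"
  assumes lin: "linear_graph M A"
    and D: "A \<subseteq> D" "op_adjoint M A \<subseteq> D" "D \<subseteq> L2 M \<times> L2 M"
    and sym: "\<And>f g u v. (f, g) \<in> D \<Longrightarrow> (u, v) \<in> D \<Longrightarrow> L2_inner M g u = L2_inner M f v"
    and zero: "\<And>h. (\<lambda>_. 0, h) \<in> D \<Longrightarrow> AE t in M. h t = 0"
  shows "self_adjoint M (op_closure M A)"
proof -
  note AL = linear_graphD[OF lin]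
  have sub: "A \<subseteq> op_closure M A"
  proof (rule subsetI, clarify)
    fix f g assume fg: "(f, g) \<in> A"
    then have "L2_dist M f f = 0" "L2_dist M g g = 0" by (simp_all add: L2_dist_def)
    then have "(\<lambda>k::nat. L2_dist M f f) \<longlonglongrightarrow> 0" "(\<lambda>k::nat. L2_dist M g g) \<longlonglongrightarrow> 0" by simp_all
    moreover have "f \<in> L2 M" "g \<in> L2 M" using AL(1,2) fg by auto
    ultimately show "(f, g) \<in> op_closure M A"
      unfolding op_closure_def mem_Collect_eq prod.case using fg
      by (intro conjI, simp, simp, rule_tac x = "\<lambda>_. f" in exI, rule_tac x = "\<lambda>_. g" in exI, simp)
  qed
  have lim: "L2_inner M g u = L2_inner M f v"
    if fg: "(f, g) \<in> op_closure M A" and uv: "(u, v) \<in> op_adjoint M A" for f g u v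
  proof -
    from fg obtain F G where FG: "f \<in> L2 M" "g \<in> L2 M" "\<And>k. (F k, G k) \<in> A"
      "(\<lambda>k. L2_dist M (F k) f) \<longlonglongrightarrow> 0" "(\<lambda>k. L2_dist M (G k) g) \<longlonglongrightarrow> 0"
      by (auto simp: op_closure_def)
    from uv have uv': "u \<in> L2 M" "v \<in> L2 M" "\<And>k. L2_inner M (G k) u = L2_inner M (F k) v"
      using FG(3) by (auto simp: op_adjoint_def)
    have "(\<lambda>k. L2_inner M (G k) u) \<longlonglongrightarrow> L2_inner M g u"
      by (rule L2_inner_tendsto_left) (use FG(1,2,4,5) uv'(1,2) AL(1,2)[OF FG(3)] in auto)
    moreover have "(\<lambda>k. L2_inner M (F k) v) \<longlonglongrightarrow> L2_inner M f v"
      by (rule L2_inner_tendsto_left) (use FG(1,2,4,5) uv'(1,2) AL(1,2)[OF FG(3)] in auto)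
    ultimately show ?thesis using uv'(3) LIMSEQ_unique by auto
  qed
  have adj: "op_adjoint M (op_closure M A) = op_adjoint M A"
  proof
    show "op_adjoint M (op_closure M A) \<subseteq> op_adjoint M A"
      using sub by (auto simp: op_adjoint_def)
    show "op_adjoint M A \<subseteq> op_adjoint M (op_closure M A)"
    proof (rule subsetI, clarify)
      fix u v assume uv: "(u, v) \<in> op_adjoint M A"
      with lim[OF _ uv] show "(u, v) \<in> op_adjoint M (op_closure M A)"
        unfolding op_adjoint_def by blast
    qed
  qed
  have Aadj: "A \<subseteq> op_adjoint M A"
    using sym[OF subsetD[OF D(1)] subsetD[OF D(1)]] AL(1,2) by (auto simp: op_adjoint_def)
  have cl_adj: "op_closure M A \<subseteq> op_adjoint M A"
  proof (rule subsetI, clarify)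
    fix u v assume uv: "(u, v) \<in> op_closure M A"
    have "L2_inner M g u = L2_inner M f v" if fg: "(f, g) \<in> A" for f g
    proof -
      have "L2_inner M v f = L2_inner M u g"
        using lim[OF uv] Aadj fg by blast
      then show ?thesis using L2_inner_cnj_commute by metis
    qed
    with uv show "(u, v) \<in> op_adjoint M A"
      by (auto simp: op_adjoint_def op_closure_def)
  qed
  have adj_cl: "op_adjoint M A \<subseteq> op_closure M A"
  proof (rule subsetI, clarify)
    fix u v assume uv: "(u, v) \<in> op_adjoint M A"
    then have uL: "u \<in> L2 M" and vL: "v \<in> L2 M" by (auto simp: op_adjoint_def)
    obtain F G P Q where FG: "\<And>k::nat. (F k, G k) \<in> A" and PL: "P \<in> L2 M" and QL: "Q \<in> L2 M"
      and lims: "(\<lambda>k. L2_dist M (F k) P) \<longlonglongrightarrow> 0" "(\<lambda>k. L2_dist M (G k) Q) \<longlonglongrightarrow> 0"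
      and orth: "\<And>f g. (f, g) \<in> A \<Longrightarrow> L2_inner M f (\<lambda>t. u t - P t) + L2_inner M g (\<lambda>t. v t - Q t) = 0"
      by (rule L2_graph_projection[OF lin uL vL]) (rule that; assumption)
    let ?e = "\<lambda>t. u t - P t" and ?h = "\<lambda>t. v t - Q t"
    have eL: "?e \<in> L2 M" and hL: "?h \<in> L2 M" by (intro L2_diff uL vL PL QL)+
    have PQ: "(P, Q) \<in> op_adjoint M A"
      using cl_adj PL QL FG lims by (auto simp: op_closure_def)
    have "(?e, ?h) \<in> op_adjoint M A"
      using uv PQ eL hL AL(1,2) by (fastforce simp: op_adjoint_def L2_inner_diff_right)
    moreover have "(?h, \<lambda>t. - ?e t) \<in> op_adjoint M A"
      unfolding op_adjoint_def using orth hL L2_uminus[OF eL]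
      by (auto simp del: minus_diff_eq simp: L2_inner_uminus_right add_eq_0_iff)
    ultimately have "L2_inner M ?h ?h = L2_inner M ?e (\<lambda>t. - ?e t)"
      using D(2) sym by blast
    then have "complex_of_real ((L2_norm M ?h)\<^sup>2 + (L2_norm M ?e)\<^sup>2) = 0"
      by (simp only: L2_inner_uminus_right L2_inner_self of_real_add left_minus)
    then have "(L2_norm M ?h)\<^sup>2 + (L2_norm M ?e)\<^sup>2 = 0"
      by (simp only: of_real_eq_0_iff)
    then have "L2_norm M ?h = 0" "L2_norm M ?e = 0"
      by (simp_all add: add_nonneg_eq_0_iff)
    then have ae: "AE t in M. v t = Q t" "AE t in M. u t = P t"
      using L2_norm_eq_0_imp_AE[OF hL] L2_norm_eq_0_imp_AE[OF eL] by simp_all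
    have "L2_dist M (F k) u = L2_dist M (F k) P" "L2_dist M (G k) v = L2_dist M (G k) Q" for k
      unfolding L2_dist_eq using ae AL(1,2)[OF FG[of k]] uL vL PL QL
      by (auto intro!: L2_norm_cong_AE L2D(1) L2_diff)
    with lims have "(\<lambda>k. L2_dist M (F k) u) \<longlonglongrightarrow> 0" "(\<lambda>k. L2_dist M (G k) v) \<longlonglongrightarrow> 0"
      by simp_all
    with uL vL FG show "(u, v) \<in> op_closure M A"
      unfolding op_closure_def by blast
  qed
  have "densely_defined M (op_closure M A)"
    unfolding densely_defined_def
  proof (intro ballI allI impI)
    fix h and e :: real assume h: "h \<in> L2 M" and e: "e > 0"
    \<comment> \<open>The zero operator on the domain of \<open>A\<close>: projecting onto its graph
      amounts to projecting onto the closure of the domain, since the second components contribute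
      nothing to the orthogonality relation.\<close>
    let ?A0 = "(\<lambda>(f, g). (f, \<lambda>_. 0)) ` A :: 'a op_graph"
    have lin0: "linear_graph M ?A0"
    proof (rule linear_graphI)
      have *: "(\<lambda>t. c * f t + c' * f' t, \<lambda>_. 0) \<in> ?A0" if "(f, g) \<in> A" "(f', g') \<in> A" for f g f' g' c c'
        by (rule image_eqI[OF _ AL(3)[OF that, of c c']]) simp
      show "?A0 \<subseteq> L2 M \<times> L2 M" using AL(1) by auto
      show "?A0 \<noteq> {}" using lin by (auto simp: linear_graph_def)
      fix f g f' g' :: "'a \<Rightarrow> complex" and c c' assume "(f, g) \<in> ?A0" "(f', g') \<in> ?A0"
      then have "\<exists>h. (f, h) \<in> A" "\<exists>h. (f', h) \<in> A" and g: "g = (\<lambda>_. 0)" "g' = (\<lambda>_. 0)" by auto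
      then obtain h h' where "(f, h) \<in> A" "(f', h') \<in> A" by blast
      from *[OF this, of c c'] show "(\<lambda>t. c * f t + c' * f' t, \<lambda>t. c * g t + c' * g' t) \<in> ?A0"
        by (simp only: g mult_zero_right add_0_right)
    qed
    obtain F G P Q where FG: "\<And>k::nat. (F k, G k) \<in> ?A0" and PL: "P \<in> L2 M" and QL: "Q \<in> L2 M"
      and lims: "(\<lambda>k. L2_dist M (F k) P) \<longlonglongrightarrow> 0" "(\<lambda>k. L2_dist M (G k) Q) \<longlonglongrightarrow> 0"
      and orth: "\<And>f g. (f, g) \<in> ?A0 \<Longrightarrow> L2_inner M f (\<lambda>t. h t - P t) + L2_inner M g (\<lambda>t. h t - Q t) = 0"
      by (rule L2_graph_projection[OF lin0 h h]) (rule that; assumption)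
    have "(\<lambda>_. 0, \<lambda>t. h t - P t) \<in> op_adjoint M A"
      unfolding op_adjoint_def using orth L2_diff[OF h PL] by (force simp: L2_inner_def)
    then have ae: "AE t in M. h t = P t"
      using D(2) zero[of "\<lambda>t. h t - P t"] by auto
    have FL: "F k \<in> L2 M" for k using FG[of k] AL(1,2) by auto
    have eq: "L2_dist M (F k) h = L2_dist M (F k) P" for k
      unfolding L2_dist_eq using ae FL[of k] h PL by (auto intro!: L2_norm_cong_AE L2D(1) L2_diff)
    have "\<forall>\<^sub>F k in sequentially. L2_dist M (F k) P < e"
      using order_tendstoD(2)[OF lims(1) e] .
    then obtain k where "L2_dist M (F k) P < e" using eventually_happens by force
    with eq have "L2_dist M (F k) h < e" by simp
    moreover obtain g where "(F k, g) \<in> A" using FG[of k] by auto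
    ultimately show "\<exists>(f, g)\<in>op_closure M A. L2_dist M f h < e" using sub by blast
  qed
  moreover have "op_adjoint M (op_closure M A) = op_closure M A"
    using adj cl_adj adj_cl by simp
  ultimately show ?thesis by (simp add: self_adjoint_def)
qed

section \<open>Absolutely continuous functions\<close>

lemma division_of_realE:
  fixes s :: "real set"
  assumes "D division_of s" "K \<in> D"
  obtains u v where "K = {u..v}" "u \<le> v" "Sup K = v" "Inf K = u"
proof -
  from division_ofD(4)[OF assms] obtain u v where K: "K = {u..v}" by auto
  with division_ofD(3)[OF assms] have "u \<le> v" by auto
  with K that show thesis by simp
qed

text \<open>Absolute continuity is phrased by lengths of intervals, whereas null sets are covered by
  open sets of small measure; this passes from one to the other.\<close>

lemma division_of_real_measure:
  fixes s :: "real set"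
  assumes D: "D division_of s"
  shows "s \<in> lmeasurable" "measure lebesgue s = (\<Sum>K\<in>D. Sup K - Inf K)"
proof -
  have fin: "finite D" and un: "\<Union>D = s" using division_ofD[OF D] by auto
  have "K \<in> lmeasurable" if "K \<in> D" for K
    using division_of_realE[OF D that] by (metis lmeasurable_interval(1) interval_cbox lmeasurable_cbox)
  then have "\<Union>D \<in> lmeasurable" using fin by (intro fmeasurable.finite_Union) auto
  then show s: "s \<in> lmeasurable" by (simp only: un)
  have "measure lebesgue s = integral s (\<lambda>_. 1::real)" by (rule lmeasure_integral[OF s])
  also have "\<dots> = (\<Sum>K\<in>D. integral K (\<lambda>_. 1::real))"
  proof (rule integral_combine_division_bottomup[OF D])
    fix K assume "K \<in> D"
    then obtain u v where "K = {u..v}" using division_of_realE[OF D] by metis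
    then show "(\<lambda>_. 1::real) integrable_on K"
      by (simp add: integrable_continuous_interval)
  qed
  also have "\<dots> = (\<Sum>K\<in>D. Sup K - Inf K)"
  proof (rule sum.cong[OF refl])
    fix K assume "K \<in> D"
    then obtain u v where "K = {u..v}" "u \<le> v" "Sup K = v" "Inf K = u" using division_of_realE[OF D] by metis
    then show "integral K (\<lambda>_. 1::real) = Sup K - Inf K" by simp
  qed
  finally show "measure lebesgue s = (\<Sum>K\<in>D. Sup K - Inf K)" .
qed

lemma abs_cont_onE:
  assumes "abs_cont_on a c F" "e > 0"
  obtains \<delta> where "\<delta> > 0" "\<And>D s. D division_of s \<Longrightarrow> s \<subseteq> {a..c} \<Longrightarrow> (\<Sum>K\<in>D. Sup K - Inf K) < \<delta>
       \<Longrightarrow> (\<Sum>K\<in>D. cmod (F (Sup K) - F (Inf K))) < e"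
proof -
  from assms(1)[unfolded abs_cont_on_def, THEN spec, THEN mp, OF assms(2)]
  obtain \<delta> where \<delta>: "\<delta> > 0 \<and> (\<forall>D s. D division_of s \<and> s \<subseteq> {a..c} \<and> (\<Sum>K\<in>D. Sup K - Inf K) < \<delta>
       \<longrightarrow> (\<Sum>K\<in>D. cmod (F (Sup K) - F (Inf K))) < e)" by (elim exE)
  show thesis
    by (rule that[OF conjunct1[OF \<delta>]]) (rule conjunct2[OF \<delta>, THEN spec, THEN spec, THEN mp], intro conjI)
qed

text \<open>
  In the gauge proof the tags lying in the exceptional null set are controlled by absolute
  continuity, after replacing the derivative by \<open>0\<close> there; the others by the derivative.
\<close>

lemma abs_cont_on_FTC:
  fixes F f :: "real \<Rightarrow> complex"
  assumes ac: "a \<le> c" and AC: "abs_cont_on a c F" and N: "negligible N"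
    and der: "\<And>t. t \<in> {a..c} - N \<Longrightarrow> (F has_vector_derivative f t) (at t within {a..c})"
  shows "(f has_integral (F c - F a)) {a..c}"
proof -
  define g where "g t = (if t \<in> N then 0 else f t)" for t
  have "(g has_integral (F c - F a)) {a..c}"
    unfolding has_integral_real
  proof (intro allI impI)
    fix e :: real assume e: "e > 0"
    then have e2: "e / 2 > 0" by simp
    obtain \<delta> where \<delta>: "\<delta> > 0" "\<And>D s. D division_of s \<Longrightarrow> s \<subseteq> {a..c} \<Longrightarrow> (\<Sum>K\<in>D. Sup K - Inf K) < \<delta>
       \<Longrightarrow> (\<Sum>K\<in>D. cmod (F (Sup K) - F (Inf K))) < e / 2"
      by (rule abs_cont_onE[OF AC e2]) (rule that; assumption)
    \<comment> \<open>All intervals tagged in \<open>N\<close> will lie in \<open>O'\<close>, so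
      their total length stays below \<open>\<delta>\<close>.\<close>
    obtain O' where O: "open O'" "N \<subseteq> O'" "O' \<in> lmeasurable" "measure lebesgue O' < \<delta>"
    proof -
      have NL: "N \<in> sets lebesgue" "N \<in> lmeasurable" and N0: "measure lebesgue N = 0"
        using N negligible_iff_measure by (auto intro: fmeasurableD)
      obtain T where T: "open T" "N \<subseteq> T" "T - N \<in> lmeasurable" "emeasure lebesgue (T - N) < ennreal \<delta>"
        using sets_lebesgue_outer_open[OF NL(1) \<delta>(1)] by metis
      have TN: "T = (T - N) \<union> N" using T by auto
      have Tm: "T \<in> lmeasurable" by (subst TN) (intro fmeasurable.Un T NL)
      have "measure lebesgue T \<le> measure lebesgue (T - N) + measure lebesgue N"
        by (subst TN, rule measure_Un_le) (use T NL in auto)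
      also have "\<dots> < \<delta>"
        using T(3,4) \<delta>(1) N0 by (simp add: emeasure_eq_measure2 fmeasurableD2 ennreal_less_iff)
      finally show thesis using T Tm that by blast
    qed
    \<comment> \<open>The \<open>+ 1\<close> covers the degenerate case
      \<open>a = c\<close>.\<close>
    define e' where "e' = e / (2 * (c - a + 1))"
    have e': "e' > 0" "e' * (c - a) < e / 2" using e ac by (auto simp: e'_def field_simps)
    have "\<exists>d>0. \<forall>y\<in>{a..c}. \<bar>y - t\<bar> < d \<longrightarrow> cmod (F y - F t - (y - t) *\<^sub>R f t) \<le> e' * \<bar>y - t\<bar>"
      if "t \<in> {a..c} - N" for t
      using der[OF that] e'(1) unfolding has_vector_derivative_def has_derivative_within_alt real_norm_def by blast
    then obtain d where d: "\<And>t. t \<in> {a..c} - N \<Longrightarrow> d t > 0"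
      "\<And>t y. t \<in> {a..c} - N \<Longrightarrow> y \<in> {a..c} \<Longrightarrow> \<bar>y - t\<bar> < d t \<Longrightarrow> cmod (F y - F t - (y - t) *\<^sub>R f t) \<le> e' * \<bar>y - t\<bar>"
      by metis
    define \<gamma> where "\<gamma> t = (if t \<in> N then O' else if t \<in> {a..c} then ball t (d t) else ball t 1)" for t
    have gauge: "gauge \<gamma>"
      using O d(1) by (auto simp: gauge_def \<gamma>_def)
    have est: "cmod ((\<Sum>(t, K)\<in>p. measure lborel K *\<^sub>R g t) - (F c - F a)) < e"
      if p: "p tagged_division_of {a..c}" and fine: "\<gamma> fine p" for p
    proof -
      note pD = tagged_division_ofD[OF p]
      have pK: "\<exists>u v. K = {u..v} \<and> u \<le> t \<and> t \<le> v \<and> u \<in> {a..c} \<and> v \<in> {a..c} \<and> Sup K = v \<and> Inf K = u \<and> measure lborel K = v - u \<and> t \<in> {a..c} \<and> K \<subseteq> \<gamma> t"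
        if tK: "(t, K) \<in> p" for t K
      proof -
        obtain u v where K: "K = {u..v}" using pD(4)[OF tK] by auto
        have t: "t \<in> {u..v}" and sub: "{u..v} \<subseteq> {a..c}" using pD(2,3)[OF tK] K by auto
        then have "u \<in> {a..c}" "v \<in> {a..c}" "t \<in> {a..c}" by auto
        moreover have "K \<subseteq> \<gamma> t" using fine tK by (auto simp: fine_def)
        ultimately show ?thesis using K t by auto
      qed
      define pN where "pN = {q \<in> p. fst q \<in> N}"
      define pM where "pM = {q \<in> p. fst q \<notin> N}"
      have split: "p = pN \<union> pM" "pN \<inter> pM = {}" and fins: "finite pN" "finite pM"
        using pD(1) by (auto simp: pN_def pM_def)
      have "(\<Sum>(t, K)\<in>p. measure lborel K *\<^sub>R g t) - (F c - F a)
          = (\<Sum>(t, K)\<in>p. measure lborel K *\<^sub>R g t - (F (Sup K) - F (Inf K)))"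
        using additive_tagged_division_1[OF ac p, of F] by (simp add: sum_subtractf split_beta)
      also have "cmod \<dots> \<le> (\<Sum>(t, K)\<in>p. cmod (measure lborel K *\<^sub>R g t - (F (Sup K) - F (Inf K))))"
        by (rule order_trans[OF norm_sum]) (simp add: split_beta)
      also have "\<dots> = (\<Sum>(t, K)\<in>pN. cmod (measure lborel K *\<^sub>R g t - (F (Sup K) - F (Inf K))))
          + (\<Sum>(t, K)\<in>pM. cmod (measure lborel K *\<^sub>R g t - (F (Sup K) - F (Inf K))))"
        unfolding split(1) by (rule sum.union_disjoint[OF fins split(2)])
      also have "\<dots> < e / 2 + e / 2"
      proof (rule add_less_le_mono)
        have pNt: "pN tagged_division_of \<Union>(snd ` pN)"
          by (rule tagged_partial_division_of_Union_self, rule tagged_partial_division_subset[of p "{a..c}"])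
             (use p in \<open>auto simp: tagged_division_of_def pN_def\<close>)
        have div: "snd ` pN division_of \<Union>(snd ` pN)"
          by (rule division_of_tagged_division[OF pNt])
        have sub: "\<Union>(snd ` pN) \<subseteq> {a..c}" using pD(3) by (force simp: pN_def)
        have subO: "\<Union>(snd ` pN) \<subseteq> O'"
          using pK by (fastforce simp: pN_def \<gamma>_def)
        have "(\<Sum>K\<in>snd ` pN. Sup K - Inf K) \<le> measure lebesgue O'"
          using division_of_real_measure[OF div] subO O(3)
          by (metis measure_mono_fmeasurable fmeasurableD)
        also have "\<dots> < \<delta>" by (rule O)
        finally have small: "(\<Sum>K\<in>snd ` pN. cmod (F (Sup K) - F (Inf K))) < e / 2"
          by (rule \<delta>(2)[OF div sub])
        have "(\<Sum>(t, K)\<in>pN. cmod (measure lborel K *\<^sub>R g t - (F (Sup K) - F (Inf K))))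
           = (\<Sum>(t, K)\<in>pN. cmod (F (Sup K) - F (Inf K)))"
          by (rule sum.cong) (auto simp: pN_def g_def norm_minus_commute)
        \<comment> \<open>Reindexing by intervals requires summands that vanish on degenerate
          intervals. A degenerate \<open>cbox\<close> may be empty, where \<open>Sup\<close> and
          \<open>Inf\<close> are unspecified; hence the case distinction.\<close>
        also have "\<dots> = (\<Sum>(t, K)\<in>pN. (if K = {} then 0 else cmod (F (Sup K) - F (Inf K))))"
          by (rule sum.cong) (auto simp: pN_def dest: pD(2))
        also have "\<dots> = (\<Sum>K\<in>snd ` pN. (if K = {} then 0 else cmod (F (Sup K) - F (Inf K))))"
        proof (rule sum.over_tagged_division_lemma[OF pNt])
          fix u v :: real assume "box u v = {}"
          then have "v \<le> u" by (simp add: box_real)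
          then show "(if cbox u v = {} then 0 else cmod (F (Sup (cbox u v)) - F (Inf (cbox u v)))) = 0"
            by (cases "v = u") auto
        qed
        also have "\<dots> \<le> (\<Sum>K\<in>snd ` pN. cmod (F (Sup K) - F (Inf K)))"
          by (rule sum_mono) auto
        finally show "(\<Sum>(t, K)\<in>pN. cmod (measure lborel K *\<^sub>R g t - (F (Sup K) - F (Inf K)))) < e / 2"
          using small by linarith
        have "(\<Sum>(t, K)\<in>pM. cmod (measure lborel K *\<^sub>R g t - (F (Sup K) - F (Inf K)))) \<le> (\<Sum>(t, K)\<in>pM. e' * measure lborel K)"
        proof (rule sum_mono, clarify)
          fix t K assume tK: "(t, K) \<in> pM"
          then have "(t, K) \<in> p" and tN: "t \<notin> N" by (auto simp: pM_def)
          then obtain u v where uv: "K = {u..v}" "u \<le> t" "t \<le> v" "u \<in> {a..c}" "v \<in> {a..c}" "Sup K = v" "Inf K = u"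
            "measure lborel K = v - u" "t \<in> {a..c}" "K \<subseteq> \<gamma> t" using pK by metis
          have "u \<in> \<gamma> t" "v \<in> \<gamma> t" using uv by auto
          then have b: "\<bar>u - t\<bar> < d t" "\<bar>v - t\<bar> < d t" using tN uv by (auto simp: \<gamma>_def dist_real_def)
          have tt: "t \<in> {a..c} - N" using uv tN by simp
          have "measure lborel K *\<^sub>R g t - (F (Sup K) - F (Inf K))
              = (F u - F t - (u - t) *\<^sub>R f t) - (F v - F t - (v - t) *\<^sub>R f t)"
            using tN uv by (simp add: g_def algebra_simps)
          also have "cmod \<dots> \<le> e' * \<bar>u - t\<bar> + e' * \<bar>v - t\<bar>"
            by (rule order_trans[OF norm_triangle_ineq4]) (intro add_mono d(2) tt uv b)
          also have "\<dots> = e' * measure lborel K" using uv by (simp add: algebra_simps)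
          finally show "cmod (measure lborel K *\<^sub>R g t - (F (Sup K) - F (Inf K))) \<le> e' * measure lborel K" .
        qed
        also have "\<dots> \<le> (\<Sum>(t, K)\<in>p. e' * measure lborel K)"
          by (rule sum_mono2) (use pD(1) e' in \<open>auto simp: pM_def\<close>)
        also have "\<dots> = e' * (\<Sum>(t, K)\<in>p. measure lborel K)" by (simp add: sum_distrib_left split_beta)
        also have "\<dots> = e' * (c - a)"
          using additive_content_tagged_division[of p a c] p ac by simp
        finally show "(\<Sum>(t, K)\<in>pM. cmod (measure lborel K *\<^sub>R g t - (F (Sup K) - F (Inf K)))) \<le> e / 2"
          using e' by linarith
      qed
      finally show ?thesis by simp
    qed
    show "\<exists>\<gamma>. gauge \<gamma> \<and> (\<forall>\<D>. \<D> tagged_division_of {a..c} \<and> \<gamma> fine \<D> \<longrightarrow>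
        cmod ((\<Sum>(t, K)\<in>\<D>. measure lborel K *\<^sub>R g t) - (F c - F a)) < e)"
      by (intro exI[of _ \<gamma>] conjI allI impI gauge, elim conjE, rule est)
  qed
  then show ?thesis
    by (rule has_integral_spike[OF N, rotated]) (auto simp: g_def)
qed

text \<open>\<open>integrable_ccontinuous_explicit\<close> controls averages over
  \<open>[t, t + k]\<close> with positive \<open>k\<close>, that is, right derivatives. Applied to
  the reflected function it controls left derivatives, outside a null set that is reflected
  back.\<close>

lemma integral_has_vector_derivative_AE:
  fixes f :: "real \<Rightarrow> complex"
  assumes f: "f integrable_on {a..c}"
  obtains N where "negligible N"
    "\<And>t. t \<in> {a<..<c} - N \<Longrightarrow> ((\<lambda>s. integral {a..s} f) has_vector_derivative f t) (at t)"
proof -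
  define g where "g t = (if t \<in> {a..c} then f t else 0)" for t
  define h where "h t = g (- t)" for t
  have gU: "g integrable_on UNIV"
    unfolding g_def using f by (rule iffD2[OF Henstock_Kurzweil_Integration.integrable_restrict_UNIV])
  have gi: "g integrable_on cbox u v" for u v
    using integrable_on_subcbox[OF gU] by simp
  have hi: "h integrable_on cbox u v" for u v
    using gi[of "-v" "-u"] integrable_reflect[where f = g and a = "-v" and b = "-u"] by (simp add: h_def[abs_def])
  obtain N1 where N1: "negligible N1" "\<And>x e. x \<notin> N1 \<Longrightarrow> 0 < e \<Longrightarrow>
      \<exists>d>0. \<forall>k. 0 < k \<and> k < d \<longrightarrow> norm (integral (cbox x (x + k *\<^sub>R One)) g /\<^sub>R k ^ DIM(real) - g x) < e"
    using integrable_ccontinuous_explicit[OF gi] by metis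
  obtain N2 where N2: "negligible N2" "\<And>x e. x \<notin> N2 \<Longrightarrow> 0 < e \<Longrightarrow>
      \<exists>d>0. \<forall>k. 0 < k \<and> k < d \<longrightarrow> norm (integral (cbox x (x + k *\<^sub>R One)) h /\<^sub>R k ^ DIM(real) - h x) < e"
    using integrable_ccontinuous_explicit[OF hi] by metis
  have "negligible (uminus ` N2)"
    by (rule negligible_differentiable_image_negligible[OF _ N2(1)]) (auto intro: derivative_intros)
  with N1(1) have "negligible (N1 \<union> uminus ` N2)" by (rule negligible_Un)
  moreover have "((\<lambda>s. integral {a..s} f) has_vector_derivative f t) (at t)"
    if t: "t \<in> {a<..<c} - (N1 \<union> uminus ` N2)" for t
    unfolding has_vector_derivative_def has_derivative_at_alt
  proof (intro conjI allI impI)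
    show "bounded_linear (\<lambda>x. x *\<^sub>R f t)" by (rule bounded_linear_scaleR_left)
    fix e :: real assume e: "e > 0"
    have tN: "t \<notin> N1" "- t \<notin> N2" using t by force+
    obtain d1 where d1: "d1 > 0" "\<And>k. 0 < k \<Longrightarrow> k < d1 \<Longrightarrow> norm (integral {t..t + k} g /\<^sub>R k - g t) < e"
      using N1(2)[OF tN(1) e] by auto
    obtain d2 where d2: "d2 > 0" "\<And>k. 0 < k \<Longrightarrow> k < d2 \<Longrightarrow> norm (integral {- t..- t + k} h /\<^sub>R k - h (- t)) < e"
      using N2(2)[OF tN(2) e] by auto
    define d where "d = min (min d1 d2) (min (t - a) (c - t))"
    have d0: "d > 0" using d1 d2 t by (auto simp: d_def)
    have est: "cmod (integral {a..y} f - integral {a..t} f - (y - t) *\<^sub>R f t) \<le> e * norm (y - t)"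
      if y: "norm (y - t) < d" for y
    proof -
      have yb: "y \<in> {a<..<c}" "\<bar>y - t\<bar> < d1" "\<bar>y - t\<bar> < d2" using y t by (auto simp: d_def abs_if split: if_splits)
      have gt: "g t = f t" "h (- t) = f t" using t by (auto simp: g_def h_def)
      have scale: "cmod (I - k *\<^sub>R w) \<le> e * k" if "cmod (I /\<^sub>R k - w) < e" "k > 0" for I w k
      proof -
        have "I - k *\<^sub>R w = k *\<^sub>R (I /\<^sub>R k - w)" using that by (simp add: algebra_simps)
        then have "cmod (I - k *\<^sub>R w) = k * cmod (I /\<^sub>R k - w)" using that by (metis norm_scaleR abs_of_pos)
        then show ?thesis using that by simp
      qed
      consider "y = t" | "y > t" | "y < t" by linarith
      then show ?thesis
      proof cases
        case 2
        have "integral {a..t} f + integral {t..y} f = integral {a..y} f"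
          using t 2 yb by (intro Henstock_Kurzweil_Integration.integral_combine integrable_on_subinterval[OF f]) auto
        then have "integral {a..y} f - integral {a..t} f = integral {t..y} f" by (simp add: algebra_simps)
        also have "\<dots> = integral {t..t + (y - t)} g"
          using t yb by (simp, intro Henstock_Kurzweil_Integration.integral_cong) (auto simp: g_def)
        finally show ?thesis
          using scale[OF d1(2)[of "y - t"]] 2 yb gt by simp
      next
        case 3
        have "integral {a..y} f + integral {y..t} f = integral {a..t} f"
          using t 3 yb by (intro Henstock_Kurzweil_Integration.integral_combine integrable_on_subinterval[OF f]) auto
        then have "integral {a..y} f - integral {a..t} f = - integral {y..t} f" by (simp add: algebra_simps)
        also have "integral {y..t} f = integral {y..t} g"
          using t yb by (intro Henstock_Kurzweil_Integration.integral_cong) (auto simp: g_def)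
        also have "\<dots> = integral {- t..- t + (t - y)} h"
          using integral_reflect_real[of t y g] by (simp add: h_def[abs_def])
        finally have *: "integral {a..y} f - integral {a..t} f - (y - t) *\<^sub>R f t
            = - (integral {- t..- t + (t - y)} h - (t - y) *\<^sub>R f t)" by (simp add: algebra_simps)
        show ?thesis unfolding * norm_minus_cancel
          using scale[OF d2(2)[of "t - y"]] 3 yb gt by simp
      qed simp
    qed
    show "\<exists>d>0. \<forall>y. norm (y - t) < d \<longrightarrow>
        norm (integral {a..y} f - integral {a..t} f - (y - t) *\<^sub>R f t) \<le> e * norm (y - t)"
      by (intro exI[of _ d] conjI allI impI d0 est)
  qed
  ultimately show thesis by (rule that)
qed

section \<open>Square integrability on subsets of the line and absolute continuity of
  primitives\<close>

lemma L2_lebesgue_on_subset: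
  assumes f: "f \<in> L2 (lebesgue_on S)" and T: "T \<subseteq> S" "T \<in> sets lebesgue" "S \<in> sets lebesgue"
  shows "f \<in> L2 (lebesgue_on T)" "L2_norm (lebesgue_on T) f \<le> L2_norm (lebesgue_on S) f"
proof -
  have m: "f \<in> borel_measurable (lebesgue_on T)"
    using measurable_restrict_mono[OF L2D(1)[OF f] T(1)] .
  have s: "set_integrable lebesgue S (\<lambda>t. (cmod (f t))\<^sup>2)"
    using L2D(2)[OF f] T(3) by (simp add: integrable_restrict_space set_integrable_def)
  then have "set_integrable lebesgue T (\<lambda>t. (cmod (f t))\<^sup>2)"
    by (rule set_integrable_subset) (use T in auto)
  then have i: "integrable (lebesgue_on T) (\<lambda>t. (cmod (f t))\<^sup>2)"
    using T(2) by (simp add: integrable_restrict_space set_integrable_def)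
  show "f \<in> L2 (lebesgue_on T)" using m i by (simp add: L2_def)
  have "integral T (\<lambda>t. (cmod (f t))\<^sup>2) \<le> integral S (\<lambda>t. (cmod (f t))\<^sup>2)"
    by (intro integral_subset_le T integrable_on_lebesgue_on i L2D(2)[OF f]) auto
  then show "L2_norm (lebesgue_on T) f \<le> L2_norm (lebesgue_on S) f"
    using lebesgue_integral_eq_integral[OF i T(2)] lebesgue_integral_eq_integral[OF L2D(2)[OF f] T(3)]
    by (simp add: L2_norm_def)
qed

lemma L2_lebesgue_on_one:
  assumes S: "S \<in> lmeasurable"
  shows "(\<lambda>_. 1) \<in> L2 (lebesgue_on S)" "L2_norm (lebesgue_on S) (\<lambda>_. 1) = sqrt (measure lebesgue S)"
proof -
  interpret finite_measure "lebesgue_on S"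
    by (rule finite_measure_lebesgue_on[OF S])
  show "(\<lambda>_. 1) \<in> L2 (lebesgue_on S)" by (simp add: L2_def)
  show "L2_norm (lebesgue_on S) (\<lambda>_. 1) = sqrt (measure lebesgue S)"
    using S by (simp add: L2_norm_def measure_restrict_space fmeasurableD)
qed

text \<open>Cauchy-Schwarz against the constant 1.\<close>

lemma L2_finite_measure_integrable:
  assumes f: "f \<in> L2 (lebesgue_on S)" and S: "S \<in> lmeasurable"
  shows "integrable (lebesgue_on S) f" "f integrable_on S" "(\<lambda>t. cmod (f t)) integrable_on S"
    "integral S (\<lambda>t. cmod (f t)) \<le> sqrt (measure lebesgue S) * L2_norm (lebesgue_on S) f"
    "cmod (integral S f) \<le> sqrt (measure lebesgue S) * L2_norm (lebesgue_on S) f"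
proof -
  note 1 = L2_lebesgue_on_one[OF S] and sS = fmeasurableD[OF S]
  show i: "integrable (lebesgue_on S) f"
    using L2_mult_integrable[OF f 1(1)] by simp
  then have ni: "integrable (lebesgue_on S) (\<lambda>t. cmod (f t))" by (rule integrable_norm)
  show fi: "f integrable_on S" and nfi: "(\<lambda>t. cmod (f t)) integrable_on S"
    using i ni sS by (auto intro: integrable_on_lebesgue_on)
  show le: "integral S (\<lambda>t. cmod (f t)) \<le> sqrt (measure lebesgue S) * L2_norm (lebesgue_on S) f"
    using L2_Cauchy_Schwarz_norm[OF f 1(1)] lebesgue_integral_eq_integral[OF ni sS] 1(2)
    by (simp add: mult.commute)
  have "cmod (integral S f) \<le> integral S (\<lambda>t. cmod (f t))"
    by (rule integral_norm_bound_integral[OF fi nfi]) simp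
  with le show "cmod (integral S f) \<le> sqrt (measure lebesgue S) * L2_norm (lebesgue_on S) f" by linarith
qed

lemma continuous_on_imp_L2:
  fixes f :: "real \<Rightarrow> complex"
  assumes f: "continuous_on {a..c} f"
  shows "f \<in> L2 (lebesgue_on {a..c})"
proof -
  have "continuous_on {a..c} (\<lambda>t. (cmod (f t))\<^sup>2)" using f by (intro continuous_intros)
  then have "(\<lambda>t. (cmod (f t))\<^sup>2) absolutely_integrable_on {a..c}"
    by (rule absolutely_integrable_continuous_real)
  then have "integrable (lebesgue_on {a..c}) (\<lambda>t. (cmod (f t))\<^sup>2)"
    by (rule absolutely_integrable_imp_integrable) simp
  moreover have "f \<in> borel_measurable (lebesgue_on {a..c})"
    using f by (rule continuous_imp_measurable_on_sets_lebesgue) simp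
  ultimately show ?thesis by (simp add: L2_def)
qed

lemma abs_cont_on_indefinite_integral:
  assumes f: "f \<in> L2 (lebesgue_on {a..c})"
    and F: "\<And>t. t \<in> {a..c} \<Longrightarrow> F t = F a + integral {a..t} f"
  shows "abs_cont_on a c F"
  unfolding abs_cont_on_def
proof (intro allI impI)
  fix e :: real assume e: "e > 0"
  \<comment> \<open>Adding 1 keeps \<open>B\<close> positive. Cauchy-Schwarz bounds the increments
    over a set of measure m by \<open>sqrt m * B\<close>, whence the choice of the square of
    \<open>e / B\<close> for \<open>\<delta>\<close>.\<close>
  define B where "B = L2_norm (lebesgue_on {a..c}) f + 1"
  have B: "B > 0" by (simp add: B_def add_nonneg_pos)
  have fi: "f integrable_on {a..c}" by (rule L2_finite_measure_integrable[OF f]) simp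
  show "\<exists>\<delta>>0. \<forall>D s. D division_of s \<and> s \<subseteq> {a..c} \<and> (\<Sum>K\<in>D. Sup K - Inf K) < \<delta>
       \<longrightarrow> (\<Sum>K\<in>D. cmod (F (Sup K) - F (Inf K))) < e"
  proof (intro exI[of _ "(e / B)\<^sup>2"] conjI allI impI, use e B in simp, elim conjE)
    fix D s assume D: "D division_of s" and s: "s \<subseteq> {a..c}" and len: "(\<Sum>K\<in>D. Sup K - Inf K) < (e / B)\<^sup>2"
    note sm = division_of_real_measure[OF D]
    have fs: "f \<in> L2 (lebesgue_on s)" and nle: "L2_norm (lebesgue_on s) f \<le> B"
      using L2_lebesgue_on_subset[OF f s fmeasurableD[OF sm(1)]] by (auto simp: B_def)
    have "(\<Sum>K\<in>D. cmod (F (Sup K) - F (Inf K))) \<le> (\<Sum>K\<in>D. integral K (\<lambda>t. cmod (f t)))"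
    proof (rule sum_mono)
      fix K assume K: "K \<in> D"
      obtain u v where uv: "K = {u..v}" "u \<le> v" "Sup K = v" "Inf K = u"
        using division_of_realE[OF D K] by metis
      have sub: "{u..v} \<subseteq> {a..c}" using division_ofD(2)[OF D K] s uv by blast
      then have uvc: "u \<in> {a..c}" "v \<in> {a..c}" using uv(2) by auto
      have fuv: "f \<in> L2 (lebesgue_on {u..v})" by (rule L2_lebesgue_on_subset[OF f sub]) simp_all
      have "integral {a..u} f + integral {u..v} f = integral {a..v} f"
        using uvc uv(2) by (intro Henstock_Kurzweil_Integration.integral_combine integrable_on_subinterval[OF fi]) auto
      then have "F (Sup K) - F (Inf K) = integral {u..v} f"
        using F[OF uvc(1)] F[OF uvc(2)] by (simp add: uv(3,4)) (simp add: algebra_simps)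
      also have "cmod \<dots> \<le> integral {u..v} (\<lambda>t. cmod (f t))"
        by (rule integral_norm_bound_integral) (auto intro!: L2_finite_measure_integrable[OF fuv])
      finally show "cmod (F (Sup K) - F (Inf K)) \<le> integral K (\<lambda>t. cmod (f t))" by (simp only: uv(1))
    qed
    also have "\<dots> = integral s (\<lambda>t. cmod (f t))"
      by (rule integral_combine_division_topdown[symmetric, OF _ D]) (rule L2_finite_measure_integrable[OF fs sm(1)])
    also have "\<dots> \<le> sqrt (measure lebesgue s) * L2_norm (lebesgue_on s) f"
      by (rule L2_finite_measure_integrable[OF fs sm(1)])
    also have "\<dots> \<le> sqrt (measure lebesgue s) * B" using nle by (intro mult_left_mono) auto
    also have "\<dots> < e / B * B"
    proof (rule mult_strict_right_mono[OF _ B])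
      show "sqrt (measure lebesgue s) < e / B"
        using len sm(2) e B by (intro real_less_lsqrt) auto
    qed
    also have "\<dots> = e" using B by simp
    finally show "(\<Sum>K\<in>D. cmod (F (Sup K) - F (Inf K))) < e" .
  qed
qed

lemma abs_cont_on_lincomb:
  assumes F: "abs_cont_on a c F" and G: "abs_cont_on a c G"
  shows "abs_cont_on a c (\<lambda>t. p * F t + q * G t)"
  unfolding abs_cont_on_def
proof (intro allI impI)
  fix e :: real assume "e > 0"
  define C where "C = cmod p + cmod q + 1"
  have C: "C > 0" "cmod p \<le> C" "cmod q \<le> C" by (auto simp: C_def add_nonneg_pos)
  then have e: "e / (2 * C) > 0" using \<open>e > 0\<close> by simp
  obtain d1 where d1: "d1 > 0" "\<And>D s. D division_of s \<Longrightarrow> s \<subseteq> {a..c} \<Longrightarrow> (\<Sum>K\<in>D. Sup K - Inf K) < d1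
       \<Longrightarrow> (\<Sum>K\<in>D. cmod (F (Sup K) - F (Inf K))) < e / (2 * C)"
    by (rule abs_cont_onE[OF F e]) (rule that; assumption)
  obtain d2 where d2: "d2 > 0" "\<And>D s. D division_of s \<Longrightarrow> s \<subseteq> {a..c} \<Longrightarrow> (\<Sum>K\<in>D. Sup K - Inf K) < d2
       \<Longrightarrow> (\<Sum>K\<in>D. cmod (G (Sup K) - G (Inf K))) < e / (2 * C)"
    by (rule abs_cont_onE[OF G e]) (rule that; assumption)
  show "\<exists>\<delta>>0. \<forall>D s. D division_of s \<and> s \<subseteq> {a..c} \<and> (\<Sum>K\<in>D. Sup K - Inf K) < \<delta>
       \<longrightarrow> (\<Sum>K\<in>D. cmod (p * F (Sup K) + q * G (Sup K) - (p * F (Inf K) + q * G (Inf K)))) < e"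
  proof (intro exI[of _ "min d1 d2"] conjI allI impI, use d1 d2 in simp, elim conjE)
    fix D s assume D: "D division_of s" "s \<subseteq> {a..c}" "(\<Sum>K\<in>D. Sup K - Inf K) < min d1 d2"
    have "(\<Sum>K\<in>D. cmod (p * F (Sup K) + q * G (Sup K) - (p * F (Inf K) + q * G (Inf K))))
       \<le> (\<Sum>K\<in>D. C * cmod (F (Sup K) - F (Inf K)) + C * cmod (G (Sup K) - G (Inf K)))"
    proof (rule sum_mono)
      fix K
      have "p * F (Sup K) + q * G (Sup K) - (p * F (Inf K) + q * G (Inf K))
          = p * (F (Sup K) - F (Inf K)) + q * (G (Sup K) - G (Inf K))"
        by (simp add: algebra_simps)
      also have "cmod \<dots> \<le> cmod p * cmod (F (Sup K) - F (Inf K)) + cmod q * cmod (G (Sup K) - G (Inf K))"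
        by (rule order_trans[OF norm_triangle_ineq]) (simp add: norm_mult)
      also have "\<dots> \<le> C * cmod (F (Sup K) - F (Inf K)) + C * cmod (G (Sup K) - G (Inf K))"
        by (intro add_mono mult_right_mono C) auto
      finally show "cmod (p * F (Sup K) + q * G (Sup K) - (p * F (Inf K) + q * G (Inf K)))
          \<le> C * cmod (F (Sup K) - F (Inf K)) + C * cmod (G (Sup K) - G (Inf K))" .
    qed
    also have "\<dots> = C * (\<Sum>K\<in>D. cmod (F (Sup K) - F (Inf K))) + C * (\<Sum>K\<in>D. cmod (G (Sup K) - G (Inf K)))"
      by (simp add: sum.distrib sum_distrib_left)
    also have "\<dots> < C * (e / (2 * C)) + C * (e / (2 * C))"
      using D by (intro add_strict_mono mult_strict_left_mono C d1(2)[OF D(1,2)] d2(2)[OF D(1,2)]) auto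
    also have "\<dots> = e" using C by simp
    finally show "(\<Sum>K\<in>D. cmod (p * F (Sup K) + q * G (Sup K) - (p * F (Inf K) + q * G (Inf K)))) < e" .
  qed
qed

lemma abs_cont_on_diff:
  "abs_cont_on a c F \<Longrightarrow> abs_cont_on a c G \<Longrightarrow> abs_cont_on a c (\<lambda>t. F t - G t)"
  using abs_cont_on_lincomb[of a c F G 1 "-1"] by simp

lemma abs_cont_on_mult:
  assumes F: "abs_cont_on a c F" and G: "abs_cont_on a c G"
    and bF: "\<And>t. t \<in> {a..c} \<Longrightarrow> cmod (F t) \<le> B" and bG: "\<And>t. t \<in> {a..c} \<Longrightarrow> cmod (G t) \<le> B"
  shows "abs_cont_on a c (\<lambda>t. F t * G t)"
  unfolding abs_cont_on_def
proof (intro allI impI)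
  fix e :: real assume "e > 0"
  define C where "C = \<bar>B\<bar> + 1"
  have C: "C > 0" by (simp add: C_def)
  then have e: "e / (2 * C) > 0" using \<open>e > 0\<close> by simp
  obtain d1 where d1: "d1 > 0" "\<And>D s. D division_of s \<Longrightarrow> s \<subseteq> {a..c} \<Longrightarrow> (\<Sum>K\<in>D. Sup K - Inf K) < d1
       \<Longrightarrow> (\<Sum>K\<in>D. cmod (F (Sup K) - F (Inf K))) < e / (2 * C)"
    by (rule abs_cont_onE[OF F e]) (rule that; assumption)
  obtain d2 where d2: "d2 > 0" "\<And>D s. D division_of s \<Longrightarrow> s \<subseteq> {a..c} \<Longrightarrow> (\<Sum>K\<in>D. Sup K - Inf K) < d2
       \<Longrightarrow> (\<Sum>K\<in>D. cmod (G (Sup K) - G (Inf K))) < e / (2 * C)"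
    by (rule abs_cont_onE[OF G e]) (rule that; assumption)
  show "\<exists>\<delta>>0. \<forall>D s. D division_of s \<and> s \<subseteq> {a..c} \<and> (\<Sum>K\<in>D. Sup K - Inf K) < \<delta>
       \<longrightarrow> (\<Sum>K\<in>D. cmod (F (Sup K) * G (Sup K) - F (Inf K) * G (Inf K))) < e"
  proof (intro exI[of _ "min d1 d2"] conjI allI impI, use d1 d2 in simp, elim conjE)
    fix D s assume D: "D division_of s" "s \<subseteq> {a..c}" "(\<Sum>K\<in>D. Sup K - Inf K) < min d1 d2"
    have "(\<Sum>K\<in>D. cmod (F (Sup K) * G (Sup K) - F (Inf K) * G (Inf K)))
       \<le> (\<Sum>K\<in>D. C * cmod (F (Sup K) - F (Inf K)) + C * cmod (G (Sup K) - G (Inf K)))"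
    proof (rule sum_mono)
      fix K assume K: "K \<in> D"
      obtain u v where uv: "K = {u..v}" "u \<le> v" "Sup K = v" "Inf K = u"
        using division_of_realE[OF D(1) K] by metis
      have "{u..v} \<subseteq> {a..c}" using division_ofD(2)[OF D(1) K] D(2) uv by blast
      then have uvc: "u \<in> {a..c}" "v \<in> {a..c}" using uv(2) by auto
      have "F v * G v - F u * G u = (F v - F u) * G v + F u * (G v - G u)" by (simp add: algebra_simps)
      also have "cmod \<dots> \<le> cmod (F v - F u) * cmod (G v) + cmod (F u) * cmod (G v - G u)"
        by (rule order_trans[OF norm_triangle_ineq]) (simp add: norm_mult)
      also have "\<dots> \<le> cmod (F v - F u) * C + C * cmod (G v - G u)"
        using bF[OF uvc(1)] bG[OF uvc(2)] by (intro add_mono mult_left_mono mult_right_mono) (auto simp: C_def)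
      finally show "cmod (F (Sup K) * G (Sup K) - F (Inf K) * G (Inf K))
        \<le> C * cmod (F (Sup K) - F (Inf K)) + C * cmod (G (Sup K) - G (Inf K))"
        by (simp add: uv(3,4) mult.commute)
    qed
    also have "\<dots> = C * (\<Sum>K\<in>D. cmod (F (Sup K) - F (Inf K))) + C * (\<Sum>K\<in>D. cmod (G (Sup K) - G (Inf K)))"
      by (simp add: sum.distrib sum_distrib_left)
    also have "\<dots> < C * (e / (2 * C)) + C * (e / (2 * C))"
      using D by (intro add_strict_mono mult_strict_left_mono C d1(2)[OF D(1,2)] d2(2)[OF D(1,2)]) auto
    also have "\<dots> = e" using C by simp
    finally show "(\<Sum>K\<in>D. cmod (F (Sup K) * G (Sup K) - F (Inf K) * G (Inf K))) < e" .
  qed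
qed

lemma abs_cont_on_imp_continuous:
  assumes "abs_cont_on a c F"
  shows "continuous_on {a..c} F"
  unfolding continuous_on_iff
proof (intro ballI allI impI)
  fix t and e :: real assume t: "t \<in> {a..c}" and e: "e > 0"
  obtain \<delta> where \<delta>: "\<delta> > 0" "\<And>D s. D division_of s \<Longrightarrow> s \<subseteq> {a..c} \<Longrightarrow> (\<Sum>K\<in>D. Sup K - Inf K) < \<delta>
       \<Longrightarrow> (\<Sum>K\<in>D. cmod (F (Sup K) - F (Inf K))) < e"
    by (rule abs_cont_onE[OF assms e]) (rule that; assumption)
  have *: "cmod (F v - F u) < e" if "u \<in> {a..c}" "v \<in> {a..c}" "u \<le> v" "v - u < \<delta>" for u v
  proof -
    have "{{u..v}} division_of {u..v}" using that by (intro division_of_self[of u v, unfolded cbox_interval]) auto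
    then show ?thesis using \<delta>(2)[of "{{u..v}}" "{u..v}"] that by auto
  qed
  show "\<exists>d>0. \<forall>s\<in>{a..c}. dist s t < d \<longrightarrow> dist (F s) (F t) < e"
  proof (intro exI[of _ \<delta>] conjI ballI impI \<delta>(1))
    fix s assume s: "s \<in> {a..c}" "dist s t < \<delta>"
    show "dist (F s) (F t) < e"
      using *[of s t] *[of t s] s t by (cases "s \<le> t") (auto simp: dist_norm dist_real_def norm_minus_commute)
  qed
qed

section \<open>Second order Sobolev functions on a compact interval\<close>

text \<open>In integrated form, so that the one-sided values at the end points are included.\<close>

definition sobolev2 :: "real \<Rightarrow> real \<Rightarrow> (real \<Rightarrow> complex) \<Rightarrow> (real \<Rightarrow> complex) \<Rightarrow> (real \<Rightarrow> complex) \<Rightarrow> bool" where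
  "sobolev2 a c U U1 w \<longleftrightarrow> a < c \<and> w \<in> L2 (lebesgue_on {a..c}) \<and>
     (\<forall>t\<in>{a..c}. U1 t = U1 a + integral {a..t} w) \<and> (\<forall>t\<in>{a..c}. U t = U a + integral {a..t} U1)"

lemma sobolev2D:
  assumes "sobolev2 a c U U1 w"
  shows "a < c" "w \<in> L2 (lebesgue_on {a..c})" "w integrable_on {a..c}"
    "\<And>t. t \<in> {a..c} \<Longrightarrow> U1 t = U1 a + integral {a..t} w"
    "\<And>t. t \<in> {a..c} \<Longrightarrow> U t = U a + integral {a..t} U1"
    "continuous_on {a..c} U1" "continuous_on {a..c} U" "U1 integrable_on {a..c}" "U1 \<in> L2 (lebesgue_on {a..c})"
    "\<And>t. t \<in> {a..c} \<Longrightarrow> (U has_vector_derivative U1 t) (at t within {a..c})"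
proof -
  show ac: "a < c" and w: "w \<in> L2 (lebesgue_on {a..c})"
    and U1: "\<And>t. t \<in> {a..c} \<Longrightarrow> U1 t = U1 a + integral {a..t} w"
    and U: "\<And>t. t \<in> {a..c} \<Longrightarrow> U t = U a + integral {a..t} U1"
    using assms unfolding sobolev2_def by blast+
  show wi: "w integrable_on {a..c}" by (rule L2_finite_measure_integrable[OF w]) simp
  have "continuous_on {a..c} (\<lambda>t. U1 a + integral {a..t} w)"
    by (intro continuous_intros indefinite_integral_continuous_1 wi)
  then show cU1: "continuous_on {a..c} U1" by (rule continuous_on_eq) (rule U1[symmetric])
  then show U1i: "U1 integrable_on {a..c}" by (rule integrable_continuous_interval)
  show "U1 \<in> L2 (lebesgue_on {a..c})" using cU1 by (rule continuous_on_imp_L2)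
  have "continuous_on {a..c} (\<lambda>t. U a + integral {a..t} U1)"
    by (intro continuous_intros indefinite_integral_continuous_1 U1i)
  then show "continuous_on {a..c} U" by (rule continuous_on_eq) (rule U[symmetric])
  show "(U has_vector_derivative U1 t) (at t within {a..c})" if t: "t \<in> {a..c}" for t
  proof -
    have "((\<lambda>t. integral {a..t} U1) has_vector_derivative U1 t) (at t within {a..c})"
      by (rule integral_has_vector_derivative[OF cU1 t])
    then have "((\<lambda>t. U a + integral {a..t} U1) has_vector_derivative 0 + U1 t) (at t within {a..c})"
      by (intro has_vector_derivative_add has_vector_derivative_const)
    then have "((\<lambda>t. U a + integral {a..t} U1) has_vector_derivative U1 t) (at t within {a..c})"
      by simp
    from has_vector_derivative_transform[OF t U this] show ?thesis .
  qed
qed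

lemma sobolev2_AE_derivative:
  assumes "sobolev2 a c U U1 w"
  obtains N where "negligible N"
    "\<And>t. t \<in> {a..c} - N \<Longrightarrow> (U1 has_vector_derivative w t) (at t within {a..c})"
proof -
  note D = sobolev2D[OF assms]
  obtain N where N: "negligible N"
    "\<And>t. t \<in> {a<..<c} - N \<Longrightarrow> ((\<lambda>s. integral {a..s} w) has_vector_derivative w t) (at t)"
    by (rule integral_has_vector_derivative_AE[OF D(3)]) (rule that; assumption)
  show thesis
  proof
    show "negligible (N \<union> {a, c})" using N(1) by (simp add: negligible_Un)
    fix t assume t: "t \<in> {a..c} - (N \<union> {a, c})"
    then have "t \<in> {a<..<c} - N" by auto
    then have "((\<lambda>s. integral {a..s} w) has_vector_derivative w t) (at t within {a..c})"
      by (rule has_vector_derivative_at_within[OF N(2)])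
    then have "((\<lambda>s. U1 a + integral {a..s} w) has_vector_derivative 0 + w t) (at t within {a..c})"
      by (intro has_vector_derivative_add has_vector_derivative_const)
    then have "((\<lambda>s. U1 a + integral {a..s} w) has_vector_derivative w t) (at t within {a..c})"
      by simp
    note der = this
    from t have t': "t \<in> {a..c}" by simp
    from has_vector_derivative_transform[OF t' D(4) der]
    show "(U1 has_vector_derivative w t) (at t within {a..c})" .
  qed
qed

text \<open>In the derivative of \<open>F1 * G - F * G1\<close> the products of first derivatives
  cancel. The form is bilinear; sesquilinear versions follow through
  \<open>sobolev2_cnj\<close>.\<close>

lemma sobolev2_Green:
  assumes F: "sobolev2 a c F F1 f" and G: "sobolev2 a c G G1 g"
  shows "((\<lambda>t. f t * G t - F t * g t) has_integral
    ((F1 c * G c - F c * G1 c) - (F1 a * G a - F a * G1 a))) {a..c}"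
proof -
  note FD = sobolev2D[OF F] and GD = sobolev2D[OF G]
  obtain NF where NF: "negligible NF" "\<And>t. t \<in> {a..c} - NF \<Longrightarrow> (F1 has_vector_derivative f t) (at t within {a..c})"
    by (rule sobolev2_AE_derivative[OF F]) (rule that; assumption)
  obtain NG where NG: "negligible NG" "\<And>t. t \<in> {a..c} - NG \<Longrightarrow> (G1 has_vector_derivative g t) (at t within {a..c})"
    by (rule sobolev2_AE_derivative[OF G]) (rule that; assumption)
  have bd: "\<exists>B. \<forall>t\<in>{a..c}. cmod (h t) \<le> B" if "continuous_on {a..c} h" for h :: "real \<Rightarrow> complex"
    using compact_imp_bounded[OF compact_continuous_image[OF that]] by (auto simp: bounded_iff)
  have mul: "abs_cont_on a c (\<lambda>t. h t * k t)"
    if hk: "abs_cont_on a c h" "abs_cont_on a c k" "continuous_on {a..c} h" "continuous_on {a..c} k" for h k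
  proof -
    obtain B where "\<forall>t\<in>{a..c}. cmod (h t) \<le> B" using bd[OF hk(3)] by blast
    moreover obtain C where "\<forall>t\<in>{a..c}. cmod (k t) \<le> C" using bd[OF hk(4)] by blast
    ultimately show ?thesis
      by (intro abs_cont_on_mult[OF hk(1,2), of "max B C"]) (auto simp: max.coboundedI1 max.coboundedI2)
  qed
  have "abs_cont_on a c (\<lambda>t. F1 t * G t - F t * G1 t)"
    by (intro abs_cont_on_diff mul abs_cont_on_indefinite_integral[OF FD(2) FD(4)]
        abs_cont_on_indefinite_integral[OF FD(9) FD(5)] abs_cont_on_indefinite_integral[OF GD(2) GD(4)]
        abs_cont_on_indefinite_integral[OF GD(9) GD(5)] FD GD)
  moreover have "((\<lambda>t. F1 t * G t - F t * G1 t) has_vector_derivative f t * G t - F t * g t) (at t within {a..c})"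
    if t: "t \<in> {a..c} - (NF \<union> NG)" for t
  proof -
    have "((\<lambda>t. F1 t * G t - F t * G1 t) has_vector_derivative
        (F1 t * G1 t + f t * G t) - (F t * g t + F1 t * G1 t)) (at t within {a..c})"
      using t by (intro has_vector_derivative_diff has_vector_derivative_mult NF NG FD GD) auto
    then show ?thesis by (simp add: algebra_simps)
  qed
  ultimately show ?thesis
    using FD(1) NF(1) NG(1) by (intro abs_cont_on_FTC[where N = "NF \<union> NG"]) (auto simp: negligible_Un)
qed

section \<open>Constructions of Sobolev functions and their end data\<close>

lemma sobolev2I_continuous:
  assumes ac: "a < c" and P2: "continuous_on {a..c} P2"
    and d1: "\<And>t. t \<in> {a..c} \<Longrightarrow> (P1 has_vector_derivative P2 t) (at t within {a..c})"
    and d0: "\<And>t. t \<in> {a..c} \<Longrightarrow> (P has_vector_derivative P1 t) (at t within {a..c})"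
  shows "sobolev2 a c P P1 P2"
proof -
  have ftc: "F t = F a + integral {a..t} f"
    if d: "\<And>t. t \<in> {a..c} \<Longrightarrow> (F has_vector_derivative f t) (at t within {a..c})" and t: "t \<in> {a..c}"
    for F f :: "real \<Rightarrow> complex" and t
  proof -
    have "(f has_integral (F t - F a)) {a..t}"
    proof (rule fundamental_theorem_of_calculus)
      show "a \<le> t" using t by simp
      fix s assume "s \<in> {a..t}"
      with t show "(F has_vector_derivative f s) (at s within {a..t})"
        by (intro has_vector_derivative_within_subset[OF d]) auto
    qed
    then show ?thesis by (simp add: integral_unique)
  qed
  show ?thesis
    unfolding sobolev2_def
    by (intro conjI ac continuous_on_imp_L2 P2 ballI ftc d1 d0)
qed

lemma sobolev2_zero: "a < c \<Longrightarrow> sobolev2 a c (\<lambda>_. 0) (\<lambda>_. 0) (\<lambda>_. 0)"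
  unfolding sobolev2_def by (intro conjI ballI L2_zero) simp_all

text \<open>Cubic Hermite interpolation, with \<open>C\<close> and \<open>E\<close> the quadratic
  and cubic coefficients in powers of t - a. It supplies test functions with prescribed values and
  slopes at both ends of a cell.\<close>

lemma sobolev2_Hermite:
  fixes A p B q :: complex
  assumes ac: "a < c"
  obtains P P1 P2 where "sobolev2 a c P P1 P2" "P a = A" "P1 a = p" "P c = B" "P1 c = q"
proof -
  define L where "L = complex_of_real (c - a)"
  have L: "L \<noteq> 0" using ac by (auto simp: L_def)
  define C where "C = 3 * (B - A) / L^2 - (2 * p + q) / L"
  define E where "E = 2 * (A - B) / L^3 + (p + q) / L^2"
  define s where "s t = complex_of_real (t - a)" for t
  define P where "P t = A + p * s t + C * s t ^ 2 + E * s t ^ 3" for t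
  define P1 where "P1 t = p + 2 * C * s t + 3 * E * s t ^ 2" for t
  define P2 where "P2 t = 2 * C + 6 * E * s t" for t
  have ds: "(s has_vector_derivative 1) (at t within {a..c})" for t
    unfolding s_def by (auto intro!: derivative_eq_intros)
  have "sobolev2 a c P P1 P2"
  proof (rule sobolev2I_continuous[OF ac])
    show "continuous_on {a..c} P2" unfolding P2_def s_def by (intro continuous_intros)
    fix t assume "t \<in> {a..c}"
    have s2: "((\<lambda>t. s t ^ 2) has_vector_derivative 2 * s t) (at t within {a..c})"
      using has_vector_derivative_mult[OF ds[of t] ds[of t]] by (simp add: power2_eq_square)
    have s3: "((\<lambda>t. s t ^ 3) has_vector_derivative 3 * s t ^ 2) (at t within {a..c})"
      using has_vector_derivative_mult[OF ds[of t] s2] by (simp add: power2_eq_square power3_eq_cube mult.assoc)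
    have cm: "((\<lambda>t. k * h t) has_vector_derivative k * h') (at t within {a..c})"
      if "(h has_vector_derivative h') (at t within {a..c})" for k h' and h :: "real \<Rightarrow> complex"
      using that by (rule has_vector_derivative_mult_right)
    show "(P1 has_vector_derivative P2 t) (at t within {a..c})"
    proof -
      have "(P1 has_vector_derivative (0 + 2 * C * 1 + 3 * E * (2 * s t))) (at t within {a..c})"
        unfolding P1_def by (intro has_vector_derivative_add cm has_vector_derivative_const ds s2)
      then show ?thesis by (simp add: P2_def mult.assoc)
    qed
    show "(P has_vector_derivative P1 t) (at t within {a..c})"
    proof -
      have "(P has_vector_derivative (0 + p * 1 + C * (2 * s t) + E * (3 * s t ^ 2))) (at t within {a..c})"
        unfolding P_def by (intro has_vector_derivative_add cm has_vector_derivative_const ds s2 s3)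
      then show ?thesis by (simp add: P1_def mult_ac)
    qed
  qed
  moreover have "P a = A" "P1 a = p" by (simp_all add: P_def P1_def s_def)
  moreover have sc: "s c = L" by (simp add: s_def L_def)
  have "P c = B" "P1 c = q"
  proof -
    define D where "D = (B - A) / L"
    have AB: "B = A + D * L" using L by (simp add: D_def)
    have CL: "C * L = 3 * D - (2 * p + q)"
      using L by (simp add: C_def AB left_diff_distrib power2_eq_square)
    have EL: "E * L * L = - 2 * D + (p + q)"
      using L by (simp add: E_def AB power2_eq_square power3_eq_cube field_simps)
    have "P c = A + p * L + (C * L) * L + (E * L * L) * L"
      by (simp add: P_def sc power2_eq_square power3_eq_cube mult_ac)
    also have "\<dots> = B" unfolding CL EL AB by (simp add: algebra_simps)
    finally show "P c = B" .
    have "P1 c = p + 2 * (C * L) + 3 * (E * L * L)"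
      by (simp add: P1_def sc power2_eq_square mult_ac)
    also have "\<dots> = q" unfolding CL EL by (simp add: algebra_simps)
    finally show "P1 c = q" .
  qed
  ultimately show thesis using that by blast
qed

lemma sobolev2_add:
  assumes U: "sobolev2 a c U U1 u" and V: "sobolev2 a c V V1 v"
  shows "sobolev2 a c (\<lambda>t. U t + V t) (\<lambda>t. U1 t + V1 t) (\<lambda>t. u t + v t)"
proof -
  note UD = sobolev2D[OF U] and VD = sobolev2D[OF V]
  have add: "F t + G t = F a + G a + integral {a..t} (\<lambda>s. f s + g s)"
    if "f integrable_on {a..c}" "g integrable_on {a..c}" "F t = F a + integral {a..t} f" "G t = G a + integral {a..t} g" "t \<in> {a..c}"
    for F G f g :: "real \<Rightarrow> complex" and t
  proof -
    have "integral {a..t} (\<lambda>s. f s + g s) = integral {a..t} f + integral {a..t} g"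
    proof (rule Henstock_Kurzweil_Integration.integral_add)
      have "{a..t} \<subseteq> {a..c}" using that(5) by simp
      then show "f integrable_on {a..t}" "g integrable_on {a..t}"
        using that(1,2) by (auto intro: integrable_on_subinterval)
    qed
    with that(3,4) show ?thesis by (simp add: algebra_simps)
  qed
  show ?thesis
    unfolding sobolev2_def
  proof (intro conjI ballI)
    fix t assume t: "t \<in> {a..c}"
    show "U1 t + V1 t = U1 a + V1 a + integral {a..t} (\<lambda>t. u t + v t)"
      by (rule add[OF UD(3) VD(3) UD(4)[OF t] VD(4)[OF t] t])
    show "U t + V t = U a + V a + integral {a..t} (\<lambda>t. U1 t + V1 t)"
      by (rule add[OF UD(8) VD(8) UD(5)[OF t] VD(5)[OF t] t])
  qed (rule UD(1), rule L2_add[OF UD(2) VD(2)])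
qed

lemma integral_cnj_Icc:
  fixes f :: "real \<Rightarrow> complex"
  assumes "f integrable_on {a..c}"
  shows "integral {a..c} (\<lambda>t. cnj (f t)) = cnj (integral {a..c} f)"
  using integral_linear[OF assms bounded_linear_cnj] by (simp add: o_def)

lemma sobolev2_cnj:
  assumes U: "sobolev2 a c U U1 u"
  shows "sobolev2 a c (\<lambda>t. cnj (U t)) (\<lambda>t. cnj (U1 t)) (\<lambda>t. cnj (u t))"
proof -
  note UD = sobolev2D[OF U]
  have c: "cnj (F t) = cnj (F a) + integral {a..t} (\<lambda>s. cnj (f s))"
    if "f integrable_on {a..c}" "F t = F a + integral {a..t} f" "t \<in> {a..c}" for F f :: "real \<Rightarrow> complex" and t
  proof -
    have "{a..t} \<subseteq> {a..c}" using that(3) by simp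
    then have "f integrable_on {a..t}" by (rule integrable_on_subinterval[OF that(1)])
    then show ?thesis by (simp only: that(2) integral_cnj_Icc complex_cnj_add)
  qed
  show ?thesis
    unfolding sobolev2_def
  proof (intro conjI ballI)
    fix t assume t: "t \<in> {a..c}"
    show "cnj (U1 t) = cnj (U1 a) + integral {a..t} (\<lambda>t. cnj (u t))"
      by (rule c[OF UD(3) UD(4)[OF t] t])
    show "cnj (U t) = cnj (U a) + integral {a..t} (\<lambda>t. cnj (U1 t))"
      by (rule c[OF UD(8) UD(5)[OF t] t])
  qed (rule UD(1), rule L2_cnj[OF UD(2)])
qed

lemma continuous_on_Icc_one_sided_limits:
  fixes g :: "real \<Rightarrow> complex"
  assumes "continuous_on {a..c} g" "a < c"
  shows "(g \<longlongrightarrow> g a) (at_right a)" "(g \<longlongrightarrow> g c) (at_left c)"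
  using assms continuous_on_Icc_at_rightD continuous_on_Icc_at_leftD by blast+

text \<open>Carries a function known on the open interval to the integrated form on the closed one.
  The right limits at \<open>a\<close> serve as initial values; end values at \<open>c\<close> then
  exist because \<open>f2\<close> is integrable up to \<open>c\<close>.\<close>

lemma sobolev2_of_open_interval:
  assumes ac: "a < c"
    and f: "\<And>t. t \<in> {a<..<c} \<Longrightarrow> (f has_vector_derivative f1 t) (at t)"
    and AC: "\<And>s t. a < s \<Longrightarrow> s \<le> t \<Longrightarrow> t < c \<Longrightarrow> abs_cont_on s t f1"
    and N: "negligible N" "\<And>t. t \<in> {a<..<c} - N \<Longrightarrow> (f1 has_vector_derivative f2 t) (at t)"
    and f2: "f2 \<in> L2 (lebesgue_on {a..c})"
    and lim: "(f \<longlongrightarrow> A) (at_right a)" "(f1 \<longlongrightarrow> p) (at_right a)"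
  obtains U U1 where "sobolev2 a c U U1 f2" "U a = A" "U1 a = p"
    "\<And>t. t \<in> {a<..<c} \<Longrightarrow> U t = f t" "\<And>t. t \<in> {a<..<c} \<Longrightarrow> U1 t = f1 t"
proof -
  have f2i: "f2 integrable_on {a..c}" by (rule L2_finite_measure_integrable[OF f2]) simp
  \<comment> \<open>Increments over compact subintervals determine \<open>F\<close> up to a
    constant, which the limit at \<open>a\<close> fixes.\<close>
  have primitive: "F t = q + integral {a..t} g"
    if g: "g integrable_on {a..c}" and Fq: "(F \<longlongrightarrow> q) (at_right a)"
      and inc: "\<And>s t. a < s \<Longrightarrow> s \<le> t \<Longrightarrow> t < c \<Longrightarrow> integral {s..t} g = F t - F s"
      and t: "t \<in> {a<..<c}" for F g :: "real \<Rightarrow> complex" and q t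
  proof -
    have "((\<lambda>s. integral {a..s} g) \<longlongrightarrow> integral {a..a} g) (at_right a)"
      by (rule continuous_on_Icc_one_sided_limits[OF indefinite_integral_continuous_1[OF g] ac])
    then have "((\<lambda>s. F t - (integral {a..t} g - integral {a..s} g)) \<longlongrightarrow> F t - (integral {a..t} g - 0)) (at_right a)"
      by (intro tendsto_intros) simp
    moreover have "\<forall>\<^sub>F s in at_right a. F t - (integral {a..t} g - integral {a..s} g) = F s"
      unfolding eventually_at_right_field
    proof (intro exI[of _ t] conjI allI impI)
      show "a < t" using t by simp
      fix s assume s: "a < s" "s < t"
      have "integral {a..s} g + integral {s..t} g = integral {a..t} g"
        using s t by (intro Henstock_Kurzweil_Integration.integral_combine integrable_on_subinterval[OF g]) auto
      then have "integral {a..t} g - integral {a..s} g = integral {s..t} g" by (simp add: algebra_simps)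
      then show "F t - (integral {a..t} g - integral {a..s} g) = F s"
        using inc[of s t] s t by simp
    qed
    ultimately have "(F \<longlongrightarrow> F t - (integral {a..t} g - 0)) (at_right a)"
      by (rule Lim_transform_eventually)
    with Fq have "q = F t - (integral {a..t} g - 0)"
      by (intro tendsto_unique[of "at_right a" F]) (auto simp: trivial_limit_at_right_real)
    then show ?thesis by simp
  qed
  define U1 where "U1 t = p + integral {a..t} f2" for t
  define U where "U t = A + integral {a..t} U1" for t
  have a0: "U1 a = p" "U a = A" by (simp_all add: U1_def U_def)
  have S: "sobolev2 a c U U1 f2"
    unfolding sobolev2_def a0 by (simp add: ac f2 U_def U1_def)
  have U1f1: "U1 t = f1 t" if t: "t \<in> {a<..<c}" for t
  proof -
    have "f1 t = p + integral {a..t} f2"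
    proof (rule primitive[OF f2i lim(2) _ t])
      fix s t assume st: "a < s" "s \<le> t" "t < c"
      have "(f2 has_integral (f1 t - f1 s)) {s..t}"
        by (rule abs_cont_on_FTC[OF st(2) AC[OF st] N(1)])
           (use st in \<open>auto intro!: has_vector_derivative_at_within[OF N(2)]\<close>)
      then show "integral {s..t} f2 = f1 t - f1 s" by (rule integral_unique)
    qed
    then show ?thesis by (simp add: U1_def)
  qed
  have Uf: "U t = f t" if t: "t \<in> {a<..<c}" for t
  proof -
    have "f t = A + integral {a..t} U1"
    proof (rule primitive[OF sobolev2D(8)[OF S] lim(1) _ t])
      fix s t assume st: "a < s" "s \<le> t" "t < c"
      have "(U1 has_integral (f t - f s)) {s..t}"
      proof (rule fundamental_theorem_of_calculus[OF st(2)])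
        fix r assume "r \<in> {s..t}"
        then have r: "r \<in> {a<..<c}" using st by auto
        from has_vector_derivative_at_within[OF f[OF r]] show "(f has_vector_derivative U1 r) (at r within {s..t})"
          by (simp only: U1f1[OF r])
      qed
      then show "integral {s..t} U1 = f t - f s" by (rule integral_unique)
    qed
    then show ?thesis by (simp add: U_def)
  qed
  show thesis by (rule that[OF S a0(2,1) Uf U1f1])
qed

text \<open>The test function has as second derivative \<open>k\<close> minus its projection onto the affine functions.\<close>

lemma L2_orthogonal_imp_affine:
  assumes ac: "a < c" and k: "k \<in> L2 (lebesgue_on {a..c})"
    and orth: "\<And>P P1 P2. sobolev2 a c P P1 P2 \<Longrightarrow> P a = 0 \<Longrightarrow> P1 a = 0 \<Longrightarrow> P c = 0 \<Longrightarrow> P1 c = 0 \<Longrightarrow>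
      L2_inner (lebesgue_on {a..c}) P2 k = 0"
  obtains A B where "AE t in lebesgue_on {a..c}. k t = A + B * of_real (t - a)"
proof -
  let ?M = "lebesgue_on {a..c}"
  \<comment> \<open>About the midpoint the functions 1 and \<open>\<tau>\<close> are orthogonal, so
    the two coefficients of the projection decouple.\<close>
  define m where "m = (a + c) / 2"
  define h where "h = (c - a) / 2"
  have h: "h > 0" "a = m - h" "c = m + h" using ac by (simp_all add: m_def h_def field_simps)
  define \<tau> where "\<tau> t = complex_of_real (t - m)" for t
  have d\<tau>: "(\<tau> has_vector_derivative 1) (at t within {a..c})" for t
    unfolding \<tau>_def by (auto intro!: derivative_eq_intros)
  have \<tau>c: "continuous_on {a..c} \<tau>" unfolding \<tau>_def by (intro continuous_intros)
  have \<tau>L: "\<tau> \<in> L2 ?M" by (rule continuous_on_imp_L2[OF \<tau>c])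
  have oneL: "(\<lambda>_. 1) \<in> L2 ?M" by (rule continuous_on_imp_L2) (intro continuous_intros)
  have \<tau>S: "sobolev2 a c \<tau> (\<lambda>_. 1) (\<lambda>_. 0)"
    by (rule sobolev2I_continuous[OF ac]) (rule continuous_on_const has_vector_derivative_const d\<tau>)+
  have LI: "integral\<^sup>L ?M f = integral {a..c} f" if "integrable ?M f" for f :: "real \<Rightarrow> complex"
    using that by (rule lebesgue_integral_eq_integral) simp
  have ki: "k integrable_on {a..c}" by (rule L2_finite_measure_integrable[OF k]) simp
  have k\<tau>i: "(\<lambda>t. k t * \<tau> t) integrable_on {a..c}"
    by (rule integrable_on_lebesgue_on[OF L2_mult_integrable[OF k \<tau>L]]) simp
  have d\<tau>2: "((\<lambda>t. \<tau> t ^ 2) has_vector_derivative 2 * \<tau> t) (at t within {a..c})" for t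
    using has_vector_derivative_mult[OF d\<tau>[of t] d\<tau>[of t]] by (simp add: power2_eq_square)
  have d\<tau>3: "((\<lambda>t. \<tau> t ^ 3) has_vector_derivative 3 * \<tau> t ^ 2) (at t within {a..c})" for t
    using has_vector_derivative_mult[OF d\<tau>[of t] d\<tau>2[of t]]
    by (simp add: power2_eq_square power3_eq_cube mult.assoc)
  have i1: "((\<lambda>_. 1::complex) has_integral of_real (2 * h)) {a..c}"
  proof -
    have "2 * h = c - a" by (simp add: h_def)
    then show ?thesis using has_integral_const_real[of "1::complex" a c] ac by (simp add: scaleR_conv_of_real)
  qed
  have i\<tau>: "(\<tau> has_integral 0) {a..c}"
  proof -
    have "(\<tau> has_integral (\<tau> c ^ 2 / 2 - \<tau> a ^ 2 / 2)) {a..c}"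
    proof (rule fundamental_theorem_of_calculus)
      fix t
      show "((\<lambda>t. \<tau> t ^ 2 / 2) has_vector_derivative \<tau> t) (at t within {a..c})"
        using has_vector_derivative_divide[OF d\<tau>2[of t], of 2] by simp
    qed (use ac in simp)
    then show ?thesis by (simp add: \<tau>_def h)
  qed
  have i\<tau>2: "((\<lambda>t. \<tau> t * \<tau> t) has_integral of_real (2 * h ^ 3 / 3)) {a..c}"
  proof -
    have "((\<lambda>t. \<tau> t * \<tau> t) has_integral (\<tau> c ^ 3 / 3 - \<tau> a ^ 3 / 3)) {a..c}"
    proof (rule fundamental_theorem_of_calculus)
      fix t
      show "((\<lambda>t. \<tau> t ^ 3 / 3) has_vector_derivative \<tau> t * \<tau> t) (at t within {a..c})"
        using has_vector_derivative_divide[OF d\<tau>3[of t], of 3] by (simp add: power2_eq_square)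
    qed (use ac in simp)
    moreover have "\<tau> c ^ 3 / 3 - \<tau> a ^ 3 / 3 = of_real (2 * h ^ 3 / 3)"
      by (simp add: \<tau>_def h power3_eq_cube)
    ultimately show ?thesis by simp
  qed
  \<comment> \<open>Inner products with 1 and with \<open>\<tau>\<close>, divided by the squared
    norms \<open>2 * h\<close> and \<open>2 * h ^ 3 / 3\<close>.\<close>
  define A where "A = integral {a..c} k / of_real (2 * h)"
  define B where "B = integral {a..c} (\<lambda>t. k t * \<tau> t) / of_real (2 * h ^ 3 / 3)"
  define P2 where "P2 t = k t - (A + B * \<tau> t)" for t
  have AB: "(\<lambda>t. A + B * \<tau> t) \<in> L2 ?M"
    by (rule continuous_on_imp_L2) (intro continuous_intros \<tau>c)
  have P2L: "P2 \<in> L2 ?M" unfolding P2_def by (rule L2_diff[OF k AB])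
  have P2_0: "(P2 has_integral 0) {a..c}"
  proof -
    have "(P2 has_integral (integral {a..c} k - (A * of_real (2 * h) + B * 0))) {a..c}"
      unfolding P2_def
      using has_integral_mult_right[OF i1, of A] has_integral_mult_right[OF i\<tau>, of B]
      by (intro has_integral_diff integrable_integral ki has_integral_add) simp_all
    then show ?thesis using h by (simp add: A_def)
  qed
  have P2_\<tau>: "((\<lambda>t. P2 t * \<tau> t) has_integral 0) {a..c}"
  proof -
    have "((\<lambda>t. k t * \<tau> t - (A * \<tau> t + B * (\<tau> t * \<tau> t))) has_integral
        (integral {a..c} (\<lambda>t. k t * \<tau> t) - (A * 0 + B * of_real (2 * h ^ 3 / 3)))) {a..c}"
      by (intro has_integral_diff integrable_integral k\<tau>i has_integral_add has_integral_mult_right i\<tau> i\<tau>2)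
    moreover have "of_real (2 * h ^ 3 / 3) \<noteq> (0::complex)" using h by simp
    ultimately show ?thesis by (simp add: B_def P2_def algebra_simps)
  qed
  define P1 where "P1 t = integral {a..t} P2" for t
  define P where "P t = integral {a..t} P1" for t
  have S: "sobolev2 a c P P1 P2"
    unfolding sobolev2_def by (simp add: ac P2L P_def P1_def)
  have P0: "P a = 0" "P1 a = 0" by (simp_all add: P_def P1_def)
  have P1c: "P1 c = 0" using P2_0 by (simp add: P1_def integral_unique)
  \<comment> \<open>Green's formula against \<open>\<tau>\<close>, whose second derivative is 0,
    converts the vanishing first moment of \<open>P2\<close> into \<open>P c = 0\<close>.\<close>
  have "((\<lambda>t. P2 t * \<tau> t - P t * 0) has_integral ((P1 c * \<tau> c - P c * 1) - (P1 a * \<tau> a - P a * 1))) {a..c}"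
    by (rule sobolev2_Green[OF S \<tau>S])
  then have "((\<lambda>t. P2 t * \<tau> t) has_integral - P c) {a..c}" using P0 P1c by simp
  from has_integral_unique[OF this P2_\<tau>] have "P c = 0" by simp
  then have "L2_inner ?M P2 k = 0" by (rule orth[OF S P0 _ P1c])
  moreover have "L2_inner ?M P2 (\<lambda>t. A + B * \<tau> t) = 0"
  proof -
    have "((\<lambda>t. cnj A * P2 t + cnj B * (P2 t * \<tau> t)) has_integral (cnj A * 0 + cnj B * 0)) {a..c}"
      by (intro has_integral_add has_integral_mult_right P2_0 P2_\<tau>)
    moreover have "L2_inner ?M P2 (\<lambda>t. A + B * \<tau> t) = integral {a..c} (\<lambda>t. P2 t * cnj (A + B * \<tau> t))"
      unfolding L2_inner_def by (rule LI[OF L2_mult_cnj_integrable[OF P2L AB]])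
    ultimately show ?thesis
      by (simp add: integral_unique \<tau>_def algebra_simps)
  qed
  ultimately have "L2_inner ?M P2 (\<lambda>t. k t - (A + B * \<tau> t)) = 0"
    by (simp add: L2_inner_diff_right k AB P2L)
  then have "L2_inner ?M P2 P2 = 0" by (simp flip: P2_def)
  then have "L2_norm ?M P2 = 0" by (simp only: L2_inner_self of_real_eq_0_iff power_eq_0_iff)
  then have "AE t in ?M. P2 t = 0" by (rule L2_norm_eq_0_imp_AE[OF P2L])
  then have "AE t in ?M. k t = (A - B * of_real (m - a)) + B * of_real (t - a)"
    by (rule AE_mp) (auto simp: P2_def \<tau>_def algebra_simps)
  then show thesis by (rule that)
qed

section \<open>The maximal operator\<close>

text \<open>Lebesgue measure is complete, so the exceptional set need not be known to be measurable.
  This matters for sets where a derivative fails to exist.\<close>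

lemma AE_lebesgue_on_iff_negligible:
  assumes S: "S \<in> sets lebesgue"
  shows "(AE t in lebesgue_on S. Q t) \<longleftrightarrow> negligible {t \<in> S. \<not> Q t}"
proof -
  have "(AE t in lebesgue_on S. Q t) \<longleftrightarrow> (AE t in lebesgue. t \<in> S \<longrightarrow> Q t)"
    using S by (simp add: AE_restrict_space_iff)
  also have "\<dots> \<longleftrightarrow> negligible {t \<in> S. \<not> Q t}"
  proof
    assume "AE t in lebesgue. t \<in> S \<longrightarrow> Q t"
    then obtain N where N: "{t \<in> space lebesgue. \<not> (t \<in> S \<longrightarrow> Q t)} \<subseteq> N" "N \<in> null_sets lebesgue"
      unfolding eventually_ae_filter by blast
    then have "negligible N" by (simp add: negligible_iff_null_sets)
    then show "negligible {t \<in> S. \<not> Q t}"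
      by (rule negligible_subset) (use N(1) in auto)
  next
    assume "negligible {t \<in> S. \<not> Q t}"
    then have "{t \<in> S. \<not> Q t} \<in> null_sets lebesgue" by (simp add: negligible_iff_null_sets)
    then show "AE t in lebesgue. t \<in> S \<longrightarrow> Q t"
      by (rule AE_I') auto
  qed
  finally show ?thesis .
qed

locale delta_points =
  fixes b :: ereal and x \<alpha> :: "nat \<Rightarrow> real"
  assumes x0: "x 0 = 0" and mono: "strict_mono x" and xb: "\<And>n. ereal (x n) < b"
    and lim: "(\<lambda>n. ereal (x n)) \<longlonglongrightarrow> b"
begin

abbreviation "I \<equiv> Ival b"
abbreviation "X \<equiv> pts x"
abbreviation "M \<equiv> lebesgue_on I"
abbreviation "J n \<equiv> {x n..x (Suc n)}"

lemma x_less_iff [simp]: "x m < x n \<longleftrightarrow> m < n"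
  using mono by (simp add: strict_mono_less)

lemma x_le_iff [simp]: "x m \<le> x n \<longleftrightarrow> m \<le> n"
  using mono by (simp add: strict_mono_less_eq)

lemma x_eq_iff [simp]: "x m = x n \<longleftrightarrow> m = n"
  using mono by (simp add: strict_mono_eq)

lemma x_nonneg [simp]: "0 \<le> x n"
  using x_le_iff[of 0 n] x0 by (simp del: x_le_iff)

lemma Icc_subset_I: "{0..x N} \<subseteq> I"
proof
  fix t assume t: "t \<in> {0..x N}"
  then have "ereal t \<le> ereal (x N)" by simp
  also have "\<dots> < b" by (rule xb)
  finally show "t \<in> I" using t by (simp add: Ival_def)
qed

lemma J_subset_I: "J n \<subseteq> I"
proof
  fix t assume "t \<in> J n"
  then have "t \<in> {0..x (Suc n)}" using order_trans[OF x_nonneg[of n], of t] by simp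
  then show "t \<in> I" by (rule subsetD[OF Icc_subset_I])
qed

lemma I_cell:
  assumes "t \<in> I"
  obtains n where "x n \<le> t" "t < x (Suc n)"
proof -
  from assms have t: "0 \<le> t" "ereal t < b" by (auto simp: Ival_def)
  have "\<forall>\<^sub>F n in sequentially. ereal t < ereal (x n)" using order_tendstoD(1)[OF lim t(2)] .
  then obtain n where n: "t < x n" by (auto simp: eventually_sequentially)
  define m where "m = (LEAST n. t < x n)"
  have m: "t < x m" unfolding m_def by (rule LeastI) (rule n)
  have "m \<noteq> 0"
  proof
    assume "m = 0"
    with m t x0 show False by simp
  qed
  then obtain k where k: "m = Suc k" by (cases m) auto
  then have "\<not> t < x k" unfolding m_def using not_less_Least[of k "\<lambda>n. t < x n"] by (simp add: m_def)
  with k m show thesis using that[of k] by simp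
qed

text \<open>Half-open cells: a glued function takes its value at an interaction point from the cell
  on the right, and its value at 0 from cell 0.\<close>

definition cell :: "real \<Rightarrow> nat" where
  "cell t = (THE n. x n \<le> t \<and> t < x (Suc n))"

lemma cell_unique:
  assumes "x n \<le> t" "t < x (Suc n)" "x m \<le> t" "t < x (Suc m)"
  shows "m = n"
proof -
  have "x n < x (Suc m)" "x m < x (Suc n)" using assms by linarith+
  then show ?thesis by simp
qed

lemma cell_eq: "x n \<le> t \<Longrightarrow> t < x (Suc n) \<Longrightarrow> cell t = n"
  unfolding cell_def by (rule the_equality) (use cell_unique in blast)+

lemma I_eq_Union: "I = (\<Union>n. J n)"
proof
  show "I \<subseteq> (\<Union>n. J n)"
  proof
    fix t assume "t \<in> I"
    then obtain n where "x n \<le> t" "t < x (Suc n)" by (rule I_cell)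
    then show "t \<in> (\<Union>n. J n)" by (intro UN_I[of n]) auto
  qed
qed (use J_subset_I in blast)

lemma I_lebesgue [simp, intro]: "I \<in> sets lebesgue"
  unfolding I_eq_Union by (intro sets.countable_UN) auto

lemma J_lebesgue [simp]: "J n \<in> sets lebesgue"
  by simp

lemma AE_I_iff: "(AE t in M. Q t) \<longleftrightarrow> (\<forall>n. AE t in lebesgue_on (J n). Q t)"
proof -
  have "{t \<in> I. \<not> Q t} = (\<Union>n. {t \<in> J n. \<not> Q t})" unfolding I_eq_Union by blast
  moreover have "negligible (\<Union>n. {t \<in> J n. \<not> Q t}) \<longleftrightarrow> (\<forall>n. negligible {t \<in> J n. \<not> Q t})"
  proof
    assume "negligible (\<Union>n. {t \<in> J n. \<not> Q t})"
    then show "\<forall>n. negligible {t \<in> J n. \<not> Q t}" by (blast intro: negligible_subset)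
  next
    assume "\<forall>n. negligible {t \<in> J n. \<not> Q t}"
    then show "negligible (\<Union>n. {t \<in> J n. \<not> Q t})" by (intro negligible_countable_Union) auto
  qed
  ultimately show ?thesis by (simp add: AE_lebesgue_on_iff_negligible)
qed

lemma J_L2:
  assumes "f \<in> L2 M" shows "f \<in> L2 (lebesgue_on (J n))"
  by (rule L2_lebesgue_on_subset[OF assms J_subset_I]) auto

text \<open>Dominated convergence along \<open>[0, x N]\<close>. Through this the adjoint equation
  and Green's formula are cut into cells, and the cellwise norms become square summable.\<close>

lemma integral_sums:
  fixes g :: "real \<Rightarrow> complex"
  assumes g: "integrable M g"
  shows "(\<lambda>n. integral (J n) g) sums integral\<^sup>L M g"
proof -
  have gi: "g integrable_on I" by (rule integrable_on_lebesgue_on[OF g]) simp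
  have gm: "g \<in> borel_measurable M" using g by (rule borel_measurable_integrable)
  have gs: "integrable (lebesgue_on {0..x N}) g" for N
  proof -
    have "set_integrable lebesgue I g"
      using g by (simp add: integrable_restrict_space set_integrable_def)
    then have "set_integrable lebesgue {0..x N} g"
      by (rule set_integrable_subset) (use Icc_subset_I in auto)
    then show ?thesis by (simp add: integrable_restrict_space set_integrable_def)
  qed
  have part: "integral {0..x N} g = (\<Sum>n<N. integral (J n) g)" for N
  proof (induction N)
    case 0 then show ?case by (simp add: x0)
  next
    case (Suc N)
    have "g integrable_on {0..x (Suc N)}"
      by (rule integrable_on_lebesgue_on[OF gs]) simp
    then have "integral {0..x N} g + integral (J N) g = integral {0..x (Suc N)} g"
      by (intro Henstock_Kurzweil_Integration.integral_combine) auto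
    with Suc show ?case by simp
  qed
  have "(\<lambda>N. LINT t|M. (if t \<in> {0..x N} then g t else 0)) \<longlonglongrightarrow> integral\<^sup>L M g"
  proof (rule integral_dominated_convergence[where w = "\<lambda>t. norm (g t)"])
    show "(\<lambda>t. if t \<in> {0..x N} then g t else 0) \<in> borel_measurable M" for N
    proof (rule measurable_If_set[OF gm])
      show "{0..x N} \<inter> space M \<in> sets M"
        using Icc_subset_I[of N] by (simp add: sets_restrict_space_iff Int_absorb2)
    qed simp
    show "AE t in M. (\<lambda>N. if t \<in> {0..x N} then g t else 0) \<longlonglongrightarrow> g t"
    proof (rule AE_I2)
      fix t assume "t \<in> space M"
      then have "t \<in> I" by simp
      then obtain n where n: "x n \<le> t" "t < x (Suc n)" by (rule I_cell)
      have "t \<in> {0..x N}" if "N \<ge> Suc n" for N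
      proof -
        have "t \<le> x N" using n(2) x_le_iff[of "Suc n" N] that by (simp del: x_le_iff)
        moreover have "0 \<le> t" using n(1) x_nonneg[of n] by linarith
        ultimately show ?thesis by simp
      qed
      then show "(\<lambda>N. if t \<in> {0..x N} then g t else 0) \<longlonglongrightarrow> g t"
        by (intro tendsto_eventually eventually_sequentiallyI[of "Suc n"]) simp
    qed
  qed (use gm g in auto)
  moreover have "(LINT t|M. (if t \<in> {0..x N} then g t else 0)) = (\<Sum>n<N. integral (J n) g)" for N
  proof -
    have "(LINT t|M. (if t \<in> {0..x N} then g t else 0)) = integral\<^sup>L (lebesgue_on {0..x N}) g"
      by (rule Lebesgue_Measure.integral_restrict) (use Icc_subset_I in auto)
    also have "\<dots> = integral {0..x N} g"
      by (rule lebesgue_integral_eq_integral[OF gs]) simp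
    finally show ?thesis using part by simp
  qed
  ultimately show ?thesis by (simp add: sums_def)
qed

lemma at_within_cell:
  assumes t: "t \<in> I - X" and n: "x n \<le> t" "t < x (Suc n)"
  shows "at t within (I - X) = at t within J n"
proof -
  \<comment> \<open>For \<open>n = 0\<close> the neighbourhood must contain 0, which belongs to
    \<open>I - X\<close> and carries a one-sided derivative.\<close>
  define S where "S = (if n = 0 then {..<x (Suc n)} else {x n<..<x (Suc n)})"
  have XS: "x k \<notin> S" if "k \<ge> 1" for k
    using that by (auto simp: S_def)
  have "t \<in> S"
  proof (cases "n = 0")
    case False
    then have "x n \<in> X" by (auto simp: pts_def)
    with t have "x n \<noteq> t" by auto
    with n False show ?thesis by (simp add: S_def)
  qed (use n in \<open>simp add: S_def\<close>)
  moreover have "open S" by (simp add: S_def)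
  moreover have "(I - X) \<inter> S - {t} = J n \<inter> S - {t}"
  proof -
    have "s \<in> J n" if "s \<in> I" "s \<in> S" for s
      using that x0 by (auto simp: S_def Ival_def split: if_splits)
    moreover have "s \<in> I - X" if "s \<in> J n" "s \<in> S" for s
      using subsetD[OF J_subset_I that(1)] that(2) XS by (auto simp: pts_def)
    ultimately show ?thesis by blast
  qed
  ultimately show ?thesis by (rule at_within_nhd)
qed

lemma open_cell_subset: "{x n<..<x (Suc n)} \<subseteq> I - X"
proof -
  have "x k \<notin> {x n<..<x (Suc n)}" for k by auto
  then show ?thesis using J_subset_I[of n] by (fastforce simp: pts_def)
qed

lemma at_within_open_cell:
  assumes "t \<in> {x n<..<x (Suc n)}"
  shows "at t within (I - X) = at t" "at t within J n = at t"
  using assms open_cell_subset[of n]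
  by (auto intro!: at_within_interior intro: interiorI[of "{x n<..<x (Suc n)}"])

text \<open>
  Cells are numbered from \<open>0\<close>: \<open>U n\<close> matters on \<open>[x n, x (n + 1)]\<close> only, and
  \<open>\<alpha> (Suc n)\<close> couples the cells \<open>n\<close> and \<open>n + 1\<close>.
\<close>

definition delta_rep :: "(real \<Rightarrow> complex) \<Rightarrow> (real \<Rightarrow> complex) \<Rightarrow> (nat \<Rightarrow> real \<Rightarrow> complex) \<Rightarrow> (nat \<Rightarrow> real \<Rightarrow> complex) \<Rightarrow> bool" where
  "delta_rep u v U U1 \<longleftrightarrow>
     (\<forall>n. sobolev2 (x n) (x (Suc n)) (U n) (U1 n) (\<lambda>t. - v t)) \<and>
     (\<forall>n. AE t in lebesgue_on (J n). u t = U n t) \<and>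
     (\<forall>n. U (Suc n) (x (Suc n)) = U n (x (Suc n))) \<and>
     (\<forall>n. U1 (Suc n) (x (Suc n)) - U1 n (x (Suc n)) = of_real (\<alpha> (Suc n)) * U n (x (Suc n))) \<and>
     U1 0 0 = 0"

text \<open>The maximal operator. As \<open>u\<close> and \<open>U n\<close> agree only almost
  everywhere, the set is stable under changes on null sets, just as the adjoint is.\<close>

definition delta_max :: "real op_graph" where
  "delta_max = {(u, v). u \<in> L2 M \<and> v \<in> L2 M \<and> (\<exists>U U1. delta_rep u v U U1)}"

lemma H0_subset_delta_max: "H0_delta b x \<alpha> \<subseteq> delta_max"
proof (rule subsetI, clarify)
  fix f g assume "(f, g) \<in> H0_delta b x \<alpha>"
  then obtain f1 f2 where g: "g = (\<lambda>t. - f2 t)" and W: "W22_with I X f f1 f2" and f10: "f1 0 = 0"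
    and int: "\<And>n. n \<ge> 1 \<Longrightarrow> \<exists>c p q. (f \<longlongrightarrow> c) (at_left (x n)) \<and> (f \<longlongrightarrow> c) (at_right (x n)) \<and>
          (f1 \<longlongrightarrow> p) (at_left (x n)) \<and> (f1 \<longlongrightarrow> q) (at_right (x n)) \<and> q - p = of_real (\<alpha> n) * c"
    unfolding H0_delta_def by blast
  have fL: "f \<in> L2 M" and f2L: "f2 \<in> L2 M" and AC: "f \<in> AC_loc (I - X)" and AC1: "f1 \<in> AC_loc (I - X)"
    and der: "\<And>t. t \<in> I - X \<Longrightarrow> (f has_vector_derivative f1 t) (at t within I - X)"
    and der1: "AE t in M. (f1 has_vector_derivative f2 t) (at t within I - X)"
    using W unfolding W22_with_def by blast+
  obtain c p q where cpq: "\<And>n. (f \<longlongrightarrow> c (Suc n)) (at_left (x (Suc n)))" "\<And>n. (f \<longlongrightarrow> c (Suc n)) (at_right (x (Suc n)))"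
    "\<And>n. (f1 \<longlongrightarrow> p (Suc n)) (at_left (x (Suc n)))" "\<And>n. (f1 \<longlongrightarrow> q (Suc n)) (at_right (x (Suc n)))"
    "\<And>n. q (Suc n) - p (Suc n) = of_real (\<alpha> (Suc n)) * c (Suc n)"
    using int by (metis le_add1 plus_1_eq_Suc)
  define N where "N = {t \<in> I. \<not> (f1 has_vector_derivative f2 t) (at t within I - X)}"
  have N: "negligible N" using der1 by (simp add: AE_lebesgue_on_iff_negligible N_def)
  \<comment> \<open>\<open>[0, y]\<close> is a compact interval inside \<open>I - X\<close>.
    Absolute continuity on it supplies at 0 the right limits that the interface conditions supply at
    the other nodes.\<close>
  define y where "y = x (Suc 0) / 2"
  have y: "0 < y" "y < x (Suc 0)" using x_less_iff[of 0 "Suc 0"] x0 by (simp_all add: y_def del: x_less_iff)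
  have sub0: "{0..y} \<subseteq> I - X"
  proof
    fix t assume t: "t \<in> {0..y}"
    then have "t \<in> J 0" using y x0 by simp
    moreover have "t \<noteq> x k" if "k \<ge> 1" for k
      using t y x_le_iff[of "Suc 0" k] that by (auto simp del: x_le_iff)
    ultimately show "t \<in> I - X" using J_subset_I[of 0] by (auto simp: pts_def)
  qed
  have right0: "(h \<longlongrightarrow> h 0) (at_right 0)" if "h \<in> AC_loc (I - X)" for h
  proof -
    have "abs_cont_on 0 y h" using that sub0 y by (auto simp: AC_loc_def)
    from continuous_on_Icc_one_sided_limits(1)[OF abs_cont_on_imp_continuous[OF this] y(1)] show ?thesis .
  qed
  define c0 where "c0 n = (if n = 0 then f 0 else c n)" for n
  define q0 where "q0 n = (if n = 0 then 0 else q n)" for n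
  have "\<exists>U U1. sobolev2 (x n) (x (Suc n)) U U1 f2 \<and> U (x n) = c0 n \<and> U1 (x n) = q0 n \<and>
      (\<forall>t\<in>{x n<..<x (Suc n)}. U t = f t \<and> U1 t = f1 t)" for n
  proof -
    have l0: "(f \<longlongrightarrow> c0 n) (at_right (x n))"
      using right0[OF AC] cpq(2) by (cases n) (auto simp: c0_def x0)
    have l1: "(f1 \<longlongrightarrow> q0 n) (at_right (x n))"
      using right0[OF AC1] f10 cpq(4) by (cases n) (auto simp: q0_def x0)
    have d0: "(f has_vector_derivative f1 t) (at t)" if t: "t \<in> {x n<..<x (Suc n)}" for t
      using der[of t] open_cell_subset[of n] t at_within_open_cell(1)[OF t] by auto
    have d1: "(f1 has_vector_derivative f2 t) (at t)" if t: "t \<in> {x n<..<x (Suc n)} - N" for t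
      using t open_cell_subset[of n] at_within_open_cell(1)[of t n] by (auto simp: N_def)
    have AC1': "abs_cont_on s t f1" if "x n < s" "s \<le> t" "t < x (Suc n)" for s t
    proof -
      have "{s..t} \<subseteq> {x n<..<x (Suc n)}" using that by auto
      then have "{s..t} \<subseteq> I - X" using open_cell_subset by (rule subset_trans)
      then show ?thesis using AC1 that by (simp add: AC_loc_def)
    qed
    have lt: "x n < x (Suc n)" by simp
    obtain U U1 where "sobolev2 (x n) (x (Suc n)) U U1 f2" "U (x n) = c0 n" "U1 (x n) = q0 n"
      "\<And>t. t \<in> {x n<..<x (Suc n)} \<Longrightarrow> U t = f t" "\<And>t. t \<in> {x n<..<x (Suc n)} \<Longrightarrow> U1 t = f1 t"
      by (rule sobolev2_of_open_interval[OF lt d0 AC1' N d1 J_L2[OF f2L] l0 l1]) (assumption | rule that)+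
    then show ?thesis by blast
  qed
  then obtain U U1 where U: "\<And>n. sobolev2 (x n) (x (Suc n)) (U n) (U1 n) f2" "\<And>n. U n (x n) = c0 n" "\<And>n. U1 n (x n) = q0 n"
    "\<And>n t. t \<in> {x n<..<x (Suc n)} \<Longrightarrow> U n t = f t" "\<And>n t. t \<in> {x n<..<x (Suc n)} \<Longrightarrow> U1 n t = f1 t"
    by metis
  \<comment> \<open>Values at the right end of a cell are identified by uniqueness of left
    limits.\<close>
  have left: "V (x (Suc n)) = l" if "continuous_on (J n) V" "(h \<longlongrightarrow> l) (at_left (x (Suc n)))"
    "\<And>t. t \<in> {x n<..<x (Suc n)} \<Longrightarrow> V t = h t" for V h :: "real \<Rightarrow> complex" and l n
  proof -
    have "(V \<longlongrightarrow> V (x (Suc n))) (at_left (x (Suc n)))"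
      by (rule continuous_on_Icc_one_sided_limits(2)[OF that(1)]) simp
    moreover have "\<forall>\<^sub>F t in at_left (x (Suc n)). V t = h t"
      unfolding eventually_at_left_field by (intro exI[of _ "x n"]) (auto intro!: that(3))
    ultimately have "(h \<longlongrightarrow> V (x (Suc n))) (at_left (x (Suc n)))"
      by (rule Lim_transform_eventually)
    with that(2) show ?thesis
      by (intro tendsto_unique[of "at_left (x (Suc n))" h]) (auto simp: trivial_limit_at_left_real)
  qed
  have Uc: "U n (x (Suc n)) = c (Suc n)" for n
    by (rule left[OF sobolev2D(7)[OF U(1)] cpq(1) U(4)])
  have U1p: "U1 n (x (Suc n)) = p (Suc n)" for n
    by (rule left[OF sobolev2D(6)[OF U(1)] cpq(3) U(5)])
  have "delta_rep f g U U1"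
    unfolding delta_rep_def
  proof (intro conjI allI)
    show "sobolev2 (x n) (x (Suc n)) (U n) (U1 n) (\<lambda>t. - g t)" for n using U(1)[of n] by (simp add: g)
    show "AE t in lebesgue_on (J n). f t = U n t" for n
    proof -
      have "{t \<in> J n. f t \<noteq> U n t} \<subseteq> {x n, x (Suc n)}"
      proof
        fix t assume t: "t \<in> {t \<in> J n. f t \<noteq> U n t}"
        then have "t \<notin> {x n<..<x (Suc n)}" using U(4)[of t n] by auto
        with t show "t \<in> {x n, x (Suc n)}" by auto
      qed
      then have "negligible {t \<in> J n. f t \<noteq> U n t}"
        by (rule negligible_subset[rotated]) simp
      then show ?thesis by (simp add: AE_lebesgue_on_iff_negligible)
    qed
    show "U (Suc n) (x (Suc n)) = U n (x (Suc n))" for n by (simp add: U(2) Uc c0_def)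
    show "U1 (Suc n) (x (Suc n)) - U1 n (x (Suc n)) = of_real (\<alpha> (Suc n)) * U n (x (Suc n))" for n
      by (simp add: U(3) U1p Uc q0_def cpq(5))
    show "U1 0 0 = 0" using U(3)[of 0] by (simp add: x0 q0_def)
  qed
  then show "(f, g) \<in> delta_max"
    using fL L2_uminus[OF f2L] by (auto simp: delta_max_def g)
qed

end

section \<open>Test functions and the adjoint\<close>

lemma abs_cont_on_subset_cong:
  assumes G: "abs_cont_on a c G" and sub: "a \<le> s" "t \<le> c" and eq: "\<And>r. r \<in> {s..t} \<Longrightarrow> F r = G r"
  shows "abs_cont_on s t F"
  unfolding abs_cont_on_def
proof (intro allI impI)
  fix e :: real assume e: "e > 0"
  obtain \<delta> where \<delta>: "\<delta> > 0" "\<And>D s. D division_of s \<Longrightarrow> s \<subseteq> {a..c} \<Longrightarrow> (\<Sum>K\<in>D. Sup K - Inf K) < \<delta>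
       \<Longrightarrow> (\<Sum>K\<in>D. cmod (G (Sup K) - G (Inf K))) < e"
    by (rule abs_cont_onE[OF G e]) (rule that; assumption)
  show "\<exists>\<delta>>0. \<forall>D s'. D division_of s' \<and> s' \<subseteq> {s..t} \<and> (\<Sum>K\<in>D. Sup K - Inf K) < \<delta>
       \<longrightarrow> (\<Sum>K\<in>D. cmod (F (Sup K) - F (Inf K))) < e"
  proof (intro exI[of _ \<delta>] conjI allI impI \<delta>(1), elim conjE)
    fix D s' assume D: "D division_of s'" "s' \<subseteq> {s..t}" "(\<Sum>K\<in>D. Sup K - Inf K) < \<delta>"
    have "{s..t} \<subseteq> {a..c}" using sub by auto
    then have "s' \<subseteq> {a..c}" using D(2) by (rule subset_trans[rotated])
    from \<delta>(2)[OF D(1) this D(3)] have "(\<Sum>K\<in>D. cmod (G (Sup K) - G (Inf K))) < e" .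
    also have "(\<Sum>K\<in>D. cmod (G (Sup K) - G (Inf K))) = (\<Sum>K\<in>D. cmod (F (Sup K) - F (Inf K)))"
    proof (rule sum.cong[OF refl])
      fix K assume K: "K \<in> D"
      obtain u v where uv: "K = {u..v}" "u \<le> v" "Sup K = v" "Inf K = u"
        using division_of_realE[OF D(1) K] by metis
      have "K \<subseteq> {s..t}" using division_ofD(2)[OF D(1) K] D(2) by blast
      then have "u \<in> {s..t}" "v \<in> {s..t}" using uv(1,2) by auto
      then show "cmod (G (Sup K) - G (Inf K)) = cmod (F (Sup K) - F (Inf K))"
        by (simp only: uv(3,4) eq)
    qed
    finally show "(\<Sum>K\<in>D. cmod (F (Sup K) - F (Inf K))) < e" .
  qed
qed

lemma L2_zero_extension:
  fixes h :: "real \<Rightarrow> complex"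
  assumes h: "h \<in> L2 (lebesgue_on T)" and S: "S \<subseteq> T" "S \<in> sets lebesgue" "T \<in> sets lebesgue" "I \<in> sets lebesgue"
  shows "(\<lambda>t. if t \<in> S then h t else 0) \<in> L2 (lebesgue_on I)"
proof -
  have hS: "h \<in> L2 (lebesgue_on S)" by (rule L2_lebesgue_on_subset[OF h S(1,2,3)])
  have "(\<lambda>t. if t \<in> S then h t else 0) \<in> borel_measurable lebesgue"
    using L2D(1)[OF hS] S(2) by (simp add: borel_measurable_if)
  then have m: "(\<lambda>t. if t \<in> S then h t else 0) \<in> borel_measurable (lebesgue_on I)"
    by (rule measurable_restrict_space1)
  have "integrable lebesgue (\<lambda>t. if t \<in> S then (cmod (h t))\<^sup>2 else 0)"
    using L2D(2)[OF hS] S(2) by (simp add: Lebesgue_Measure.integrable_restrict_UNIV)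
  then have "integrable lebesgue (\<lambda>t. indicator I t *\<^sub>R (if t \<in> S then (cmod (h t))\<^sup>2 else 0))"
    using S(4) by (intro integrable_mult_indicator)
  then have "integrable (lebesgue_on I) (\<lambda>t. if t \<in> S then (cmod (h t))\<^sup>2 else 0)"
    using S(4) by (simp add: integrable_restrict_space)
  moreover have "(\<lambda>t. if t \<in> S then (cmod (h t))\<^sup>2 else 0) = (\<lambda>t. (cmod (if t \<in> S then h t else 0))\<^sup>2)"
    by auto
  ultimately show ?thesis using m by (simp add: L2_def)
qed

lemma L2_sum:
  assumes "finite A" "\<And>i. i \<in> A \<Longrightarrow> f i \<in> L2 M"
  shows "(\<lambda>t. \<Sum>i\<in>A. f i t) \<in> L2 M"
  using assms by (induction rule: finite_induct) (auto intro: L2_add)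

lemma L2_cong_space:
  assumes "f \<in> L2 M" "\<And>t. t \<in> space M \<Longrightarrow> f t = g t"
  shows "g \<in> L2 M"
proof -
  have "g \<in> borel_measurable M" using L2D(1)[OF assms(1)] assms(2) by (simp cong: measurable_cong)
  moreover have "integrable M (\<lambda>t. (cmod (g t))\<^sup>2)"
    using L2D(2)[OF assms(1)] assms(2) by (simp cong: Bochner_Integration.integrable_cong)
  ultimately show ?thesis by (simp add: L2_def)
qed

section \<open>Gluing one function per cell\<close>

context delta_points
begin

lemma glue_L2:
  assumes h: "\<And>n. h n \<in> L2 (lebesgue_on (J n))" and fin: "\<And>n. n \<ge> N \<Longrightarrow> h n = (\<lambda>_. 0)"
  shows "(\<lambda>t. h (cell t) t) \<in> L2 M"
proof -
  let ?S = "\<lambda>n. {x n..<x (Suc n)}"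
  have "(\<lambda>t. \<Sum>n<N. if t \<in> ?S n then h n t else 0) \<in> L2 M"
    by (intro L2_sum L2_zero_extension[OF h]) auto
  then show ?thesis
  proof (rule L2_cong_space)
    fix t assume "t \<in> space M"
    then have "t \<in> I" by simp
    then obtain n where n: "x n \<le> t" "t < x (Suc n)" by (rule I_cell)
    have S: "t \<in> ?S m \<longleftrightarrow> m = n" for m using cell_unique[OF n, of m] n by auto
    have "(\<Sum>m<N. if t \<in> ?S m then h m t else 0) = (\<Sum>m<N. if m = n then h m t else 0)"
      by (simp only: S)
    also have "\<dots> = h n t" using fin[of n] by (cases "n < N") simp_all
    finally show "(\<Sum>n<N. if t \<in> ?S n then h n t else 0) = h (cell t) t"
      by (simp only: cell_eq[OF n])
  qed
qed

lemma glue_derivative: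
  assumes t: "t \<in> I - X" and n: "x n \<le> t" "t < x (Suc n)"
    and d: "(G n has_vector_derivative d) (at t within J n)"
  shows "((\<lambda>t. G (cell t) t) has_vector_derivative d) (at t within (I - X))"
  unfolding at_within_cell[OF t n]
proof (rule has_vector_derivative_transform_within[OF d])
  show "0 < x (Suc n) - t" using n by simp
  show "t \<in> J n" using n by simp
  fix s assume s: "s \<in> J n" "dist s t < x (Suc n) - t"
  then have "x n \<le> s" "s < x (Suc n)" by (auto simp: dist_real_def)
  then show "G n s = G (cell s) s" by (simp only: cell_eq)
qed

text \<open>A compact interval inside \<open>I - X\<close> stays in one cell: otherwise it would
  contain the right end of the cell in which it starts.\<close>

lemma glue_AC_loc:
  assumes "\<And>n. abs_cont_on (x n) (x (Suc n)) (G n)"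
  shows "(\<lambda>t. G (cell t) t) \<in> AC_loc (I - X)"
  unfolding AC_loc_def
proof (clarify)
  fix s t assume st: "s \<le> t" and sub: "{s..t} \<subseteq> I - X"
  then have "s \<in> I" by auto
  then obtain n where n: "x n \<le> s" "s < x (Suc n)" by (rule I_cell)
  have "x (Suc n) \<in> X" by (auto simp: pts_def)
  have t: "t < x (Suc n)"
  proof (rule ccontr)
    assume "\<not> t < x (Suc n)"
    then have "x (Suc n) \<in> {s..t}" using n by simp
    with sub \<open>x (Suc n) \<in> X\<close> show False by blast
  qed
  show "abs_cont_on s t (\<lambda>t. G (cell t) t)"
  proof (rule abs_cont_on_subset_cong[OF assms n(1)])
    show "t \<le> x (Suc n)" using t by simp
    fix r assume "r \<in> {s..t}"
    then have "x n \<le> r" "r < x (Suc n)" using n t by auto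
    then show "G (cell r) r = G n r" by (simp only: cell_eq)
  qed
qed

lemma glue_limits:
  fixes G :: "nat \<Rightarrow> real \<Rightarrow> complex"
  assumes "\<And>n. continuous_on (J n) (G n)"
  shows "((\<lambda>t. G (cell t) t) \<longlongrightarrow> G n (x (Suc n))) (at_left (x (Suc n)))"
    "((\<lambda>t. G (cell t) t) \<longlongrightarrow> G n (x n)) (at_right (x n))"
proof -
  have lt: "x n < x (Suc n)" by simp
  show "((\<lambda>t. G (cell t) t) \<longlongrightarrow> G n (x (Suc n))) (at_left (x (Suc n)))"
  proof (rule Lim_transform_eventually[OF continuous_on_Icc_one_sided_limits(2)[OF assms[of n] lt]])
    show "\<forall>\<^sub>F t in at_left (x (Suc n)). G n t = G (cell t) t"
      unfolding eventually_at_left_field by (intro exI[of _ "x n"]) (auto simp: cell_eq[of n])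
  qed
  show "((\<lambda>t. G (cell t) t) \<longlongrightarrow> G n (x n)) (at_right (x n))"
  proof (rule Lim_transform_eventually[OF continuous_on_Icc_one_sided_limits(1)[OF assms[of n] lt]])
    show "\<forall>\<^sub>F t in at_right (x n). G n t = G (cell t) t"
      unfolding eventually_at_right_field by (intro exI[of _ "x (Suc n)"]) (auto simp: cell_eq[of n])
  qed
qed

text \<open>An element of the domain of \<open>H0_delta\<close> given cell by cell; vanishing from
  cell \<open>N\<close> on makes the support compact in \<open>I\<close>.\<close>

definition test_family :: "nat \<Rightarrow> (nat \<Rightarrow> real \<Rightarrow> complex) \<Rightarrow> (nat \<Rightarrow> real \<Rightarrow> complex) \<Rightarrow> (nat \<Rightarrow> real \<Rightarrow> complex) \<Rightarrow> bool" where
  "test_family N P P1 P2 \<longleftrightarrow>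
     (\<forall>n. sobolev2 (x n) (x (Suc n)) (P n) (P1 n) (P2 n)) \<and>
     (\<forall>n\<ge>N. P n = (\<lambda>_. 0) \<and> P2 n = (\<lambda>_. 0)) \<and>
     (\<forall>n. P (Suc n) (x (Suc n)) = P n (x (Suc n))) \<and>
     (\<forall>n. P1 (Suc n) (x (Suc n)) - P1 n (x (Suc n)) = of_real (\<alpha> (Suc n)) * P n (x (Suc n))) \<and>
     P1 0 0 = 0"

lemma test_familyD:
  assumes "test_family N P P1 P2"
  shows "\<And>n. sobolev2 (x n) (x (Suc n)) (P n) (P1 n) (P2 n)"
    "\<And>n. n \<ge> N \<Longrightarrow> P n = (\<lambda>_. 0)" "\<And>n. n \<ge> N \<Longrightarrow> P2 n = (\<lambda>_. 0)"
    "\<And>n. P (Suc n) (x (Suc n)) = P n (x (Suc n))"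
    "\<And>n. P1 (Suc n) (x (Suc n)) - P1 n (x (Suc n)) = of_real (\<alpha> (Suc n)) * P n (x (Suc n))"
    "P1 0 0 = 0"
  using assms unfolding test_family_def by blast+

lemma test_family_L2:
  assumes "test_family N P P1 P2"
  shows "(\<lambda>t. P (cell t) t) \<in> L2 M" "(\<lambda>t. P2 (cell t) t) \<in> L2 M"
proof -
  note T = test_familyD[OF assms]
  have "P n \<in> L2 (lebesgue_on (J n))" for n
    by (rule continuous_on_imp_L2[OF sobolev2D(7)[OF T(1)]])
  then show "(\<lambda>t. P (cell t) t) \<in> L2 M" by (rule glue_L2) (rule T(2))
  show "(\<lambda>t. P2 (cell t) t) \<in> L2 M" by (rule glue_L2[OF sobolev2D(2)[OF T(1)]]) (rule T(3))
qed

lemma test_family_H0: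
  assumes "test_family N P P1 P2"
  shows "(\<lambda>t. P (cell t) t, \<lambda>t. - P2 (cell t) t) \<in> H0_delta b x \<alpha>"
proof -
  note T = test_familyD[OF assms]
  let ?F = "\<lambda>t. P (cell t) t" and ?F1 = "\<lambda>t. P1 (cell t) t" and ?F2 = "\<lambda>t. P2 (cell t) t"
  have "W22_with I X ?F ?F1 ?F2"
    unfolding W22_with_def
  proof (intro conjI ballI)
    show "?F \<in> L2 M" "?F2 \<in> L2 M" by (rule test_family_L2[OF assms])+
    show "?F \<in> AC_loc (I - X)"
      by (rule glue_AC_loc, rule abs_cont_on_indefinite_integral[OF sobolev2D(9)[OF T(1)] sobolev2D(5)[OF T(1)]])
    show "?F1 \<in> AC_loc (I - X)"
      by (rule glue_AC_loc, rule abs_cont_on_indefinite_integral[OF sobolev2D(2)[OF T(1)] sobolev2D(4)[OF T(1)]])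
    show "(?F has_vector_derivative ?F1 t) (at t within I - X)" if t: "t \<in> I - X" for t
    proof -
      from t obtain n where n: "x n \<le> t" "t < x (Suc n)" using I_cell[of t] by blast
      then have "t \<in> J n" by simp
      from glue_derivative[where G = P, OF t n sobolev2D(10)[OF T(1) this]] show ?thesis by (simp only: cell_eq[OF n])
    qed
    show "AE t in M. (?F1 has_vector_derivative ?F2 t) (at t within I - X)"
      unfolding AE_I_iff
    proof
      fix n
      obtain E where E: "negligible E"
        "\<And>t. t \<in> J n - E \<Longrightarrow> (P1 n has_vector_derivative P2 n t) (at t within J n)"
        by (rule sobolev2_AE_derivative[OF T(1)[of n]]) (rule that; assumption)
      have "{t \<in> J n. \<not> (?F1 has_vector_derivative ?F2 t) (at t within I - X)} \<subseteq> E \<union> {x n, x (Suc n)}"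
      proof (rule subsetI, rule ccontr)
        fix t assume t: "t \<in> {t \<in> J n. \<not> (?F1 has_vector_derivative ?F2 t) (at t within I - X)}"
          and nE: "t \<notin> E \<union> {x n, x (Suc n)}"
        then have tc: "t \<in> {x n<..<x (Suc n)}" and tE: "t \<in> J n - E" by auto
        then have n: "x n \<le> t" "t < x (Suc n)" by auto
        from glue_derivative[where G = P1, OF subsetD[OF open_cell_subset tc] n E(2)[OF tE]]
        have "(?F1 has_vector_derivative ?F2 t) (at t within I - X)" by (simp only: cell_eq[OF n])
        with t show False by simp
      qed
      then have "negligible {t \<in> J n. \<not> (?F1 has_vector_derivative ?F2 t) (at t within I - X)}"
        by (rule negligible_subset[rotated]) (simp add: negligible_Un E(1))
      then show "AE t in lebesgue_on (J n). (?F1 has_vector_derivative ?F2 t) (at t within I - X)"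
        by (simp add: AE_lebesgue_on_iff_negligible)
    qed
  qed
  moreover have "comp_supp I X ?F"
  proof -
    have "{t \<in> I - X. ?F t \<noteq> 0} \<subseteq> {0..x N}"
    proof
      fix t assume t: "t \<in> {t \<in> I - X. ?F t \<noteq> 0}"
      then have "t \<in> I" by simp
      then obtain n where n: "x n \<le> t" "t < x (Suc n)" by (rule I_cell)
      then have "P n t \<noteq> 0" using t by (simp add: cell_eq)
      then have "\<not> N \<le> n" using T(2)[of n] by auto
      then have "x (Suc n) \<le> x N" by simp
      with n(2) have "t \<le> x N" by linarith
      moreover have "0 \<le> t" using t by (simp add: Ival_def)
      ultimately show "t \<in> {0..x N}" by simp
    qed
    then have sub: "closure {t \<in> I - X. ?F t \<noteq> 0} \<subseteq> {0..x N}"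
      by (rule closure_minimal) simp
    have "compact (closure {t \<in> I - X. ?F t \<noteq> 0})"
      using compact_Int_closed[of "{0..x N}" "closure {t \<in> I - X. ?F t \<noteq> 0}"] sub by (simp add: Int_absorb1)
    with sub Icc_subset_I show ?thesis unfolding comp_supp_def by blast
  qed
  moreover have "?F1 0 = 0"
    using T(6) cell_eq[of 0 0] x0 x_less_iff[of 0 "Suc 0"] by (simp del: x_less_iff)
  moreover have "\<exists>c p q. (?F \<longlongrightarrow> c) (at_left (x n)) \<and> (?F \<longlongrightarrow> c) (at_right (x n)) \<and>
          (?F1 \<longlongrightarrow> p) (at_left (x n)) \<and> (?F1 \<longlongrightarrow> q) (at_right (x n)) \<and> q - p = of_real (\<alpha> n) * c" if n1: "n \<ge> 1" for n
  proof -
    obtain m where m: "n = Suc m" using n1 by (cases n) auto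
    have gP: "(?F \<longlongrightarrow> P m (x (Suc m))) (at_left (x (Suc m)))" "(?F \<longlongrightarrow> P (Suc m) (x (Suc m))) (at_right (x (Suc m)))"
      by (rule glue_limits, rule sobolev2D(7)[OF T(1)])+
    have gP1: "(?F1 \<longlongrightarrow> P1 m (x (Suc m))) (at_left (x (Suc m)))" "(?F1 \<longlongrightarrow> P1 (Suc m) (x (Suc m))) (at_right (x (Suc m)))"
      by (rule glue_limits, rule sobolev2D(6)[OF T(1)])+
    show ?thesis
      unfolding m using gP gP1 T(4)[of m] T(5)[of m] by (intro exI conjI) auto
  qed
  ultimately show ?thesis
    unfolding H0_delta_def by (intro CollectI exI[of _ ?F] exI[of _ ?F2] conjI refl exI[of _ ?F1]) auto
qed

text \<open>The equation defining the adjoint, tested on a glued function and cut into cells, where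
  Green's formula becomes applicable.\<close>

lemma adjoint_test_family:
  assumes uv: "(u, v) \<in> op_adjoint M (H0_delta b x \<alpha>)" and T: "test_family N P P1 P2"
  shows "(\<lambda>n. integral (J n) (\<lambda>t. P2 n t * cnj (u t) + P n t * cnj (v t))) sums 0"
proof -
  have u: "u \<in> L2 M" and v: "v \<in> L2 M"
    and eq: "L2_inner M (\<lambda>t. - P2 (cell t) t) u = L2_inner M (\<lambda>t. P (cell t) t) v"
    using uv test_family_H0[OF T] by (auto simp: op_adjoint_def)
  note L = test_family_L2[OF T]
  let ?g = "\<lambda>t. P2 (cell t) t * cnj (u t) + P (cell t) t * cnj (v t)"
  note i = L2_mult_cnj_integrable[OF L(2) u] L2_mult_cnj_integrable[OF L(1) v]
  have "integral\<^sup>L M ?g = 0"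
  proof -
    have "(LINT t|M. P (cell t) t * cnj (v t)) = - (LINT t|M. P2 (cell t) t * cnj (u t))"
      using eq by (simp add: L2_inner_def)
    with i show ?thesis by simp
  qed
  then have "(\<lambda>n. integral (J n) ?g) sums 0"
    using integral_sums[OF Bochner_Integration.integrable_add[OF i]] by simp
  moreover have "integral (J n) ?g = integral (J n) (\<lambda>t. P2 n t * cnj (u t) + P n t * cnj (v t))" for n
  proof (rule integral_spike[of "{x (Suc n)}"])
    fix t assume "t \<in> J n - {x (Suc n)}"
    then have "x n \<le> t" "t < x (Suc n)" by auto
    then show "P2 n t * cnj (u t) + P n t * cnj (v t) = ?g t" by (simp only: cell_eq)
  qed simp
  ultimately show ?thesis by simp
qed

end

section \<open>Regularity and interface conditions for elements of the adjoint\<close>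

lemma AE_negligible_integral_cong:
  fixes f g :: "real \<Rightarrow> complex"
  assumes "AE t in lebesgue_on S. f t = g t" "S \<in> sets lebesgue"
  shows "integral S f = integral S g"
proof (rule integral_spike)
  show "negligible {t \<in> S. \<not> f t = g t}" using assms by (simp add: AE_lebesgue_on_iff_negligible)
qed auto

lemma sums_single_nat:
  fixes f :: "nat \<Rightarrow> complex"
  assumes "f sums s" "\<And>m. m \<noteq> n \<Longrightarrow> f m = 0"
  shows "f n = s"
proof -
  have "f sums (\<Sum>m\<in>{n}. f m)" by (rule sums_finite) (use assms(2) in auto)
  with assms(1) show ?thesis using sums_unique2 by force
qed

context delta_points
begin

text \<open>The sesquilinear Wronskian of a test function with \<open>U\<close>: the boundary term
  in Green's formula.\<close>

definition flux :: "(nat \<Rightarrow> real \<Rightarrow> complex) \<Rightarrow> (nat \<Rightarrow> real \<Rightarrow> complex) \<Rightarrow> (nat \<Rightarrow> real \<Rightarrow> complex) \<Rightarrow> (nat \<Rightarrow> real \<Rightarrow> complex) \<Rightarrow> nat \<Rightarrow> real \<Rightarrow> complex" where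
  "flux P P1 U U1 n t = P1 n t * cnj (U n t) - P n t * cnj (U1 n t)"

lemma Green_cell:
  assumes P: "sobolev2 (x n) (x (Suc n)) (P n) (P1 n) (P2 n)"
    and U: "sobolev2 (x n) (x (Suc n)) (U n) (U1 n) (\<lambda>t. - v t)"
    and ae: "AE t in lebesgue_on (J n). u t = U n t"
  shows "integral (J n) (\<lambda>t. P2 n t * cnj (u t) + P n t * cnj (v t))
    = flux P P1 U U1 n (x (Suc n)) - flux P P1 U U1 n (x n)"
proof -
  have "integral (J n) (\<lambda>t. P2 n t * cnj (u t) + P n t * cnj (v t))
      = integral (J n) (\<lambda>t. P2 n t * cnj (U n t) - P n t * cnj (- v t))"
    by (rule AE_negligible_integral_cong) (use ae in \<open>auto elim!: AE_mp\<close>)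
  also have "\<dots> = flux P P1 U U1 n (x (Suc n)) - flux P P1 U U1 n (x n)"
    unfolding flux_def by (rule integral_unique[OF sobolev2_Green[OF P sobolev2_cnj[OF U]]])
  finally show ?thesis .
qed

lemma test_family_cell:
  assumes S: "sobolev2 (x n) (x (Suc n)) P P1 P2"
    and z: "P (x n) = 0" "P1 (x n) = 0" "P (x (Suc n)) = 0" "P1 (x (Suc n)) = 0"
  shows "test_family (Suc n) (\<lambda>m. if m = n then P else (\<lambda>_. 0)) (\<lambda>m. if m = n then P1 else (\<lambda>_. 0))
    (\<lambda>m. if m = n then P2 else (\<lambda>_. 0))"
  unfolding test_family_def
proof (intro conjI allI)
  show "sobolev2 (x m) (x (Suc m)) (if m = n then P else (\<lambda>_. 0)) (if m = n then P1 else (\<lambda>_. 0)) (if m = n then P2 else (\<lambda>_. 0))" for m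
    using S sobolev2_zero[of "x m" "x (Suc m)"] by simp
qed (use z x0 in \<open>auto split: if_splits\<close>)

text \<open>Two cubics meeting at one interaction point leave two free parameters, enough to test
  continuity and the jump condition separately.\<close>

lemma test_family_vertex:
  fixes B q :: complex
  obtains P P1 P2 where "test_family (Suc (Suc n)) P P1 P2"
    "\<And>m. m \<noteq> n \<Longrightarrow> m \<noteq> Suc n \<Longrightarrow> P m = (\<lambda>_. 0) \<and> P1 m = (\<lambda>_. 0)"
    "P n (x n) = 0" "P1 n (x n) = 0" "P n (x (Suc n)) = B" "P1 n (x (Suc n)) = q"
    "P (Suc n) (x (Suc n)) = B" "P1 (Suc n) (x (Suc n)) = q + of_real (\<alpha> (Suc n)) * B"
    "P (Suc n) (x (Suc (Suc n))) = 0" "P1 (Suc n) (x (Suc (Suc n))) = 0"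
proof -
  have lt: "x n < x (Suc n)" "x (Suc n) < x (Suc (Suc n))" by simp_all
  obtain Q Q1 Q2 where Q: "sobolev2 (x n) (x (Suc n)) Q Q1 Q2" "Q (x n) = 0" "Q1 (x n) = 0"
    "Q (x (Suc n)) = B" "Q1 (x (Suc n)) = q"
    by (rule sobolev2_Hermite[OF lt(1)])
  obtain R R1 R2 where R: "sobolev2 (x (Suc n)) (x (Suc (Suc n))) R R1 R2" "R (x (Suc n)) = B"
    "R1 (x (Suc n)) = q + of_real (\<alpha> (Suc n)) * B" "R (x (Suc (Suc n))) = 0" "R1 (x (Suc (Suc n))) = 0"
    by (rule sobolev2_Hermite[OF lt(2)])
  define sel where "sel f g m = (if m = n then f else if m = Suc n then g else (\<lambda>_. 0))"
    for f g :: "real \<Rightarrow> complex" and m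
  have "test_family (Suc (Suc n)) (sel Q R) (sel Q1 R1) (sel Q2 R2)"
    unfolding test_family_def
  proof (intro conjI allI)
    show "sobolev2 (x m) (x (Suc m)) (sel Q R m) (sel Q1 R1 m) (sel Q2 R2 m)" for m
      using Q(1) R(1) sobolev2_zero[of "x m" "x (Suc m)"] by (simp add: sel_def)
    show "sel Q R (Suc m) (x (Suc m)) = sel Q R m (x (Suc m))" for m
      using Q R by (auto simp: sel_def)
    show "sel Q1 R1 (Suc m) (x (Suc m)) - sel Q1 R1 m (x (Suc m)) = of_real (\<alpha> (Suc m)) * sel Q R m (x (Suc m))" for m
      using Q R by (auto simp: sel_def)
    show "sel Q1 R1 0 0 = 0" using Q(3) x0 by (auto simp: sel_def)
  qed (auto simp: sel_def)
  then show thesis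
    by (rule that) (use Q R in \<open>auto simp: sel_def\<close>)
qed

text \<open>On a cell, \<open>u\<close> minus a double primitive of \<open>- v\<close> is orthogonal
  to all second derivatives of functions with zero end data, hence affine. Once \<open>u\<close> is
  known to be regular, the adjoint equation reduces to an identity between boundary terms, from
  which test functions around a single node isolate the condition at that node.\<close>

lemma adjoint_subset_delta_max: "op_adjoint M (H0_delta b x \<alpha>) \<subseteq> delta_max"
proof (rule subsetI, clarify)
  fix u v assume uv: "(u, v) \<in> op_adjoint M (H0_delta b x \<alpha>)"
  then have u: "u \<in> L2 M" and v: "v \<in> L2 M" by (auto simp: op_adjoint_def)
  have "\<exists>U U1. sobolev2 (x n) (x (Suc n)) U U1 (\<lambda>t. - v t) \<and> (AE t in lebesgue_on (J n). u t = U t)" for n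
  proof -
    let ?a = "x n" and ?c = "x (Suc n)" and ?M = "lebesgue_on (J n)"
    have lt: "?a < ?c" by simp
    define Z1 where "Z1 t = integral {?a..t} (\<lambda>t. - v t)" for t
    define Z where "Z t = integral {?a..t} Z1" for t
    have ZS: "sobolev2 ?a ?c Z Z1 (\<lambda>t. - v t)"
      unfolding sobolev2_def by (auto simp: Z_def Z1_def intro: L2_uminus J_L2[OF v])
    have ZL: "Z \<in> L2 ?M" by (rule continuous_on_imp_L2[OF sobolev2D(7)[OF ZS]])
    have uL: "u \<in> L2 ?M" and vL: "v \<in> L2 ?M" by (rule J_L2[OF u], rule J_L2[OF v])
    have kL: "(\<lambda>t. u t - Z t) \<in> L2 ?M" by (rule L2_diff[OF uL ZL])
    obtain A B where AB: "AE t in ?M. u t - Z t = A + B * of_real (t - ?a)"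
    proof (rule L2_orthogonal_imp_affine[OF lt kL])
      fix P P1 P2 assume P: "sobolev2 ?a ?c P P1 P2" "P ?a = 0" "P1 ?a = 0" "P ?c = 0" "P1 ?c = 0"
      note PL = continuous_on_imp_L2[OF sobolev2D(7)[OF P(1)]] and P2L = sobolev2D(2)[OF P(1)]
      have "integral (J n) (\<lambda>t. P2 t * cnj (u t) + P t * cnj (v t)) = 0"
        using sums_single_nat[OF adjoint_test_family[OF uv test_family_cell[OF P]], of n] by simp
      moreover have "integral (J n) (\<lambda>t. P2 t * cnj (Z t) - P t * cnj (- v t)) = 0"
        using integral_unique[OF sobolev2_Green[OF P(1) sobolev2_cnj[OF ZS]]] P by simp
      moreover have "L2_inner ?M P2 (\<lambda>t. u t - Z t)
          = integral (J n) (\<lambda>t. P2 t * cnj (u t) + P t * cnj (v t)) - integral (J n) (\<lambda>t. P2 t * cnj (Z t) - P t * cnj (- v t))"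
      proof -
        have i: "integrable ?M (\<lambda>t. P2 t * cnj (u t) + P t * cnj (v t))" "integrable ?M (\<lambda>t. P2 t * cnj (Z t) - P t * cnj (- v t))"
          by (intro Bochner_Integration.integrable_add Bochner_Integration.integrable_diff L2_mult_cnj_integrable PL P2L uL vL ZL L2_uminus)+
        have "L2_inner ?M P2 (\<lambda>t. u t - Z t) = (LINT t|?M. (P2 t * cnj (u t) + P t * cnj (v t)) - (P2 t * cnj (Z t) - P t * cnj (- v t)))"
          unfolding L2_inner_def by (rule Bochner_Integration.integral_cong) (auto simp: algebra_simps)
        also have "\<dots> = (LINT t|?M. P2 t * cnj (u t) + P t * cnj (v t)) - (LINT t|?M. P2 t * cnj (Z t) - P t * cnj (- v t))"
          by (rule Bochner_Integration.integral_diff[OF i])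
        finally show ?thesis
          by (simp only: lebesgue_integral_eq_integral[OF i(1) J_lebesgue] lebesgue_integral_eq_integral[OF i(2) J_lebesgue])
      qed
      ultimately show "L2_inner ?M P2 (\<lambda>t. u t - Z t) = 0" by simp
    qed
    have aff: "sobolev2 ?a ?c (\<lambda>t. A + B * of_real (t - ?a)) (\<lambda>_. B) (\<lambda>_. 0)"
      by (rule sobolev2I_continuous[OF lt]) (auto intro!: derivative_eq_intros continuous_intros)
    have "sobolev2 ?a ?c (\<lambda>t. Z t + (A + B * of_real (t - ?a))) (\<lambda>t. Z1 t + B) (\<lambda>t. - v t)"
      using sobolev2_add[OF ZS aff] by simp
    moreover have "AE t in ?M. u t = Z t + (A + B * of_real (t - ?a))"
      using AB by (rule AE_mp) (auto simp: algebra_simps)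
    ultimately show ?thesis by blast
  qed
  then obtain U U1 where US: "\<And>n. sobolev2 (x n) (x (Suc n)) (U n) (U1 n) (\<lambda>t. - v t)"
    and Uae: "\<And>n. AE t in lebesgue_on (J n). u t = U n t"
    by metis
  have bd: "(\<lambda>n. flux P P1 U U1 n (x (Suc n)) - flux P P1 U U1 n (x n)) sums 0" if T: "test_family N P P1 P2" for N P P1 P2
  proof -
    have "integral (J n) (\<lambda>t. P2 n t * cnj (u t) + P n t * cnj (v t))
        = flux P P1 U U1 n (x (Suc n)) - flux P P1 U U1 n (x n)" for n
      using Green_cell[where n = n and P = P and ?P1.0 = P1 and ?P2.0 = P2 and U = U and ?U1.0 = U1]
        test_familyD(1)[OF T] US Uae by blast
    then show ?thesis using adjoint_test_family[OF uv T] by simp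
  qed
  \<comment> \<open>Only the cells \<open>n\<close> and \<open>Suc n\<close> contribute, and their
    outer ends carry zero data; what remains equates the fluxes on the two sides of
    \<open>x (Suc n)\<close>.\<close>
  have vertex: "q * cnj (U n (x (Suc n))) - B * cnj (U1 n (x (Suc n)))
      = (q + of_real (\<alpha> (Suc n)) * B) * cnj (U (Suc n) (x (Suc n))) - B * cnj (U1 (Suc n) (x (Suc n)))" for n q B
  proof -
    obtain P P1 P2 where P: "test_family (Suc (Suc n)) P P1 P2"
      "\<And>m. m \<noteq> n \<Longrightarrow> m \<noteq> Suc n \<Longrightarrow> P m = (\<lambda>_. 0) \<and> P1 m = (\<lambda>_. 0)"
      "P n (x n) = 0" "P1 n (x n) = 0" "P n (x (Suc n)) = B" "P1 n (x (Suc n)) = q"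
      "P (Suc n) (x (Suc n)) = B" "P1 (Suc n) (x (Suc n)) = q + of_real (\<alpha> (Suc n)) * B"
      "P (Suc n) (x (Suc (Suc n))) = 0" "P1 (Suc n) (x (Suc (Suc n))) = 0"
      by (rule test_family_vertex[of n B q]) (rule that; assumption)
    let ?e = "\<lambda>n. flux P P1 U U1 n (x (Suc n)) - flux P P1 U U1 n (x n)"
    have "?e sums (\<Sum>m\<in>{n, Suc n}. ?e m)"
      by (rule sums_finite) (use P(2) in \<open>auto simp: flux_def\<close>)
    with bd[OF P(1)] have "(\<Sum>m\<in>{n, Suc n}. ?e m) = 0"
      using sums_unique2 by blast
    then show ?thesis
      using P(3-10) by (simp add: flux_def add_eq_0_iff2)
  qed
  have "delta_rep u v U U1"
    unfolding delta_rep_def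
  proof (intro conjI allI US Uae)
    \<comment> \<open>Slope 1 with value 0 isolates continuity; below, slope 0 with value 1 isolates
      the jump of the derivative.\<close>
    have Ueq: "U (Suc n) (x (Suc n)) = U n (x (Suc n))" for n
      using vertex[of 1 n 0] by simp
    then show "U (Suc n) (x (Suc n)) = U n (x (Suc n))" for n .
    show "U1 (Suc n) (x (Suc n)) - U1 n (x (Suc n)) = of_real (\<alpha> (Suc n)) * U n (x (Suc n))" for n
    proof -
      have "cnj (U1 (Suc n) (x (Suc n)) - U1 n (x (Suc n))) = cnj (of_real (\<alpha> (Suc n)) * U n (x (Suc n)))"
        using vertex[of 0 n 1] Ueq[of n] by (simp add: algebra_simps)
      then show ?thesis by (simp only: complex_cnj_cancel_iff)
    qed
    show "U1 0 0 = 0"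
    proof -
      have lt: "x 0 < x (Suc 0)" by simp
      \<comment> \<open>Slope 0 at the origin keeps the test function in the domain; the value 1
        then picks out the derivative of \<open>U 0\<close> at 0.\<close>
      obtain Q Q1 Q2 where Q: "sobolev2 (x 0) (x (Suc 0)) Q Q1 Q2" "Q (x 0) = 1" "Q1 (x 0) = 0"
        "Q (x (Suc 0)) = 0" "Q1 (x (Suc 0)) = 0"
        by (rule sobolev2_Hermite[OF lt])
      define P where "P m = (if m = 0 then Q else (\<lambda>_. 0))" for m :: nat
      define P1 where "P1 m = (if m = 0 then Q1 else (\<lambda>_. 0))" for m :: nat
      define P2 where "P2 m = (if m = 0 then Q2 else (\<lambda>_. 0))" for m :: nat
      have "test_family 1 P P1 P2"
        unfolding test_family_def
      proof (intro conjI allI)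
        show "sobolev2 (x m) (x (Suc m)) (P m) (P1 m) (P2 m)" for m
          using Q(1) sobolev2_zero[of "x m" "x (Suc m)"] by (simp add: P_def P1_def P2_def)
      qed (use Q x0 in \<open>auto simp: P_def P1_def P2_def\<close>)
      from sums_single_nat[OF bd[OF this], of 0]
      have "flux P P1 U U1 0 (x (Suc 0)) - flux P P1 U U1 0 (x 0) = 0"
        by (simp add: flux_def P_def P1_def)
      then show ?thesis using Q(2-5) by (simp add: flux_def P_def P1_def x0)
    qed
  qed
  with u v show "(u, v) \<in> delta_max" by (auto simp: delta_max_def)
qed

text \<open>A continuous function that vanishes almost everywhere vanishes identically, together
  with its derivative, and so does the second derivative almost everywhere. Density of the domain
  rests on this.\<close>

lemma delta_max_zero:
  assumes "(\<lambda>_. 0, h) \<in> delta_max"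
  shows "AE t in M. h t = 0"
  unfolding AE_I_iff
proof
  fix n
  let ?a = "x n" and ?c = "x (Suc n)"
  have lt: "?a < ?c" by simp
  from assms obtain U U1 where S: "sobolev2 ?a ?c (U n) (U1 n) (\<lambda>t. - h t)"
    and ae: "AE t in lebesgue_on (J n). 0 = U n t"
    by (auto simp: delta_max_def delta_rep_def)
  note D = sobolev2D[OF S]
  have "((\<lambda>t. (cmod (U n t))\<^sup>2) has_integral 0) (J n)"
    by (rule has_integral_spike[of "{t \<in> J n. \<not> 0 = U n t}" _ _ "\<lambda>_. 0"])
       (use ae in \<open>auto simp: AE_lebesgue_on_iff_negligible\<close>)
  then have i: "((\<lambda>t. (cmod (U n t))\<^sup>2) has_integral 0) (cbox ?a ?c)" by simp
  have c: "continuous_on (cbox ?a ?c) (\<lambda>t. (cmod (U n t))\<^sup>2)"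
    using D(7) by (simp only: cbox_interval) (intro continuous_intros)
  have U0: "U n t = 0" if "t \<in> J n" for t
  proof -
    have "(cmod (U n t))\<^sup>2 = 0"
      by (rule has_integral_0_cbox_imp_0[OF c _ i]) (use lt that in \<open>simp_all only: cbox_interval box_real zero_le_power2 greaterThanLessThan_empty_iff not_le not_False_eq_True\<close>)
    then show ?thesis by simp
  qed
  have U10: "U1 n t = 0" if t: "t \<in> J n" for t
  proof -
    have "((\<lambda>_. 0) has_vector_derivative U1 n t) (at t within J n)"
      by (rule has_vector_derivative_transform[OF t _ D(10)[OF t]]) (simp add: U0)
    then show ?thesis
      using vector_derivative_unique_within_closed_interval[of ?a ?c t "\<lambda>_. 0" "U1 n t" 0] lt t by simp
  qed
  obtain N where N: "negligible N" "\<And>t. t \<in> J n - N \<Longrightarrow> (U1 n has_vector_derivative - h t) (at t within J n)"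
    by (rule sobolev2_AE_derivative[OF S]) (rule that; assumption)
  have "{t \<in> J n. \<not> h t = 0} \<subseteq> N"
  proof (rule subsetI, rule ccontr)
    fix t assume t: "t \<in> {t \<in> J n. \<not> h t = 0}" and "t \<notin> N"
    then have tN: "t \<in> J n - N" and tJ: "t \<in> J n" by auto
    have "((\<lambda>_. 0) has_vector_derivative - h t) (at t within J n)"
      by (rule has_vector_derivative_transform[OF tJ _ N(2)[OF tN]]) (simp add: U10)
    then have "- h t = 0"
      using vector_derivative_unique_within_closed_interval[of ?a ?c t "\<lambda>_. 0" "- h t" 0] lt tJ by simp
    with t show False by simp
  qed
  then show "AE t in lebesgue_on (J n). h t = 0"
    using N(1) by (simp add: AE_lebesgue_on_iff_negligible negligible_subset)
qed

lemma AC_loc_lincomb: "F \<in> AC_loc S \<Longrightarrow> G \<in> AC_loc S \<Longrightarrow> (\<lambda>t. p * F t + q * G t) \<in> AC_loc S"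
  unfolding AC_loc_def by (blast intro: abs_cont_on_lincomb)

lemma H0_linear: "linear_graph M (H0_delta b x \<alpha>)"
proof (rule linear_graphI)
  show "H0_delta b x \<alpha> \<subseteq> L2 M \<times> L2 M"
    using H0_subset_delta_max by (auto simp: delta_max_def)
  have "test_family 0 (\<lambda>_ _. 0) (\<lambda>_ _. 0) (\<lambda>_ _. 0)"
    unfolding test_family_def by (auto intro: sobolev2_zero)
  from test_family_H0[OF this] show "H0_delta b x \<alpha> \<noteq> {}" by blast
  fix f g f' g' p q assume "(f, g) \<in> H0_delta b x \<alpha>" "(f', g') \<in> H0_delta b x \<alpha>"
  then obtain f1 f2 f1' f2' where g: "g = (\<lambda>t. - f2 t)" "g' = (\<lambda>t. - f2' t)"
    and W: "W22_with I X f f1 f2" "W22_with I X f' f1' f2'" and cs: "comp_supp I X f" "comp_supp I X f'"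
    and f10: "f1 0 = 0" "f1' 0 = 0"
    and int: "\<And>n. n \<ge> 1 \<Longrightarrow> \<exists>c p q. (f \<longlongrightarrow> c) (at_left (x n)) \<and> (f \<longlongrightarrow> c) (at_right (x n)) \<and>
          (f1 \<longlongrightarrow> p) (at_left (x n)) \<and> (f1 \<longlongrightarrow> q) (at_right (x n)) \<and> q - p = of_real (\<alpha> n) * c"
    and int': "\<And>n. n \<ge> 1 \<Longrightarrow> \<exists>c p q. (f' \<longlongrightarrow> c) (at_left (x n)) \<and> (f' \<longlongrightarrow> c) (at_right (x n)) \<and>
          (f1' \<longlongrightarrow> p) (at_left (x n)) \<and> (f1' \<longlongrightarrow> q) (at_right (x n)) \<and> q - p = of_real (\<alpha> n) * c"
    unfolding H0_delta_def by blast
  let ?F = "\<lambda>t. p * f t + q * f' t" and ?F1 = "\<lambda>t. p * f1 t + q * f1' t" and ?F2 = "\<lambda>t. p * f2 t + q * f2' t"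
  have dl: "((\<lambda>t. p * h t + q * h' t) has_vector_derivative (p * d + q * d')) F"
    if "(h has_vector_derivative d) F" "(h' has_vector_derivative d') F" for h h' d d' F
    using that by (intro has_vector_derivative_add has_vector_derivative_mult_right)
  have "W22_with I X ?F ?F1 ?F2"
    unfolding W22_with_def
  proof (intro conjI ballI)
    show "?F \<in> L2 M" "?F2 \<in> L2 M"
      using W by (auto simp: W22_with_def intro!: L2_add L2_cmult)
    show "?F \<in> AC_loc (I - X)" "?F1 \<in> AC_loc (I - X)"
      using W by (auto simp: W22_with_def intro!: AC_loc_lincomb)
    show "(?F has_vector_derivative ?F1 t) (at t within I - X)" if "t \<in> I - X" for t
      using W that by (intro dl) (auto simp: W22_with_def)
    have "AE t in M. (f1 has_vector_derivative f2 t) (at t within I - X)"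
      "AE t in M. (f1' has_vector_derivative f2' t) (at t within I - X)"
      using W by (simp_all add: W22_with_def)
    then show "AE t in M. (?F1 has_vector_derivative ?F2 t) (at t within I - X)"
      by eventually_elim (rule dl)
  qed
  moreover have "comp_supp I X ?F"
  proof -
    let ?S = "\<lambda>f. closure {t \<in> I - X. f t \<noteq> (0::complex)}"
    have "{t \<in> I - X. ?F t \<noteq> 0} \<subseteq> {t \<in> I - X. f t \<noteq> 0} \<union> {t \<in> I - X. f' t \<noteq> 0}" by auto
    then have sub: "?S ?F \<subseteq> ?S f \<union> ?S f'" unfolding closure_Un[symmetric] by (rule closure_mono)
    moreover have "compact (?S f \<union> ?S f')" using cs by (simp add: comp_supp_def compact_Un)
    ultimately have "compact (?S ?F)"
      using compact_Int_closed[of "?S f \<union> ?S f'" "?S ?F"] by (simp add: Int_absorb1)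
    moreover have "?S ?F \<subseteq> I" using sub cs unfolding comp_supp_def by blast
    ultimately show ?thesis by (simp add: comp_supp_def)
  qed
  moreover have "?F1 0 = 0" using f10 by simp
  moreover have "\<exists>c r s. (?F \<longlongrightarrow> c) (at_left (x n)) \<and> (?F \<longlongrightarrow> c) (at_right (x n)) \<and>
          (?F1 \<longlongrightarrow> r) (at_left (x n)) \<and> (?F1 \<longlongrightarrow> s) (at_right (x n)) \<and> s - r = of_real (\<alpha> n) * c" if n1: "n \<ge> 1" for n
  proof -
    obtain c r s where 1: "(f \<longlongrightarrow> c) (at_left (x n))" "(f \<longlongrightarrow> c) (at_right (x n))"
      "(f1 \<longlongrightarrow> r) (at_left (x n))" "(f1 \<longlongrightarrow> s) (at_right (x n))" "s - r = of_real (\<alpha> n) * c"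
      using int[OF n1] by blast
    obtain c' r' s' where 2: "(f' \<longlongrightarrow> c') (at_left (x n))" "(f' \<longlongrightarrow> c') (at_right (x n))"
      "(f1' \<longlongrightarrow> r') (at_left (x n))" "(f1' \<longlongrightarrow> s') (at_right (x n))" "s' - r' = of_real (\<alpha> n) * c'"
      using int'[OF n1] by blast
    have "(p * s + q * s') - (p * r + q * r') = p * (s - r) + q * (s' - r')" by (simp add: algebra_simps)
    also have "\<dots> = of_real (\<alpha> n) * (p * c + q * c')" unfolding 1(5) 2(5) by (simp add: algebra_simps)
    finally have "(p * s + q * s') - (p * r + q * r') = of_real (\<alpha> n) * (p * c + q * c')" .
    with 1 2 show ?thesis
      by (intro exI[of _ "p * c + q * c'"] exI[of _ "p * r + q * r'"] exI[of _ "p * s + q * s'"] conjI tendsto_intros)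
  qed
  ultimately have "(?F, \<lambda>t. - ?F2 t) \<in> H0_delta b x \<alpha>"
    unfolding H0_delta_def by (intro CollectI exI[of _ ?F] exI[of _ ?F2] conjI refl exI[of _ ?F1]) auto
  then show "(\<lambda>t. p * f t + q * f' t, \<lambda>t. p * g t + q * g' t) \<in> H0_delta b x \<alpha>"
    by (simp add: g)
qed

end

section \<open>Jacobi recursions\<close>

text \<open>\<open>f n\<close> times the forward difference quotient of \<open>g\<close>, minus the
  same with the roles exchanged: the discrete counterpart of f g' - f' g.\<close>

definition wronsk :: "(nat \<Rightarrow> real) \<Rightarrow> (nat \<Rightarrow> complex) \<Rightarrow> (nat \<Rightarrow> complex) \<Rightarrow> nat \<Rightarrow> complex" where
  "wronsk d f g n = (f n * g (n + 1) - f (n + 1) * g n) / of_real (d (n + 1))"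

text \<open>The defect of \<open>f\<close> in the recursion. It vanishes for the node values of a
  continuous cellwise affine function satisfying the jump conditions.\<close>

definition jacobi :: "(nat \<Rightarrow> real) \<Rightarrow> (nat \<Rightarrow> real) \<Rightarrow> (nat \<Rightarrow> complex) \<Rightarrow> nat \<Rightarrow> complex" where
  "jacobi d \<alpha> f n = of_real (\<alpha> n) * f n - (f (n + 1) - f n) / of_real (d (n + 1))
     + (f n - f (n - 1)) / of_real (d n)"

text \<open>Discrete Lagrange identity: the terms with \<open>\<alpha> n\<close> are symmetric in
  \<open>f\<close> and \<open>g\<close> and cancel.\<close>

lemma wronsk_step:
  assumes "d n \<noteq> 0" "d (n + 1) \<noteq> 0" "n \<ge> 1"
  shows "wronsk d f g n - wronsk d f g (n - 1) = g n * jacobi d \<alpha> f n - f n * jacobi d \<alpha> g n"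
proof -
  obtain m where m: "n = Suc m" using assms(3) by (cases n) auto
  have "complex_of_real (d (Suc m)) \<noteq> 0" "complex_of_real (d (Suc (Suc m))) \<noteq> 0"
    using assms by (auto simp: m)
  then show ?thesis
    by (simp add: wronsk_def jacobi_def m field_simps)
qed

text \<open>Expansion of the 3 by 3 determinant with columns y, f, g and rows taken at n, n - 1 and
  again n, which is 0.\<close>

lemma wronsk_exchange:
  assumes "n \<ge> 1"
  shows "y n * wronsk d f g (n - 1) = f n * wronsk d y g (n - 1) - g n * wronsk d y f (n - 1)"
proof -
  obtain m where m: "n = Suc m" using assms by (cases n) auto
  show ?thesis by (cases "d (Suc m) = 0") (simp_all add: wronsk_def m field_simps)
qed

text \<open>With equality in the bound on \<open>c\<close> the sequence \<open>1 / r n\<close>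
  solves the recursion, that is, \<open>r n * z n\<close> is constant. A larger \<open>c\<close>
  only raises the next term as long as \<open>z n\<close> is positive, which the growth itself
  ensures.\<close>

lemma dominant_recursion_mono:
  fixes d r c z :: "nat \<Rightarrow> real"
  assumes d: "\<And>n. n \<ge> 1 \<Longrightarrow> d n > 0" and r: "\<And>n. n \<ge> 1 \<Longrightarrow> r n > 0"
    and c: "\<And>n. n \<ge> 2 \<Longrightarrow> r n / (d n * r (n - 1)) + r n / (d (n + 1) * r (n + 1)) \<le> c n"
    and z1: "r 1 * z 1 = 1" "r 2 * z 2 = 1"
    and z: "\<And>n. n \<ge> 2 \<Longrightarrow> z (n + 1) / d (n + 1) = c n * z n - z (n - 1) / d n"
  shows "n \<ge> 1 \<Longrightarrow> r n * z n \<ge> 1 \<and> r n * z n \<le> r (n + 1) * z (n + 1)"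
proof (induction n rule: nat_induct_at_least)
  case base
  then show ?case using z1 by (simp add: numeral_2_eq_2)
next
  case (Suc n)
  then have n: "n \<ge> 1" by simp
  note pos = d[OF n] r[OF n] d[of "n + 1"] r[of "n + 1"] d[of "n + 2"] r[of "n + 2"]
  have zn: "z (n + 1) > 0"
  proof (rule ccontr)
    assume "\<not> z (n + 1) > 0"
    then have "r (n + 1) * z (n + 1) \<le> 0" using pos by (intro mult_nonneg_nonpos) auto
    with Suc.IH show False by linarith
  qed
  have "r (n + 1) * z (n + 1) / (d (n + 2) * r (n + 2))
      = (r (n + 1) / (d (n + 1) * r n) + r (n + 1) / (d (n + 2) * r (n + 2))) * z (n + 1)
        - r (n + 1) * z (n + 1) / (d (n + 1) * r n)"
    by (simp add: algebra_simps)
  also have "\<dots> \<le> c (n + 1) * z (n + 1) - r n * z n / (d (n + 1) * r n)"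
  proof (intro diff_mono mult_right_mono divide_right_mono)
    show "r (n + 1) / (d (n + 1) * r n) + r (n + 1) / (d (n + 2) * r (n + 2)) \<le> c (n + 1)"
      using c[of "n + 1"] n by simp
    show "r n * z n \<le> r (n + 1) * z (n + 1)" using Suc by simp
  qed (use zn pos in auto)
  also have "r n * z n / (d (n + 1) * r n) = z n / d (n + 1)" using pos by simp
  also have "c (n + 1) * z (n + 1) - z n / d (n + 1) = z (n + 2) / d (n + 2)"
    using z[of "n + 1"] n by simp
  finally have "r (n + 1) * z (n + 1) / (d (n + 2) * r (n + 2)) * (d (n + 2) * r (n + 2))
     \<le> z (n + 2) / d (n + 2) * (d (n + 2) * r (n + 2))"
    using pos by (intro mult_right_mono) auto
  then have "r (n + 1) * z (n + 1) \<le> r (n + 2) * z (n + 2)"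
    using pos by (simp add: mult_ac)
  then show ?case using Suc by simp
qed

text \<open>Each factor \<open>1 + k n\<close> is at most \<open>exp (k n)\<close>, so the product
  is bounded by the exponential of the convergent series.\<close>

lemma discrete_Gronwall_bounded:
  fixes M k :: "nat \<Rightarrow> real"
  assumes k: "\<And>n. k n \<ge> 0" "summable k" and M: "\<And>n. M n \<ge> 0"
    and step: "\<And>n. n \<ge> N \<Longrightarrow> M (Suc n) \<le> M n * (1 + k n)"
  obtains B where "\<And>n. n \<ge> N \<Longrightarrow> M n \<le> B"
proof
  fix n assume "n \<ge> N"
  then have "M n \<le> M N * exp (\<Sum>j<n. k j)"
  proof (induction n rule: nat_induct_at_least)
    case base
    have "1 \<le> exp (\<Sum>j<N. k j)" using k by (simp add: sum_nonneg)
    then show ?case using M[of N] mult_left_mono[of 1 "exp (\<Sum>j<N. k j)" "M N"] by simp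
  next
    case (Suc n)
    have "M (Suc n) \<le> M n * (1 + k n)" by (rule step) fact
    also have "\<dots> \<le> (M N * exp (\<Sum>j<n. k j)) * exp (k n)"
      by (intro mult_mono Suc.IH exp_ge_add_one_self) (use M k in auto)
    also have "\<dots> = M N * exp (\<Sum>j<Suc n. k j)" by (simp add: exp_add)
    finally show ?case .
  qed
  also have "\<dots> \<le> M N * exp (suminf k)"
    using M k by (intro mult_left_mono) (auto intro: sum_le_suminf)
  finally show "M n \<le> M N * exp (suminf k)" .
qed

section \<open>The Wronskian of two approximate solutions\<close>

locale jacobi_pair =
  fixes d \<alpha> r \<gamma> :: "nat \<Rightarrow> real" and f g :: "nat \<Rightarrow> complex"
  assumes d_pos: "\<And>n. n \<ge> 1 \<Longrightarrow> d n > 0"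
    and r_def: "\<And>n. r n = sqrt (d n + d (n + 1))"
    and \<gamma>: "\<And>n. \<gamma> n \<ge> 0" "summable (\<lambda>n. (\<gamma> n)\<^sup>2)"
    and f_le: "\<And>n. n \<ge> 1 \<Longrightarrow> r n * cmod (f n) \<le> \<gamma> n"
    and g_le: "\<And>n. n \<ge> 1 \<Longrightarrow> r n * cmod (g n) \<le> \<gamma> n"
    and Jf_le: "\<And>n. n \<ge> 1 \<Longrightarrow> cmod (jacobi d \<alpha> f n) \<le> r n * \<gamma> n"
    and Jg_le: "\<And>n. n \<ge> 1 \<Longrightarrow> cmod (jacobi d \<alpha> g n) \<le> r n * \<gamma> n"
begin

abbreviation "W \<equiv> wronsk d f g"

lemma r_pos: "n \<ge> 1 \<Longrightarrow> r n > 0"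
  using d_pos[of n] d_pos[of "n + 1"] by (simp add: r_def)

lemma r_square: "n \<ge> 1 \<Longrightarrow> (r n)\<^sup>2 = d n + d (n + 1)"
  using d_pos[of n] d_pos[of "n + 1"] by (simp add: r_def)

lemma W_step: "n \<ge> 1 \<Longrightarrow> W n - W (n - 1) = g n * jacobi d \<alpha> f n - f n * jacobi d \<alpha> g n"
  using d_pos[of n] d_pos[of "n + 1"] by (intro wronsk_step) auto

lemma W_convergent: "convergent W"
proof -
  have bd: "norm (W (Suc n) - W n) \<le> 2 * (\<gamma> (Suc n))\<^sup>2" for n
  proof -
    have *: "cmod (u * v) \<le> (\<gamma> (Suc n))\<^sup>2"
      if "r (Suc n) * cmod u \<le> \<gamma> (Suc n)" "cmod v \<le> r (Suc n) * \<gamma> (Suc n)" for u v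
    proof -
      have "cmod (u * v) \<le> cmod u * (r (Suc n) * \<gamma> (Suc n))"
        using that by (simp add: norm_mult mult_left_mono)
      also have "\<dots> = (r (Suc n) * cmod u) * \<gamma> (Suc n)" by simp
      also have "\<dots> \<le> \<gamma> (Suc n) * \<gamma> (Suc n)" using that \<gamma> by (intro mult_right_mono) auto
      finally show ?thesis by (simp add: power2_eq_square)
    qed
    have "cmod (W (Suc n) - W n) \<le> cmod (g (Suc n) * jacobi d \<alpha> f (Suc n)) + cmod (f (Suc n) * jacobi d \<alpha> g (Suc n))"
      using W_step[of "Suc n"] norm_triangle_ineq4 by simp
    also have "\<dots> \<le> (\<gamma> (Suc n))\<^sup>2 + (\<gamma> (Suc n))\<^sup>2"
      by (intro add_mono * f_le g_le Jf_le Jg_le) auto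
    finally show ?thesis by simp
  qed
  have "summable (\<lambda>n. 2 * (\<gamma> (Suc n))\<^sup>2)"
    using \<gamma>(2) summable_Suc_iff[of "\<lambda>n. (\<gamma> n)\<^sup>2"] by (intro summable_mult) simp
  then have "summable (\<lambda>n. W (Suc n) - W n)"
    by (rule summable_comparison_test'[where N = 0]) (rule bd)
  then have "(\<lambda>n. \<Sum>k<n. W (Suc k) - W k) \<longlonglongrightarrow> (\<Sum>k. W (Suc k) - W k)"
    by (rule summable_LIMSEQ)
  then have "(\<lambda>n. (W n - W 0) + W 0) \<longlonglongrightarrow> (\<Sum>k. W (Suc k) - W k) + W 0"
    by (intro tendsto_add tendsto_const) (simp only: sum_lessThan_telescope)
  then show ?thesis by (auto simp: convergent_def)
qed

text \<open>The recursion for \<open>f\<close> at \<open>n\<close> is multiplied by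
  \<open>g (n + 1)\<close> and antisymmetrised, so that \<open>f (n + 1) * g (n + 1)\<close> drops
  out. The last bracket involves the indices n - 1 and n + 1 only, and the factor
  \<open>r (n - 1) * r (n + 1)\<close> makes it summable: this is the origin of the weight in the
  divergence condition.\<close>

lemma W_alpha:
  assumes n: "n \<ge> 2"
  shows "of_real (\<alpha> n * d n * d (n + 1)) * W n
    = of_real (d n) * (jacobi d \<alpha> f n * g (n + 1) - jacobi d \<alpha> g n * f (n + 1))
      - of_real (d n + d (n + 1)) * W n + (f (n - 1) * g (n + 1) - g (n - 1) * f (n + 1))"
proof -
  have "complex_of_real (d n) \<noteq> 0" "complex_of_real (d (n + 1)) \<noteq> 0"
    using d_pos[of n] d_pos[of "n + 1"] n by auto
  then show ?thesis
    by (simp add: wronsk_def jacobi_def field_simps)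
qed

lemma W_tendsto_0_if_not_summable:
  assumes dsum: "summable (\<lambda>n. (d n)\<^sup>2)"
    and div: "\<not> summable (\<lambda>n. \<bar>\<alpha> (n + 2)\<bar> * d (n + 2) * d (n + 3) * r (n + 1) * r (n + 3))"
  shows "W \<longlonglongrightarrow> 0"
proof -
  obtain L where L: "W \<longlonglongrightarrow> L" using W_convergent by (auto simp: convergent_def)
  have "L = 0"
  proof (rule ccontr)
    assume "L \<noteq> 0"
    obtain B where B: "B > 0" "\<And>n. cmod (W n) \<le> B"
      using convergent_imp_Bseq[OF W_convergent] by (auto elim: BseqE)
    obtain E where E: "E > 0" "\<And>n. cmod (of_real (d n)) \<le> E"
    proof -
      have "(\<lambda>n. sqrt ((d n)\<^sup>2)) \<longlonglongrightarrow> sqrt 0"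
        by (intro tendsto_real_sqrt summable_LIMSEQ_zero dsum)
      then have "d \<longlonglongrightarrow> 0" by (simp add: tendsto_rabs_zero_iff)
      then have "Bseq d" by (intro convergent_imp_Bseq) (auto simp: convergent_def)
      then show thesis using that by (auto elim: BseqE)
    qed
    have rE: "r n \<le> sqrt (2 * E)" if "n \<ge> 1" for n
      using E(2)[of n] E(2)[of "n + 1"] unfolding r_def by (intro real_sqrt_le_mono) auto
    \<comment> \<open>One line for each term of \<open>W_alpha\<close>, with \<open>E\<close>
      bounding the gaps and \<open>B\<close> the Wronskians. The square summability of the gaps
      enters through the second line.\<close>
    define \<beta> where "\<beta> n = 2 * (E * (2 * E)) * ((\<gamma> (n + 2))\<^sup>2 + (\<gamma> (n + 3))\<^sup>2)
      + B * (4 * ((d (n + 1))\<^sup>2 + (d (n + 2))\<^sup>2 + (d (n + 3))\<^sup>2 + (d (n + 4))\<^sup>2))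
      + 2 * ((\<gamma> (n + 1))\<^sup>2 + (\<gamma> (n + 3))\<^sup>2)" for n
    have "summable \<beta>"
    proof -
      have "summable (\<lambda>n. (\<gamma> (n + k))\<^sup>2)" "summable (\<lambda>n. (d (n + k))\<^sup>2)" for k
        using \<gamma>(2) dsum summable_iff_shift[of "\<lambda>n. (\<gamma> n)\<^sup>2"] summable_iff_shift[of "\<lambda>n. (d n)\<^sup>2"] by auto
      then show ?thesis unfolding \<beta>_def by (intro summable_add summable_mult)
    qed
    have bound: "\<bar>\<alpha> (n + 2)\<bar> * d (n + 2) * d (n + 3) * r (n + 1) * r (n + 3) * cmod (W (n + 2)) \<le> \<beta> n" for n
    proof -
      define m where "m = n + 2"
      have m: "m \<ge> 2" "m - 1 = n + 1" "m + 1 = n + 3" by (auto simp: m_def)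
      have dp: "d m > 0" "d (m + 1) > 0" "d (m - 1) > 0" "d (m + 2) > 0" using d_pos m by auto
      have rp: "r m > 0" "r (m + 1) > 0" "r (m - 1) > 0" using r_pos m by auto
      let ?R = "r (m - 1) * r (m + 1)"
      have am: "p * q \<le> p\<^sup>2 + q\<^sup>2" if "p \<ge> 0" "q \<ge> 0" for p q :: real
        using sum_squares_bound[of p q] mult_nonneg_nonneg[OF that] by (simp add: mult.assoc)
      \<comment> \<open>\<open>r (m + 1)\<close> is spent on \<open>v\<close>; the remaining
        \<open>r (m - 1)\<close> and the \<open>r m\<close> coming from the defect are each at most
        \<open>sqrt (2 * E)\<close>.\<close>
      have 1: "?R * (d m * (cmod u * cmod v)) \<le> E * (2 * E) * ((\<gamma> m)\<^sup>2 + (\<gamma> (m + 1))\<^sup>2)"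
        if "cmod u \<le> r m * \<gamma> m" "r (m + 1) * cmod v \<le> \<gamma> (m + 1)" for u v
      proof -
        have "?R * (d m * (cmod u * cmod v)) = (d m * r (m - 1)) * (cmod u * (r (m + 1) * cmod v))"
          by (simp add: mult_ac)
        also have "\<dots> \<le> (d m * r (m - 1)) * ((r m * \<gamma> m) * \<gamma> (m + 1))"
          using that dp rp \<gamma> by (intro mult_left_mono mult_mono) auto
        also have "\<dots> = d m * (r (m - 1) * r m) * (\<gamma> m * \<gamma> (m + 1))" by (simp add: mult_ac)
        also have "\<dots> \<le> E * (sqrt (2 * E) * sqrt (2 * E)) * ((\<gamma> m)\<^sup>2 + (\<gamma> (m + 1))\<^sup>2)"
          using E(2)[of m] rE m \<gamma> dp rp E(1) by (intro mult_mono am) auto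
        finally show ?thesis using E by simp
      qed
      \<comment> \<open>Decay must come from the gaps here: \<open>?R\<close> is at most half a sum
        of four gaps, so its product with two further gaps is quadratic in them.\<close>
      have 2: "?R * ((d m + d (m + 1)) * cmod (W m)) \<le> B * (4 * ((d (m - 1))\<^sup>2 + (d m)\<^sup>2 + (d (m + 1))\<^sup>2 + (d (m + 2))\<^sup>2))"
      proof -
        have "?R \<le> ((r (m - 1))\<^sup>2 + (r (m + 1))\<^sup>2) / 2"
          using sum_squares_bound[of "r (m - 1)" "r (m + 1)"] by simp
        also have "(r (m - 1))\<^sup>2 = d (m - 1) + d m" using r_square[of "m - 1"] m by simp
        also have "(r (m + 1))\<^sup>2 = d (m + 1) + d (m + 2)" using r_square[of "m + 1"] by simp
        finally have R: "?R \<le> ((d (m - 1) + d m) + (d (m + 1) + d (m + 2))) / 2" .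
        have "?R * ((d m + d (m + 1)) * cmod (W m))
          \<le> (((d (m - 1) + d m) + (d (m + 1) + d (m + 2))) / 2) * ((d m + d (m + 1)) * B)"
          using B dp rp by (intro mult_mono R) auto
        also have "\<dots> \<le> B * (4 * ((d (m - 1))\<^sup>2 + (d m)\<^sup>2 + (d (m + 1))\<^sup>2 + (d (m + 2))\<^sup>2))"
        proof -
          have "((a + b + (c + e)) / 2) * (b + c) \<le> 4 * (a\<^sup>2 + b\<^sup>2 + c\<^sup>2 + e\<^sup>2)" for a b c e :: real
            using sum_squares_bound[of a b] sum_squares_bound[of a c] sum_squares_bound[of b c]
              sum_squares_bound[of e b] sum_squares_bound[of e c]
              zero_le_power2[of a] zero_le_power2[of b] zero_le_power2[of c] zero_le_power2[of e]
            by (simp add: power2_eq_square algebra_simps)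
               (use zero_le_square[of a] zero_le_square[of b] zero_le_square[of c] zero_le_square[of e] in linarith)
          from mult_left_mono[OF this, of B] B show ?thesis by (simp add: mult_ac)
        qed
        finally show ?thesis .
      qed
      have 3: "?R * (cmod u * cmod v) \<le> (\<gamma> (m - 1))\<^sup>2 + (\<gamma> (m + 1))\<^sup>2"
        if "r (m - 1) * cmod u \<le> \<gamma> (m - 1)" "r (m + 1) * cmod v \<le> \<gamma> (m + 1)" for u v
      proof -
        have "?R * (cmod u * cmod v) = (r (m - 1) * cmod u) * (r (m + 1) * cmod v)" by (simp add: mult_ac)
        also have "\<dots> \<le> \<gamma> (m - 1) * \<gamma> (m + 1)" using that rp \<gamma> by (intro mult_mono) auto
        also have "\<dots> \<le> (\<gamma> (m - 1))\<^sup>2 + (\<gamma> (m + 1))\<^sup>2" by (rule am) (use \<gamma> in auto)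
        finally show ?thesis .
      qed
      have f1: "r (m - 1) * cmod (f (m - 1)) \<le> \<gamma> (m - 1)" "r (m - 1) * cmod (g (m - 1)) \<le> \<gamma> (m - 1)"
        "r (m + 1) * cmod (f (m + 1)) \<le> \<gamma> (m + 1)" "r (m + 1) * cmod (g (m + 1)) \<le> \<gamma> (m + 1)"
        "cmod (jacobi d \<alpha> f m) \<le> r m * \<gamma> m" "cmod (jacobi d \<alpha> g m) \<le> r m * \<gamma> m"
        using f_le g_le Jf_le Jg_le m by auto
      have "\<bar>\<alpha> m\<bar> * d m * d (m + 1) * cmod (W m) = cmod (of_real (\<alpha> m * d m * d (m + 1)) * W m)"
        using dp by (simp add: norm_mult abs_mult)
      also have "\<dots> \<le> (d m * (cmod (jacobi d \<alpha> f m) * cmod (g (m + 1))) + d m * (cmod (jacobi d \<alpha> g m) * cmod (f (m + 1))))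
          + (d m + d (m + 1)) * cmod (W m)
          + (cmod (f (m - 1)) * cmod (g (m + 1)) + cmod (g (m - 1)) * cmod (f (m + 1)))"
      proof -
        have t: "cmod (p * (a * b - a' * b') - q * w + (e * b - e' * b'))
            \<le> (cmod p * (cmod a * cmod b) + cmod p * (cmod a' * cmod b')) + cmod q * cmod w
              + (cmod e * cmod b + cmod e' * cmod b')" for p q a b a' b' w e e'
        proof -
          have "cmod (p * (a * b - a' * b') - q * w + (e * b - e' * b'))
            \<le> cmod (p * (a * b) - p * (a' * b')) + cmod (q * w) + cmod (e * b - e' * b')"
            by (simp add: right_diff_distrib) (meson add_mono norm_triangle_ineq norm_triangle_ineq4 order_trans order_refl)
          also have "\<dots> \<le> (cmod (p * (a * b)) + cmod (p * (a' * b'))) + cmod (q * w) + (cmod (e * b) + cmod (e' * b'))"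
            by (intro add_mono norm_triangle_ineq4 order_refl)
          finally show ?thesis by (simp add: norm_mult)
        qed
        have "cmod (of_real (d m)) = d m" "cmod (of_real (d m + d (m + 1))) = d m + d (m + 1)"
          using dp by (simp_all del: of_real_add)
        then show ?thesis
          unfolding W_alpha[OF m(1)]
          using t[of "of_real (d m)" "jacobi d \<alpha> f m" "g (m + 1)" "jacobi d \<alpha> g m" "f (m + 1)"
            "of_real (d m + d (m + 1))" "W m" "f (m - 1)" "g (m - 1)"] by (simp only:)
      qed
      finally have "?R * (\<bar>\<alpha> m\<bar> * d m * d (m + 1) * cmod (W m)) \<le> ?R * \<dots>"
        using rp by (intro mult_left_mono) auto
      also have "\<dots> \<le> 2 * (E * (2 * E) * ((\<gamma> m)\<^sup>2 + (\<gamma> (m + 1))\<^sup>2))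
        + B * (4 * ((d (m - 1))\<^sup>2 + (d m)\<^sup>2 + (d (m + 1))\<^sup>2 + (d (m + 2))\<^sup>2))
        + 2 * ((\<gamma> (m - 1))\<^sup>2 + (\<gamma> (m + 1))\<^sup>2)"
        using 1[OF f1(5,4)] 1[OF f1(6,3)] 2 3[OF f1(1,4)] 3[OF f1(2,3)]
        by (simp add: distrib_left)
      also have "\<dots> = \<beta> n" by (simp add: \<beta>_def m_def numeral_eq_Suc)
      finally show ?thesis by (simp add: m_def numeral_eq_Suc mult_ac)
    qed
    have "\<forall>\<^sub>F n in sequentially. cmod (W n) > cmod L / 2"
      using order_tendstoD(1)[OF tendsto_norm[OF L], of "cmod L / 2"] \<open>L \<noteq> 0\<close> by simp
    then obtain N where N: "\<And>n. n \<ge> N \<Longrightarrow> cmod (W n) > cmod L / 2"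
      by (auto simp: eventually_sequentially)
    have "summable (\<lambda>n. \<bar>\<alpha> (n + 2)\<bar> * d (n + 2) * d (n + 3) * r (n + 1) * r (n + 3))"
    proof (rule summable_comparison_test'[where N = N])
      show "summable (\<lambda>n. 2 / cmod L * \<beta> n)" using \<open>summable \<beta>\<close> by (rule summable_mult)
      fix n assume "n \<ge> N"
      let ?a = "\<bar>\<alpha> (n + 2)\<bar> * d (n + 2) * d (n + 3) * r (n + 1) * r (n + 3)"
      have a: "?a \<ge> 0" using d_pos[of "n + 2"] d_pos[of "n + 3"] r_pos[of "n + 1"] r_pos[of "n + 3"] by simp
      have "?a * (cmod L / 2) \<le> ?a * cmod (W (n + 2))"
        using N[of "n + 2"] \<open>n \<ge> N\<close> by (intro mult_left_mono a) auto
      also have "\<dots> \<le> \<beta> n" by (rule bound)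
      finally show "norm ?a \<le> 2 / cmod L * \<beta> n"
        using a \<open>L \<noteq> 0\<close> by (simp add: field_simps)
    qed
    with div show False by simp
  qed
  with L show ?thesis by simp
qed

text \<open>As long as |W| exceeds |L| / 2 > 0, \<open>wronsk_exchange\<close> bounds r |y| by a
  multiple of gamma times \<open>M\<close>, the sum of the moduli of the Wronskians of y with f and
  with g. Inserted into the Lagrange identity, this gives \<open>M\<close> relative increments of
  order gamma squared, so \<open>M\<close> is bounded. Then r |y| tends to 0, contrary to the first
  assumption.\<close>

lemma W_tendsto_0_if_large_solution:
  assumes y: "\<And>n. n \<ge> 1 \<Longrightarrow> r n * cmod (y n) \<ge> 1"
    and Jy: "\<And>n. n \<ge> 2 \<Longrightarrow> jacobi d \<alpha> y n = of_real (\<mu> * (r n)\<^sup>2) * y n"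
  shows "W \<longlonglongrightarrow> 0"
proof -
  obtain L where L: "W \<longlonglongrightarrow> L" using W_convergent by (auto simp: convergent_def)
  have "L = 0"
  proof (rule ccontr)
    assume "L \<noteq> 0"
    have "\<forall>\<^sub>F n in sequentially. cmod (W n) > cmod L / 2"
      using order_tendstoD(1)[OF tendsto_norm[OF L], of "cmod L / 2"] \<open>L \<noteq> 0\<close> by simp
    then obtain N0 where N0: "\<And>n. n \<ge> N0 \<Longrightarrow> cmod (W n) > cmod L / 2"
      by (auto simp: eventually_sequentially)
    define M where "M n = cmod (wronsk d y g n) + cmod (wronsk d y f n)" for n
    define \<kappa> where "\<kappa> = 2 / cmod L"
    have \<kappa>: "\<kappa> > 0" using \<open>L \<noteq> 0\<close> by (simp add: \<kappa>_def)
    have yM: "r (Suc n) * cmod (y (Suc n)) \<le> \<kappa> * (\<gamma> (Suc n) * M n)" if "n \<ge> N0" for n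
    proof -
      have "r (Suc n) * cmod (y (Suc n)) * (cmod L / 2) \<le> r (Suc n) * cmod (y (Suc n)) * cmod (W n)"
        using N0[OF that] r_pos[of "Suc n"] by (intro mult_left_mono) auto
      also have "\<dots> = r (Suc n) * cmod (f (Suc n) * wronsk d y g n - g (Suc n) * wronsk d y f n)"
        using wronsk_exchange[of "Suc n" y d f g] by (simp flip: norm_mult)
      also have "\<dots> \<le> r (Suc n) * (cmod (f (Suc n) * wronsk d y g n) + cmod (g (Suc n) * wronsk d y f n))"
        using r_pos[of "Suc n"] by (intro mult_left_mono norm_triangle_ineq4) auto
      also have "\<dots> = (r (Suc n) * cmod (f (Suc n))) * cmod (wronsk d y g n) + (r (Suc n) * cmod (g (Suc n))) * cmod (wronsk d y f n)"
        by (simp add: norm_mult algebra_simps)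
      also have "\<dots> \<le> \<gamma> (Suc n) * cmod (wronsk d y g n) + \<gamma> (Suc n) * cmod (wronsk d y f n)"
        by (intro add_mono mult_right_mono f_le g_le) auto
      also have "\<dots> = \<gamma> (Suc n) * M n" by (simp add: M_def distrib_left)
      finally show ?thesis using \<open>L \<noteq> 0\<close> by (simp add: \<kappa>_def field_simps)
    qed
    \<comment> \<open>Twice the constant of \<open>W1\<close>, once for each of the two Wronskians
      in \<open>M\<close>.\<close>
    define c where "c = 2 * (1 + \<bar>\<mu>\<bar>) * \<kappa>"
    have c0: "c \<ge> 0" using \<kappa> by (simp add: c_def)
    have W1: "cmod (wronsk d y h (Suc n)) \<le> cmod (wronsk d y h n) + (1 + \<bar>\<mu>\<bar>) * \<kappa> * (\<gamma> (Suc n))\<^sup>2 * M n"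
      if n: "n \<ge> max N0 1" and h: "r (Suc n) * cmod (h (Suc n)) \<le> \<gamma> (Suc n)"
        and Jh: "cmod (jacobi d \<alpha> h (Suc n)) \<le> r (Suc n) * \<gamma> (Suc n)" for h n
    proof -
      let ?m = "Suc n"
      have "wronsk d y h ?m - wronsk d y h n = h ?m * jacobi d \<alpha> y ?m - y ?m * jacobi d \<alpha> h ?m"
        using wronsk_step[of d ?m y h \<alpha>] d_pos[of ?m] d_pos[of "Suc ?m"] by simp
      \<comment> \<open>The shift in the recursion for \<open>y\<close> is moved onto
        \<open>h\<close>, where it has the same size as the defect of \<open>h\<close>.\<close>
      also have "\<dots> = y ?m * (of_real (\<mu> * (r ?m)\<^sup>2) * h ?m - jacobi d \<alpha> h ?m)"
        using Jy[of ?m] n by (simp add: algebra_simps)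
      also have "cmod \<dots> \<le> cmod (y ?m) * (\<bar>\<mu>\<bar> * (r ?m * (r ?m * cmod (h ?m))) + cmod (jacobi d \<alpha> h ?m))"
        unfolding norm_mult[of "y ?m"]
        by (intro mult_left_mono order_trans[OF norm_triangle_ineq4])
           (simp_all add: norm_mult abs_mult power2_eq_square mult_ac)
      also have "\<dots> \<le> cmod (y ?m) * (\<bar>\<mu>\<bar> * (r ?m * \<gamma> ?m) + r ?m * \<gamma> ?m)"
        using h Jh r_pos[of ?m] by (intro mult_left_mono add_mono) auto
      also have "\<dots> = (1 + \<bar>\<mu>\<bar>) * \<gamma> ?m * (r ?m * cmod (y ?m))" by (simp add: algebra_simps)
      also have "\<dots> \<le> (1 + \<bar>\<mu>\<bar>) * \<gamma> ?m * (\<kappa> * (\<gamma> ?m * M n))"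
        using yM[of n] n \<gamma> by (intro mult_left_mono) auto
      also have "\<dots> = (1 + \<bar>\<mu>\<bar>) * \<kappa> * (\<gamma> ?m)\<^sup>2 * M n" by (simp add: power2_eq_square mult_ac)
      finally have "cmod (wronsk d y h ?m - wronsk d y h n) \<le> (1 + \<bar>\<mu>\<bar>) * \<kappa> * (\<gamma> ?m)\<^sup>2 * M n" .
      then show ?thesis using norm_triangle_sub[of "wronsk d y h ?m" "wronsk d y h n"] by linarith
    qed
    have step: "M (Suc n) \<le> M n * (1 + c * (\<gamma> (Suc n))\<^sup>2)" if n: "n \<ge> max N0 1" for n
      using W1[OF n f_le Jf_le] W1[OF n g_le Jg_le] unfolding M_def[of "Suc n"]
      by (simp add: c_def M_def algebra_simps)
    obtain B where B: "\<And>n. n \<ge> max N0 1 \<Longrightarrow> M n \<le> B"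
    proof (rule discrete_Gronwall_bounded[of "\<lambda>n. c * (\<gamma> (Suc n))\<^sup>2" M "max N0 1"])
      show "summable (\<lambda>n. c * (\<gamma> (Suc n))\<^sup>2)"
        using \<gamma>(2) summable_Suc_iff[of "\<lambda>n. (\<gamma> n)\<^sup>2"] by (intro summable_mult) simp
    qed (use c0 step in \<open>auto simp: M_def\<close>)
    have "(\<lambda>n. sqrt ((\<gamma> n)\<^sup>2)) \<longlonglongrightarrow> sqrt 0"
      by (intro tendsto_real_sqrt summable_LIMSEQ_zero \<gamma>)
    then have "\<gamma> \<longlonglongrightarrow> 0" using \<gamma>(1) by simp
    then have "(\<lambda>n. \<kappa> * (\<gamma> (Suc n) * B)) \<longlonglongrightarrow> \<kappa> * (0 * B)"
      by (intro tendsto_intros) (simp add: LIMSEQ_Suc)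
    then have "\<forall>\<^sub>F n in sequentially. \<kappa> * (\<gamma> (Suc n) * B) < 1"
      by (intro order_tendstoD(2)) auto
    then obtain N1 where N1: "\<And>n. n \<ge> N1 \<Longrightarrow> \<kappa> * (\<gamma> (Suc n) * B) < 1"
      by (auto simp: eventually_sequentially)
    define n where "n = max N1 (max N0 1)"
    have "1 \<le> r (Suc n) * cmod (y (Suc n))" by (rule y) simp
    also have "\<dots> \<le> \<kappa> * (\<gamma> (Suc n) * M n)" by (rule yM) (simp add: n_def)
    also have "\<dots> \<le> \<kappa> * (\<gamma> (Suc n) * B)"
      using B[of n] \<kappa> \<gamma> by (intro mult_left_mono) (auto simp: n_def)
    also have "\<dots> < 1" by (rule N1) (simp add: n_def)
    finally show False by simp
  qed
  with L show ?thesis by simp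
qed

end

context jacobi_pair
begin

text \<open>
  The last two conditions of the theorem (with \<open>\<sigma> = -1\<close> and \<open>\<sigma> = 1\<close>) force some solution of the
  recursion to grow: \<open>r n * \<bar>y n\<bar>\<close> increases, for \<open>\<sigma> = -1\<close> with alternating signs.
\<close>

lemma W_tendsto_0_if_dominant:
  assumes \<sigma>: "\<sigma> = 1 \<or> \<sigma> = (-1::real)"
    and dom: "\<And>n. n \<ge> 2 \<Longrightarrow> r n / (d n * r (n - 1)) + r n / (d (n + 1) * r (n + 1))
      \<le> \<sigma> * (\<alpha> n + 1 / d n + 1 / d (n + 1)) + C * (r n)\<^sup>2"
  shows "W \<longlonglongrightarrow> 0"
proof -
  \<comment> \<open>The diagonal coefficient for the shifted value
    \<open>\<alpha> n + \<sigma> * C * (r n)\<^sup>2\<close>, multiplied by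
    \<open>\<sigma>\<close>.\<close>
  define c where "c n = \<sigma> * (\<alpha> n + 1 / d n + 1 / d (n + 1)) + C * (r n)\<^sup>2" for n
  \<comment> \<open>The two-step recursion as an iteration on pairs: \<open>p k\<close> is
    \<open>(z (k + 1), z (k + 2))\<close>. The initial pair makes \<open>r n * z n\<close> equal to
    1 for \<open>n = 1\<close> and \<open>n = 2\<close>.\<close>
  define p where "p = rec_nat (1 / r 1, 1 / r 2) (\<lambda>n q. (snd q, d (n + 3) * (c (n + 2) * snd q - fst q / d (n + 2))))"
  define z where "z n = fst (p (n - 1))" for n
  have pS: "p (Suc n) = (snd (p n), d (n + 3) * (c (n + 2) * snd (p n) - fst (p n) / d (n + 2)))" for n
    by (simp add: p_def)
  have z12: "z 1 = 1 / r 1" "z 2 = 1 / r 2" by (simp_all add: z_def p_def)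
  have zrec: "z (n + 1) / d (n + 1) = c n * z n - z (n - 1) / d n" if n2: "n \<ge> 2" for n
  proof -
    obtain k where k: "n = k + 2" using le_Suc_ex[OF n2] by (auto simp: add.commute)
    have "z (n + 1) = snd (p (Suc k))" "z n = snd (p k)" "z (n - 1) = fst (p k)"
      by (simp_all add: z_def k pS)
    moreover have "snd (p (Suc k)) = d (n + 1) * (c n * snd (p k) - fst (p k) / d n)"
      by (simp add: pS k numeral_eq_Suc)
    ultimately show ?thesis using d_pos[of "n + 1"] by simp
  qed
  have rz: "r 1 * z 1 = 1" "r 2 * z 2 = 1"
    unfolding z12 using r_pos[of 1] r_pos[of 2] by simp_all
  have grow: "r n * z n \<ge> 1" if n: "n \<ge> 1" for n
    using dominant_recursion_mono[OF d_pos r_pos dom[folded c_def] rz zrec n] by blast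
  \<comment> \<open>For \<open>\<sigma> = -1\<close> the alternating signs flip both neighbours
    relative to the middle term, so that the same positive sequence \<open>z\<close> serves an upper
    bound on \<open>\<alpha>\<close> as well as a lower one.\<close>
  define y where "y n = complex_of_real (\<sigma> ^ n * z n)" for n
  show ?thesis
  proof (rule W_tendsto_0_if_large_solution)
    show "1 \<le> r n * cmod (y n)" if n: "n \<ge> 1" for n
    proof -
      have "cmod (y n) = \<bar>z n\<bar>" using \<sigma> by (auto simp: y_def abs_mult power_abs simp del: of_real_mult of_real_power)
      moreover have "r n * z n \<le> r n * \<bar>z n\<bar>" using r_pos[OF n] by (intro mult_left_mono) auto
      ultimately show ?thesis using grow[OF n] by simp
    qed
    show "jacobi d \<alpha> y n = of_real ((- \<sigma> * C) * (r n)\<^sup>2) * y n" if n: "n \<ge> 2" for n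
    proof -
      obtain m where m: "n = Suc m" using n by (cases n) auto
      have s2: "\<sigma> * \<sigma> = 1" using \<sigma> by auto
      have dp: "d n \<noteq> 0" "d (n + 1) \<noteq> 0" using d_pos[of n] d_pos[of "n + 1"] n by auto
      have s1: "\<sigma> ^ (n - 1) = \<sigma> * \<sigma> ^ n" using s2 by (simp add: m flip: mult.assoc)
      have "\<alpha> n * (\<sigma> ^ n * z n) - (\<sigma> ^ (n + 1) * z (n + 1) - \<sigma> ^ n * z n) / d (n + 1)
          + (\<sigma> ^ n * z n - \<sigma> ^ (n - 1) * z (n - 1)) / d n
        = \<sigma> ^ n * ((\<alpha> n + 1 / d n + 1 / d (n + 1)) * z n - \<sigma> * (z (n + 1) / d (n + 1) + z (n - 1) / d n))"
        unfolding s1 by (simp add: algebra_simps diff_divide_distrib add_divide_distrib)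
      also have "z (n + 1) / d (n + 1) + z (n - 1) / d n = c n * z n" using zrec[OF n] by simp
      also have "\<sigma> * (c n * z n) = (\<sigma> * \<sigma>) * (\<alpha> n + 1 / d n + 1 / d (n + 1)) * z n + \<sigma> * C * (r n)\<^sup>2 * z n"
        by (simp add: c_def algebra_simps)
      also have "\<sigma> ^ n * ((\<alpha> n + 1 / d n + 1 / d (n + 1)) * z n - \<dots>) = ((- \<sigma> * C) * (r n)\<^sup>2) * (\<sigma> ^ n * z n)"
        unfolding s2 by (simp add: algebra_simps)
      finally have *: "\<alpha> n * (\<sigma> ^ n * z n) - (\<sigma> ^ (n + 1) * z (n + 1) - \<sigma> ^ n * z n) / d (n + 1)
          + (\<sigma> ^ n * z n - \<sigma> ^ (n - 1) * z (n - 1)) / d n = ((- \<sigma> * C) * (r n)\<^sup>2) * (\<sigma> ^ n * z n)" .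
      have "jacobi d \<alpha> y n = of_real (\<alpha> n * (\<sigma> ^ n * z n) - (\<sigma> ^ (n + 1) * z (n + 1) - \<sigma> ^ n * z n) / d (n + 1)
          + (\<sigma> ^ n * z n - \<sigma> ^ (n - 1) * z (n - 1)) / d n)"
        by (simp only: jacobi_def y_def of_real_add of_real_diff of_real_divide of_real_mult)
      then show ?thesis unfolding * y_def by (simp only: of_real_mult)
    qed
  qed
qed

end

section \<open>End point values and increments in terms of L2 norms on a cell\<close>

lemma polynomial_moment:
  fixes p s A m :: complex
  assumes ac: "a < c"
  shows "((\<lambda>t. (p + s * of_real (t - a)) * (A + m * of_real (t - a))) has_integral
    (p * A * of_real (c - a) + (p * m + s * A) * of_real (c - a) ^ 2 / 2 + s * m * of_real (c - a) ^ 3 / 3)) {a..c}"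
proof -
  define \<tau> where "\<tau> t = complex_of_real (t - a)" for t
  define G where "G t = p * A * \<tau> t + (p * m + s * A) / 2 * \<tau> t ^ 2 + s * m / 3 * \<tau> t ^ 3" for t
  have d1: "(\<tau> has_vector_derivative 1) (at t within {a..c})" for t
    unfolding \<tau>_def by (auto intro!: derivative_eq_intros)
  have d2: "((\<lambda>t. \<tau> t ^ 2) has_vector_derivative 2 * \<tau> t) (at t within {a..c})" for t
    using has_vector_derivative_mult[OF d1[of t] d1[of t]] by (simp add: power2_eq_square)
  have d3: "((\<lambda>t. \<tau> t ^ 3) has_vector_derivative 3 * \<tau> t ^ 2) (at t within {a..c})" for t
    using has_vector_derivative_mult[OF d1[of t] d2[of t]]
    by (simp add: power2_eq_square power3_eq_cube mult.assoc)
  have dG: "(G has_vector_derivative (p + s * \<tau> t) * (A + m * \<tau> t)) (at t within {a..c})" for t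
  proof -
    have "(G has_vector_derivative (p * A * 1 + (p * m + s * A) / 2 * (2 * \<tau> t) + s * m / 3 * (3 * \<tau> t ^ 2))) (at t within {a..c})"
      unfolding G_def by (intro has_vector_derivative_add has_vector_derivative_mult_right d1 d2 d3)
    moreover have "p * A * 1 + (p * m + s * A) / 2 * (2 * \<tau> t) + s * m / 3 * (3 * \<tau> t ^ 2)
        = (p + s * \<tau> t) * (A + m * \<tau> t)"
      by (simp add: field_simps power2_eq_square)
    ultimately show ?thesis by (simp only:)
  qed
  have "((\<lambda>t. (p + s * \<tau> t) * (A + m * \<tau> t)) has_integral (G c - G a)) {a..c}"
    by (rule fundamental_theorem_of_calculus) (use ac dG in auto)
  moreover have "G c - G a = p * A * of_real (c - a) + (p * m + s * A) * of_real (c - a) ^ 2 / 2 + s * m * of_real (c - a) ^ 3 / 3"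
    by (simp add: G_def \<tau>_def)
  ultimately show ?thesis by (simp only: \<tau>_def)
qed

text \<open>Cauchy-Schwarz for the primitive of \<open>w\<close>; integrating the resulting bound
  once more controls the first order Taylor remainder.\<close>

lemma sobolev2_increment:
  assumes S: "sobolev2 a c U U1 w" and t: "t \<in> {a..c}"
  shows "cmod (U1 t - U1 a) \<le> sqrt (c - a) * L2_norm (lebesgue_on {a..c}) w"
    "cmod (U t - U a - of_real (t - a) * U1 a) \<le> (c - a) * (sqrt (c - a) * L2_norm (lebesgue_on {a..c}) w)"
proof -
  note D = sobolev2D[OF S]
  let ?B = "sqrt (c - a) * L2_norm (lebesgue_on {a..c}) w"
  have 1: "cmod (U1 s - U1 a) \<le> ?B" if s: "s \<in> {a..c}" for s
  proof -
    have sub: "{a..s} \<subseteq> {a..c}" using s by auto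
    note w = L2_lebesgue_on_subset[OF D(2) sub]
    have "U1 s - U1 a = integral {a..s} w" using D(4)[OF s] by simp
    also have "cmod \<dots> \<le> sqrt (measure lebesgue {a..s}) * L2_norm (lebesgue_on {a..s}) w"
      by (rule L2_finite_measure_integrable(5)[OF w(1)]) simp_all
    also have "\<dots> \<le> ?B" using s w(2) by (intro mult_mono) auto
    finally show ?thesis .
  qed
  then show "cmod (U1 t - U1 a) \<le> ?B" using t .
  have sub: "{a..t} \<subseteq> {a..c}" using t by auto
  have i: "(\<lambda>s. U1 s - U1 a) integrable_on {a..t}"
    by (intro integrable_diff integrable_on_subinterval[OF D(8) sub] integrable_const_ivl)
  have "integral {a..t} (\<lambda>s. U1 s - U1 a) = integral {a..t} U1 - integral {a..t} (\<lambda>_. U1 a)"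
    by (intro Henstock_Kurzweil_Integration.integral_diff integrable_on_subinterval[OF D(8) sub] integrable_const_ivl)
  then have "U t - U a - of_real (t - a) * U1 a = integral {a..t} (\<lambda>s. U1 s - U1 a)"
    using D(5)[OF t] t by (simp add: scaleR_conv_of_real)
  also have "cmod \<dots> \<le> ?B * (t - a)"
    by (rule integral_bound) (use t 1 i continuous_on_subset[OF D(6) sub] in \<open>auto intro!: continuous_intros\<close>)
  also have "\<dots> \<le> ?B * (c - a)" using t by (intro mult_left_mono) auto
  finally show "cmod (U t - U a - of_real (t - a) * U1 a) \<le> (c - a) * ?B" by (simp add: mult.commute)
qed

text \<open>
  The weights \<open>4 - 6 \<tau> / L\<close> and \<open>6 \<tau> / L - 2\<close> on \<open>[0, L]\<close> integrate an affine function to \<open>L\<close>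
  times its value at the left and at the right end point.
\<close>

lemma sobolev2_endpoint_bound:
  assumes S: "sobolev2 a c U U1 w" and E: "c - a \<le> E" "E \<ge> 1"
  defines "\<beta> \<equiv> L2_norm (lebesgue_on {a..c}) U + L2_norm (lebesgue_on {a..c}) w"
  shows "sqrt (c - a) * cmod (U a) \<le> 5 * E\<^sup>2 * \<beta>" "sqrt (c - a) * cmod (U c) \<le> 5 * E\<^sup>2 * \<beta>"
proof -
  note D = sobolev2D[OF S]
  let ?u = "L2_norm (lebesgue_on {a..c}) U" and ?w = "L2_norm (lebesgue_on {a..c}) w"
  define L where "L = c - a"
  have L: "L > 0" using D(1) by (simp add: L_def)
  have UL: "U \<in> L2 (lebesgue_on {a..c})" by (rule continuous_on_imp_L2[OF D(7)])
  define Er where "Er t = U t - (U a + U1 a * of_real (t - a))" for t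
  have Er: "cmod (Er t) \<le> L * (sqrt L * ?w)" if "t \<in> {a..c}" for t
    using sobolev2_increment(2)[OF S that] by (simp add: Er_def L_def algebra_simps)
  have cEr: "continuous_on {a..c} Er" unfolding Er_def by (intro continuous_intros D(7))
  \<comment> \<open>4 is the largest absolute value of either weight chosen below, both of which
    range over \<open>[-2, 4]\<close>.\<close>
  have main: "cmod (p * U a * of_real L + (p * U1 a + s * U a) * of_real L ^ 2 / 2 + s * U1 a * of_real L ^ 3 / 3)
      \<le> 4 * (sqrt L * ?u) + 4 * (L * (sqrt L * ?w)) * L"
    if ps: "\<And>t. t \<in> {a..c} \<Longrightarrow> cmod (p + s * of_real (t - a)) \<le> 4" for p s
  proof -
    let ?k = "\<lambda>t. p + s * complex_of_real (t - a)"
    have ck: "continuous_on {a..c} ?k" by (intro continuous_intros)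
    have i: "(\<lambda>t. ?k t * U t) integrable_on {a..c}" "(\<lambda>t. ?k t * Er t) integrable_on {a..c}"
      by (intro integrable_continuous_interval continuous_on_mult ck D(7) cEr)+
    have "p * U a * of_real L + (p * U1 a + s * U a) * of_real L ^ 2 / 2 + s * U1 a * of_real L ^ 3 / 3
        = integral {a..c} (\<lambda>t. ?k t * (U a + U1 a * of_real (t - a)))"
      unfolding L_def by (rule integral_unique[symmetric, OF polynomial_moment[OF D(1)]])
    also have "\<dots> = integral {a..c} (\<lambda>t. ?k t * U t - ?k t * Er t)"
      by (rule Henstock_Kurzweil_Integration.integral_cong) (simp add: Er_def algebra_simps)
    also have "\<dots> = integral {a..c} (\<lambda>t. ?k t * U t) - integral {a..c} (\<lambda>t. ?k t * Er t)"
      by (rule Henstock_Kurzweil_Integration.integral_diff[OF i])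
    also have "cmod \<dots> \<le> cmod (integral {a..c} (\<lambda>t. ?k t * U t)) + cmod (integral {a..c} (\<lambda>t. ?k t * Er t))"
      by (rule norm_triangle_ineq4)
    also have "cmod (integral {a..c} (\<lambda>t. ?k t * U t)) \<le> integral {a..c} (\<lambda>t. 4 * cmod (U t))"
    proof (rule integral_norm_bound_integral[OF i(1)])
      show "(\<lambda>t. 4 * cmod (U t)) integrable_on {a..c}"
        by (intro integrable_continuous_interval continuous_intros D(7))
      show "cmod (?k t * U t) \<le> 4 * cmod (U t)" if "t \<in> {a..c}" for t
        unfolding norm_mult by (intro mult_right_mono ps that) simp
    qed
    also have "integral {a..c} (\<lambda>t. 4 * cmod (U t)) = 4 * integral {a..c} (\<lambda>t. cmod (U t))"
      by (rule integral_mult_right)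
    also have "integral {a..c} (\<lambda>t. cmod (U t)) \<le> sqrt L * ?u"
      using L2_finite_measure_integrable(4)[OF UL] L by (simp add: L_def)
    also have "cmod (integral {a..c} (\<lambda>t. ?k t * Er t)) \<le> 4 * (L * (sqrt L * ?w)) * L"
      unfolding L_def
    proof (rule integral_bound)
      show "continuous_on {a..c} (\<lambda>t. ?k t * Er t)" by (intro continuous_on_mult ck cEr)
      show "cmod (?k t * Er t) \<le> 4 * ((c - a) * (sqrt (c - a) * ?w))" if "t \<in> {a..c}" for t
        unfolding norm_mult by (intro mult_mono ps that Er[unfolded L_def]) auto
    qed (use D(1) in simp)
    finally show ?thesis by simp
  qed
  \<comment> \<open>One factor \<open>sqrt L\<close> is cancelled. The constant 5 in place of 4
    leaves room for the Taylor remainder at the right end point.\<close>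
  have fin: "sqrt L * X \<le> 5 * E\<^sup>2 * \<beta>"
    if X: "X * L \<le> 4 * (sqrt L * ?u) + 5 * (L * (sqrt L * ?w)) * L" for X
  proof -
    have ss: "sqrt L * sqrt L = L" using L by simp
    have "(sqrt L * X) * sqrt L = X * (sqrt L * sqrt L)" by (simp only: mult_ac)
    also have "\<dots> = X * L" by (simp only: ss)
    also have "\<dots> \<le> (4 * ?u + 5 * L\<^sup>2 * ?w) * sqrt L"
      using X by (simp add: algebra_simps power2_eq_square)
    finally have "sqrt L * X \<le> 4 * ?u + 5 * L\<^sup>2 * ?w"
      using L by (simp add: mult_le_cancel_right)
    also have "\<dots> \<le> 5 * E\<^sup>2 * ?u + 5 * E\<^sup>2 * ?w"
    proof (intro add_mono mult_right_mono)
      have "1 \<le> E\<^sup>2" using E(2) by (simp add: one_le_power)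
      then show "4 \<le> 5 * E\<^sup>2" by linarith
      show "5 * L\<^sup>2 \<le> 5 * E\<^sup>2" using E(1) L by (simp add: L_def power_mono)
    qed auto
    also have "\<dots> = 5 * E\<^sup>2 * \<beta>" by (simp add: \<beta>_def distrib_left)
    finally show ?thesis .
  qed
  have frac: "0 \<le> (t - a) / L" "(t - a) / L \<le> 1" if "t \<in> {a..c}" for t
    using that L by (auto simp: L_def)
  show "sqrt (c - a) * cmod (U a) \<le> 5 * E\<^sup>2 * \<beta>"
  proof -
    have "cmod (4 + (- 6 / of_real L) * of_real (t - a)) \<le> 4" if "t \<in> {a..c}" for t
    proof -
      have "4 + (- 6 / of_real L) * of_real (t - a) = complex_of_real (4 - 6 * ((t - a) / L))" by simp
      then have "cmod (4 + (- 6 / of_real L) * of_real (t - a)) = \<bar>4 - 6 * ((t - a) / L)\<bar>"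
        by (simp only: norm_of_real)
      then show ?thesis using frac[OF that] by linarith
    qed
    from main[OF this] have "cmod (U a * of_real L) \<le> 4 * (sqrt L * ?u) + 4 * (L * (sqrt L * ?w)) * L"
    proof (rule order_trans[rotated])
      have "U a * of_real L = 4 * U a * of_real L + (4 * U1 a + (- 6 / of_real L) * U a) * of_real L ^ 2 / 2
          + (- 6 / of_real L) * U1 a * of_real L ^ 3 / 3"
        using L by (simp add: field_simps power2_eq_square power3_eq_cube)
      then show "cmod (U a * of_real L) \<le> cmod (4 * U a * of_real L + (4 * U1 a + (- 6 / of_real L) * U a) * of_real L ^ 2 / 2
          + (- 6 / of_real L) * U1 a * of_real L ^ 3 / 3)" by (rule eq_refl[OF arg_cong[where f = cmod]])
    qed
    moreover have "cmod (U a * of_real L) = cmod (U a) * L" using L by (simp add: norm_mult)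
    moreover have "0 \<le> (L * (sqrt L * ?w)) * L" using L by simp
    ultimately have "cmod (U a) * L \<le> 4 * (sqrt L * ?u) + 5 * (L * (sqrt L * ?w)) * L" by simp
    from fin[OF this] show ?thesis by (simp add: L_def)
  qed
  show "sqrt (c - a) * cmod (U c) \<le> 5 * E\<^sup>2 * \<beta>"
  proof -
    have "cmod (- 2 + (6 / of_real L) * of_real (t - a)) \<le> 4" if "t \<in> {a..c}" for t
    proof -
      have "- 2 + (6 / of_real L) * of_real (t - a) = complex_of_real (6 * ((t - a) / L) - 2)" by simp
      then have "cmod (- 2 + (6 / of_real L) * of_real (t - a)) = \<bar>6 * ((t - a) / L) - 2\<bar>"
        by (simp only: norm_of_real)
      then show ?thesis using frac[OF that] by linarith
    qed
    from main[OF this] have "cmod ((U a + U1 a * of_real L) * of_real L) \<le> 4 * (sqrt L * ?u) + 4 * (L * (sqrt L * ?w)) * L"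
    proof (rule order_trans[rotated])
      have "(U a + U1 a * of_real L) * of_real L = - 2 * U a * of_real L + (- 2 * U1 a + (6 / of_real L) * U a) * of_real L ^ 2 / 2
          + (6 / of_real L) * U1 a * of_real L ^ 3 / 3"
        using L by (simp add: field_simps power2_eq_square power3_eq_cube)
      then show "cmod ((U a + U1 a * of_real L) * of_real L) \<le> cmod (- 2 * U a * of_real L + (- 2 * U1 a + (6 / of_real L) * U a) * of_real L ^ 2 / 2
          + (6 / of_real L) * U1 a * of_real L ^ 3 / 3)" by (rule eq_refl[OF arg_cong[where f = cmod]])
    qed
    moreover have "cmod (U c) * L \<le> cmod ((U a + U1 a * of_real L) * of_real L) + (L * (sqrt L * ?w)) * L"
    proof -
      have "U c = (U a + U1 a * of_real L) + Er c" by (simp add: Er_def L_def)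
      then have "cmod (U c) \<le> cmod (U a + U1 a * of_real L) + cmod (Er c)" by (metis norm_triangle_ineq)
      also have "\<dots> \<le> cmod (U a + U1 a * of_real L) + L * (sqrt L * ?w)"
        using Er[of c] D(1) by simp
      finally have "cmod (U c) * L \<le> (cmod (U a + U1 a * of_real L) + L * (sqrt L * ?w)) * L"
        using L by (intro mult_right_mono) auto
      moreover have "cmod ((U a + U1 a * of_real L) * of_real L) = cmod (U a + U1 a * of_real L) * L"
        unfolding norm_mult using L by simp
      ultimately show ?thesis by (simp only: distrib_right)
    qed
    ultimately have "cmod (U c) * L \<le> 4 * (sqrt L * ?u) + 5 * (L * (sqrt L * ?w)) * L" by simp
    from fin[OF this] show ?thesis by (simp add: L_def)
  qed
qed

section \<open>Node values and the limit point case\<close>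

text \<open>For nonnegative terms unordered and ordered summability coincide.\<close>

lemma summable_on_atLeast_iff_summable:
  fixes F :: "nat \<Rightarrow> real"
  assumes "\<And>n. n \<ge> k \<Longrightarrow> F n \<ge> 0"
  shows "F summable_on {k..} \<longleftrightarrow> summable (\<lambda>n. F (n + k))"
proof -
  have img: "{k..} = (\<lambda>n. n + k) ` UNIV"
    by (auto simp: image_iff) (metis add.commute le_Suc_ex)
  have "F summable_on {k..} \<longleftrightarrow> (F \<circ> (\<lambda>n. n + k)) summable_on UNIV"
    unfolding img by (rule summable_on_reindex) (simp add: inj_on_def)
  also have "\<dots> \<longleftrightarrow> summable (F \<circ> (\<lambda>n. n + k))"
    by (rule summable_on_UNIV_nonneg_real_iff) (simp add: assms)
  finally show ?thesis by (simp add: o_def)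
qed

lemma L2_norm_square_integral:
  assumes "f \<in> L2 (lebesgue_on S)" "S \<in> sets lebesgue"
  shows "complex_of_real ((L2_norm (lebesgue_on S) f)\<^sup>2) = integral S (\<lambda>t. complex_of_real ((cmod (f t))\<^sup>2))"
proof -
  have "integrable (lebesgue_on S) (\<lambda>t. complex_of_real ((cmod (f t))\<^sup>2))"
    using L2D(2)[OF assms(1)] by (rule integrable_of_real)
  from lebesgue_integral_eq_integral[OF this assms(2)] show ?thesis
    by (simp only: L2_norm_square integral_complex_of_real)
qed

context delta_points
begin

lemma gap_Suc: "gap x (Suc n) = x (Suc n) - x n"
  by (simp add: gap_def)

lemma gap_pos: "n \<ge> 1 \<Longrightarrow> gap x n > 0"
  using x_less_iff[of "n - 1" n] by (simp add: gap_def)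

lemma summable_L2_norm_cells:
  assumes "f \<in> L2 M"
  shows "summable (\<lambda>n. (L2_norm (lebesgue_on (J n)) f)\<^sup>2)"
proof -
  have "integrable M (\<lambda>t. complex_of_real ((cmod (f t))\<^sup>2))"
    using L2D(2)[OF assms] by (rule integrable_of_real)
  from sums_summable[OF integral_sums[OF this]]
  have "summable (\<lambda>n. complex_of_real ((L2_norm (lebesgue_on (J n)) f)\<^sup>2))"
    by (simp only: L2_norm_square_integral[OF J_L2[OF assms] J_lebesgue])
  then show ?thesis by (simp only: summable_complex_of_real)
qed

definition nodes :: "(nat \<Rightarrow> real \<Rightarrow> complex) \<Rightarrow> nat \<Rightarrow> complex" where
  "nodes U n = U n (x n)"

definition cell_norm :: "(real \<Rightarrow> complex) \<Rightarrow> (real \<Rightarrow> complex) \<Rightarrow> nat \<Rightarrow> real" where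
  "cell_norm u v n = L2_norm (lebesgue_on (J n)) u + L2_norm (lebesgue_on (J n)) v"

lemma cell_norm_nonneg [simp]: "0 \<le> cell_norm u v n"
  by (simp add: cell_norm_def)

lemma summable_cell_norm:
  assumes "u \<in> L2 M" "v \<in> L2 M"
  shows "summable (\<lambda>n. (cell_norm u v n)\<^sup>2)"
proof (rule summable_comparison_test'[where N = 0])
  show "summable (\<lambda>n. 2 * (L2_norm (lebesgue_on (J n)) u)\<^sup>2 + 2 * (L2_norm (lebesgue_on (J n)) v)\<^sup>2)"
    by (intro summable_add summable_mult summable_L2_norm_cells assms)
  fix n
  have "(a + b)\<^sup>2 \<le> 2 * a\<^sup>2 + 2 * b\<^sup>2" for a b :: real
    using sum_squares_bound[of a b] by (simp add: power2_sum)
  then show "norm ((cell_norm u v n)\<^sup>2) \<le> 2 * (L2_norm (lebesgue_on (J n)) u)\<^sup>2 + 2 * (L2_norm (lebesgue_on (J n)) v)\<^sup>2"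
    by (simp add: cell_norm_def)
qed

text \<open>
  Passing to the node values turns an element of the maximal domain into a solution of the
  Jacobi recursion up to an error that is square summable after division by \<open>rad\<close>.
\<close>

lemma nodes_bounds:
  assumes rep: "delta_rep u v U U1" and u: "u \<in> L2 M" and v: "v \<in> L2 M"
    and E: "E \<ge> 1" "\<And>n. gap x (Suc n) \<le> E" and n: "n \<ge> 1"
  defines "\<gamma> \<equiv> 5 * E\<^sup>2 * (cell_norm u v (n - 1) + cell_norm u v n)"
  shows "rad x n * cmod (nodes U n) \<le> \<gamma>"
    "cmod (jacobi (gap x) \<alpha> (nodes U) n) \<le> rad x n * \<gamma>"
    "cmod ((nodes U (n + 1) - nodes U n) / of_real (gap x (n + 1)) - U1 n (x n)) \<le> rad x n * \<gamma>"
proof -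
  obtain m where m: "n = Suc m" using n by (cases n) auto
  have S: "sobolev2 (x k) (x (Suc k)) (U k) (U1 k) (\<lambda>t. - v t)" and ae: "AE t in lebesgue_on (J k). u t = U k t"
    and cont: "U (Suc k) (x (Suc k)) = U k (x (Suc k))"
    and jump: "U1 (Suc k) (x (Suc k)) - U1 k (x (Suc k)) = of_real (\<alpha> (Suc k)) * U k (x (Suc k))" for k
    using rep unfolding delta_rep_def by blast+
  have nU: "L2_norm (lebesgue_on (J k)) (U k) = L2_norm (lebesgue_on (J k)) u" for k
  proof (rule L2_norm_cong_AE)
    show "AE t in lebesgue_on (J k). U k t = u t" using ae[of k] by (rule AE_mp) auto
    show "U k \<in> borel_measurable (lebesgue_on (J k))"
      using continuous_on_imp_L2[OF sobolev2D(7)[OF S]] by (rule L2D)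
    show "u \<in> borel_measurable (lebesgue_on (J k))" using J_L2[OF u] by (rule L2D)
  qed
  have nv: "L2_norm (lebesgue_on (J k)) (\<lambda>t. - v t) = L2_norm (lebesgue_on (J k)) v" for k
    by (simp add: L2_norm_def)
  let ?b = "cell_norm u v"
  have E2: "5 * E\<^sup>2 \<ge> 5" using E(1) by (simp add: one_le_power)
  have \<gamma>b: "5 * ?b k \<le> 5 * E\<^sup>2 * ?b k" for k using E2 by (intro mult_right_mono) auto
  have dn: "gap x n > 0" "gap x (n + 1) > 0" using gap_pos n by simp_all
  have sr: "sqrt (gap x n) \<le> rad x n" "sqrt (gap x (n + 1)) \<le> rad x n"
    using dn by (simp_all add: rad_def)
  have r0: "rad x n \<ge> 0" using dn by (simp add: rad_def)
  have left: "sqrt (gap x n) * cmod (nodes U n) \<le> 5 * E\<^sup>2 * ?b m"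
    using sobolev2_endpoint_bound(2)[OF S[of m], of E] E cont[of m]
    by (simp add: m nodes_def gap_Suc nU nv cell_norm_def)
  have right: "sqrt (gap x (n + 1)) * cmod (nodes U n) \<le> 5 * E\<^sup>2 * ?b n"
    using sobolev2_endpoint_bound(1)[OF S[of n], of E] E
    by (simp add: nodes_def gap_Suc nU nv cell_norm_def)
  \<comment> \<open>The root of the sum is at most the sum of the roots, and each root is matched by
    the end point bound of its own cell.\<close>
  have "rad x n * cmod (nodes U n) \<le> (sqrt (gap x n) + sqrt (gap x (n + 1))) * cmod (nodes U n)"
    unfolding rad_def using dn by (intro mult_right_mono sqrt_add_le_add_sqrt) auto
  also have "\<dots> \<le> \<gamma>" using left right by (simp add: \<gamma>_def m algebra_simps)
  finally show "rad x n * cmod (nodes U n) \<le> \<gamma>" .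
  have vb: "L2_norm (lebesgue_on (J k)) v \<le> ?b k" for k by (simp add: cell_norm_def)
  \<comment> \<open>The difference quotient misses the slope at the left end by the Taylor remainder
    divided by the length of the cell.\<close>
  have slope: "cmod ((nodes U (Suc k) - nodes U k) / of_real (gap x (Suc k)) - U1 k (x k)) \<le> sqrt (gap x (Suc k)) * ?b k" for k
  proof -
    have g: "gap x (Suc k) > 0" using gap_pos by simp
    have "cmod (U k (x (Suc k)) - U k (x k) - of_real (gap x (Suc k)) * U1 k (x k))
        \<le> gap x (Suc k) * (sqrt (gap x (Suc k)) * L2_norm (lebesgue_on (J k)) v)"
      using sobolev2_increment(2)[OF S[of k], of "x (Suc k)"] by (simp add: gap_Suc nv)
    also have "\<dots> \<le> gap x (Suc k) * (sqrt (gap x (Suc k)) * ?b k)"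
      using g vb by (intro mult_left_mono) auto
    finally have *: "cmod (U k (x (Suc k)) - U k (x k) - of_real (gap x (Suc k)) * U1 k (x k))
        \<le> gap x (Suc k) * (sqrt (gap x (Suc k)) * ?b k)" .
    have "(nodes U (Suc k) - nodes U k) / of_real (gap x (Suc k)) - U1 k (x k)
        = (U k (x (Suc k)) - U k (x k) - of_real (gap x (Suc k)) * U1 k (x k)) / of_real (gap x (Suc k))"
      using g cont[of k] by (simp add: nodes_def diff_divide_distrib)
    then have "cmod ((nodes U (Suc k) - nodes U k) / of_real (gap x (Suc k)) - U1 k (x k))
        = cmod (U k (x (Suc k)) - U k (x k) - of_real (gap x (Suc k)) * U1 k (x k)) / gap x (Suc k)"
      using g by (simp add: norm_divide)
    also have "\<dots> \<le> sqrt (gap x (Suc k)) * ?b k"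
      using * g by (simp add: pos_divide_le_eq mult.commute)
    finally show ?thesis .
  qed
  have s1: "cmod ((nodes U (n + 1) - nodes U n) / of_real (gap x (n + 1)) - U1 n (x n)) \<le> rad x n * ?b n"
    using slope[of n] mult_right_mono[OF sr(2) cell_norm_nonneg[of u v n]] by simp
  also have "\<dots> \<le> rad x n * \<gamma>"
  proof (rule mult_left_mono[OF _ r0])
    show "?b n \<le> \<gamma>" using \<gamma>b[of n] \<gamma>b[of "n - 1"] cell_norm_nonneg[of u v n] cell_norm_nonneg[of u v "n - 1"]
      unfolding \<gamma>_def distrib_left by linarith
  qed
  finally show "cmod ((nodes U (n + 1) - nodes U n) / of_real (gap x (n + 1)) - U1 n (x n)) \<le> rad x n * \<gamma>" .
  have s2: "cmod ((nodes U n - nodes U m) / of_real (gap x n) - U1 m (x m)) \<le> rad x n * ?b m"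
    using slope[of m] mult_right_mono[OF sr(1) cell_norm_nonneg[of u v m]] by (simp add: m)
  have s3: "cmod (U1 m (x n) - U1 m (x m)) \<le> rad x n * ?b m"
  proof -
    have "cmod (U1 m (x n) - U1 m (x m)) \<le> sqrt (gap x n) * L2_norm (lebesgue_on (J m)) v"
      using sobolev2_increment(1)[OF S[of m], of "x n"] by (simp add: gap_Suc nv m)
    also have "\<dots> \<le> rad x n * ?b m" using sr(1) vb r0 by (intro mult_mono) auto
    finally show ?thesis .
  qed
  \<comment> \<open>The jump condition replaces \<open>\<alpha> n\<close> times the node value by a
    difference of slopes; \<open>\<alpha>\<close> disappears and every bracket is an error estimated
    above.\<close>
  have "jacobi (gap x) \<alpha> (nodes U) n
      = ((nodes U n - nodes U m) / of_real (gap x n) - U1 m (x m)) - (U1 m (x n) - U1 m (x m))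
        - ((nodes U (n + 1) - nodes U n) / of_real (gap x (n + 1)) - U1 n (x n))"
    using jump[of m] cont[of m] by (simp add: jacobi_def nodes_def m)
  also have "cmod \<dots> \<le> (rad x n * ?b m + rad x n * ?b m) + rad x n * ?b n"
    by (rule order_trans[OF norm_triangle_ineq4 add_mono[OF order_trans[OF norm_triangle_ineq4 add_mono[OF s2 s3]] s1]])
  also have "\<dots> = rad x n * (2 * ?b m + ?b n)" by (simp add: algebra_simps)
  also have "\<dots> \<le> rad x n * \<gamma>"
  proof (rule mult_left_mono[OF _ r0])
    show "2 * ?b m + ?b n \<le> \<gamma>" using \<gamma>b[of n] \<gamma>b[of m] cell_norm_nonneg[of u v n] cell_norm_nonneg[of u v m]
      unfolding \<gamma>_def distrib_left m diff_Suc_1 by linarith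
  qed
  finally show "cmod (jacobi (gap x) \<alpha> (nodes U) n) \<le> rad x n * \<gamma>" .
qed

text \<open>Conjugation preserves the jump conditions because \<open>\<alpha>\<close> is
  real.\<close>

lemma delta_rep_cnj:
  assumes "delta_rep u v U U1"
  shows "delta_rep (\<lambda>t. cnj (u t)) (\<lambda>t. cnj (v t)) (\<lambda>n t. cnj (U n t)) (\<lambda>n t. cnj (U1 n t))"
proof -
  have S: "sobolev2 (x k) (x (Suc k)) (U k) (U1 k) (\<lambda>t. - v t)" and ae: "AE t in lebesgue_on (J k). u t = U k t"
    and cont: "U (Suc k) (x (Suc k)) = U k (x (Suc k))"
    and jump: "U1 (Suc k) (x (Suc k)) - U1 k (x (Suc k)) = of_real (\<alpha> (Suc k)) * U k (x (Suc k))"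
    and z: "U1 0 0 = 0" for k
    using assms unfolding delta_rep_def by blast+
  show ?thesis
    unfolding delta_rep_def
  proof (intro conjI allI)
    fix n
    show "sobolev2 (x n) (x (Suc n)) (\<lambda>t. cnj (U n t)) (\<lambda>t. cnj (U1 n t)) (\<lambda>t. - cnj (v t))"
      using sobolev2_cnj[OF S[of n]] by simp
    show "AE t in lebesgue_on (J n). cnj (u t) = cnj (U n t)" using ae[of n] by (rule AE_mp) simp
    show "cnj (U (Suc n) (x (Suc n))) = cnj (U n (x (Suc n)))" by (simp only: cont)
    show "cnj (U1 (Suc n) (x (Suc n))) - cnj (U1 n (x (Suc n))) = of_real (\<alpha> (Suc n)) * cnj (U n (x (Suc n)))"
      using arg_cong[OF jump[of n], of cnj] by simp
    show "cnj (U1 0 0) = 0" by (simp only: z complex_cnj_zero)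
  qed
qed

text \<open>A discrete form of Weyl's limit point case at \<open>b\<close>. Quantifying over
  abstract sequences separates the operator from the three conditions.\<close>

definition limit_point :: bool where
  "limit_point \<longleftrightarrow> (\<forall>\<gamma> f g. jacobi_pair (gap x) \<alpha> (rad x) \<gamma> f g \<longrightarrow> wronsk (gap x) f g \<longlonglongrightarrow> 0)"

text \<open>Green's formula summed over the cells telescopes, since the interface conditions make
  the Wronskian continuous across the nodes. The boundary term vanishes at 0 by the Neumann
  condition and in the limit at \<open>b\<close> by comparison with the discrete Wronskian.\<close>

lemma delta_max_symmetric:
  assumes dsum: "summable (\<lambda>n. (gap x n)\<^sup>2)" and lp: limit_point
    and D: "(f, g) \<in> delta_max" "(u, v) \<in> delta_max"
  shows "L2_inner M g u = L2_inner M f v"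
proof -
  from D obtain F F1 U U1 where F: "f \<in> L2 M" "g \<in> L2 M" "delta_rep f g F F1"
    and U: "u \<in> L2 M" "v \<in> L2 M" "delta_rep u v U U1" by (auto simp: delta_max_def)
  \<comment> \<open>Conjugating one function makes every form bilinear, as in
    \<open>sobolev2_Green\<close> and \<open>wronsk\<close>.\<close>
  define V where "V n t = cnj (U n t)" for n t
  define V1 where "V1 n t = cnj (U1 n t)" for n t
  let ?u = "\<lambda>t. cnj (u t)" and ?v = "\<lambda>t. cnj (v t)"
  have V: "?u \<in> L2 M" "?v \<in> L2 M" "delta_rep ?u ?v V V1"
    using U delta_rep_cnj[OF U(3)] by (auto intro: L2_cnj simp: V_def[abs_def] V1_def[abs_def])
  have "(\<lambda>n. sqrt ((gap x n)\<^sup>2)) \<longlonglongrightarrow> sqrt 0"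
    by (intro tendsto_real_sqrt summable_LIMSEQ_zero dsum)
  then have "gap x \<longlonglongrightarrow> 0" by (simp add: tendsto_rabs_zero_iff)
  then have "Bseq (gap x)" by (intro convergent_imp_Bseq) (auto simp: convergent_def)
  then obtain K where K: "K > 0" "\<And>n. \<bar>gap x n\<bar> \<le> K" by (auto elim: BseqE)
  define E where "E = max K 1"
  have E: "E \<ge> 1" "\<And>n. gap x (Suc n) \<le> E"
    using K(2) by (auto simp: E_def intro: order_trans[OF abs_ge_self] max.coboundedI1)
  define \<gamma>f where "\<gamma>f n = 5 * E\<^sup>2 * (cell_norm f g (n - 1) + cell_norm f g n)" for n
  define \<gamma>v where "\<gamma>v n = 5 * E\<^sup>2 * (cell_norm ?u ?v (n - 1) + cell_norm ?u ?v n)" for n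
  define \<gamma> where "\<gamma> n = \<gamma>f n + \<gamma>v n" for n
  note bf = nodes_bounds[OF F(3,1,2) E, folded \<gamma>f_def] and bv = nodes_bounds[OF V(3,1,2) E, folded \<gamma>v_def]
  have \<gamma>0: "\<gamma>f n \<ge> 0" "\<gamma>v n \<ge> 0" for n by (auto simp: \<gamma>f_def \<gamma>v_def)
  then have \<gamma>le: "\<gamma>f n \<le> \<gamma> n" "\<gamma>v n \<le> \<gamma> n" and \<gamma>nn: "\<gamma> n \<ge> 0" for n by (auto simp: \<gamma>_def)
  have rad0: "rad x n \<ge> 0" if "n \<ge> 1" for n using gap_pos[OF that] gap_pos[of "n + 1"] by (simp add: rad_def)
  have sum\<gamma>: "summable (\<lambda>n. (\<gamma> n)\<^sup>2)"
  proof -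
    have sq: "(a + b)\<^sup>2 \<le> 2 * a\<^sup>2 + 2 * b\<^sup>2" for a b :: real
      using sum_squares_bound[of a b] by (simp add: power2_sum)
    have shift: "summable (\<lambda>n. (h n)\<^sup>2) \<Longrightarrow> summable (\<lambda>n. (h (n - 1))\<^sup>2)" for h :: "nat \<Rightarrow> real"
      using summable_Suc_iff[of "\<lambda>n. (h (n - 1))\<^sup>2"] by simp
    have half: "summable (\<lambda>n. (5 * E\<^sup>2 * (h (n - 1) + h n))\<^sup>2)" if "summable (\<lambda>n. (h n)\<^sup>2)" for h :: "nat \<Rightarrow> real"
    proof (rule summable_comparison_test'[where N = 0])
      show "summable (\<lambda>n. (5 * E\<^sup>2)\<^sup>2 * (2 * (h (n - 1))\<^sup>2 + 2 * (h n)\<^sup>2))"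
        by (intro summable_mult summable_add that shift)
      show "norm ((5 * E\<^sup>2 * (h (n - 1) + h n))\<^sup>2) \<le> (5 * E\<^sup>2)\<^sup>2 * (2 * (h (n - 1))\<^sup>2 + 2 * (h n)\<^sup>2)" for n
        unfolding power_mult_distrib[of "5 * E\<^sup>2"] real_norm_def abs_of_nonneg[OF mult_nonneg_nonneg[OF zero_le_power2 zero_le_power2]]
        by (intro mult_left_mono sq) simp
    qed
    have "summable (\<lambda>n. (\<gamma>f n)\<^sup>2)" "summable (\<lambda>n. (\<gamma>v n)\<^sup>2)"
      unfolding \<gamma>f_def \<gamma>v_def by (intro half summable_cell_norm F V)+
    then have "summable (\<lambda>n. 2 * (\<gamma>f n)\<^sup>2 + 2 * (\<gamma>v n)\<^sup>2)" by (intro summable_add summable_mult)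
    then show ?thesis
      by (rule summable_comparison_test'[where N = 0]) (simp add: \<gamma>_def sq)
  qed
  have JP: "jacobi_pair (gap x) \<alpha> (rad x) \<gamma> (nodes F) (nodes V)"
  proof
    fix n :: nat
    show "rad x n = sqrt (gap x n + gap x (n + 1))" by (simp add: rad_def)
    show "0 \<le> \<gamma> n" by (rule \<gamma>nn)
    assume n: "n \<ge> 1"
    show "0 < gap x n" using n by (rule gap_pos)
    show "rad x n * cmod (nodes F n) \<le> \<gamma> n" using bf(1)[OF n] \<gamma>le(1)[of n] by linarith
    show "rad x n * cmod (nodes V n) \<le> \<gamma> n" using bv(1)[OF n] \<gamma>le(2)[of n] by linarith
    show "cmod (jacobi (gap x) \<alpha> (nodes F) n) \<le> rad x n * \<gamma> n"
      using bf(2)[OF n] mult_left_mono[OF \<gamma>le(1) rad0[OF n], of n] by linarith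
    show "cmod (jacobi (gap x) \<alpha> (nodes V) n) \<le> rad x n * \<gamma> n"
      using bv(2)[OF n] mult_left_mono[OF \<gamma>le(2) rad0[OF n], of n] by linarith
  qed (rule sum\<gamma>)
  then have W0: "wronsk (gap x) (nodes F) (nodes V) \<longlonglongrightarrow> 0"
    using lp by (auto simp: limit_point_def)
  \<comment> \<open>\<open>\<omega>\<close> is F' V - F V', opposite in sign to
    \<open>wronsk\<close>; hence it is their sum that is small.\<close>
  define \<omega> where "\<omega> n = F1 n (x n) * V n (x n) - F n (x n) * V1 n (x n)" for n
  have \<omega>W: "cmod (\<omega> n + wronsk (gap x) (nodes F) (nodes V) n) \<le> 2 * (\<gamma> n)\<^sup>2" if n: "n \<ge> 1" for n
  proof -
    let ?e = "(nodes F (n + 1) - nodes F n) / of_real (gap x (n + 1)) - F1 n (x n)"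
    let ?h = "(nodes V (n + 1) - nodes V n) / of_real (gap x (n + 1)) - V1 n (x n)"
    have b: "cmod (p * q) \<le> (\<gamma> n)\<^sup>2" if "rad x n * cmod p \<le> \<gamma> n" "cmod q \<le> rad x n * \<gamma> n" for p q
    proof -
      have "cmod (p * q) \<le> cmod p * (rad x n * \<gamma> n)" using that(2) by (simp add: norm_mult mult_left_mono)
      also have "\<dots> = (rad x n * cmod p) * \<gamma> n" by simp
      also have "\<dots> \<le> \<gamma> n * \<gamma> n" using that(1) \<gamma>nn by (intro mult_right_mono) auto
      finally show ?thesis by (simp add: power2_eq_square)
    qed
    have "\<omega> n + wronsk (gap x) (nodes F) (nodes V) n = nodes F n * ?h - nodes V n * ?e"
      by (simp add: \<omega>_def wronsk_def nodes_def diff_divide_distrib right_diff_distrib left_diff_distrib mult.commute)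
    also have "cmod \<dots> \<le> (\<gamma> n)\<^sup>2 + (\<gamma> n)\<^sup>2"
    proof (rule order_trans[OF norm_triangle_ineq4 add_mono])
      show "cmod (nodes F n * ?h) \<le> (\<gamma> n)\<^sup>2"
        using bf(1)[OF n] \<gamma>le(1)[of n] bv(3)[OF n] mult_left_mono[OF \<gamma>le(2) rad0[OF n], of n]
        by (intro b) linarith+
      show "cmod (nodes V n * ?e) \<le> (\<gamma> n)\<^sup>2"
        using bv(1)[OF n] \<gamma>le(2)[of n] bf(3)[OF n] mult_left_mono[OF \<gamma>le(1) rad0[OF n], of n]
        by (intro b) linarith+
    qed
    finally show ?thesis by simp
  qed
  have "(\<lambda>n. \<omega> n + wronsk (gap x) (nodes F) (nodes V) n) \<longlonglongrightarrow> 0"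
  proof (rule Lim_null_comparison)
    show "(\<lambda>n. 2 * (\<gamma> n)\<^sup>2) \<longlonglongrightarrow> 0"
      using tendsto_mult_right_zero[OF summable_LIMSEQ_zero[OF sum\<gamma>], of 2] by simp
    show "\<forall>\<^sub>F n in sequentially. cmod (\<omega> n + wronsk (gap x) (nodes F) (nodes V) n) \<le> 2 * (\<gamma> n)\<^sup>2"
      by (rule eventually_sequentiallyI[of 1]) (rule \<omega>W)
  qed
  from tendsto_diff[OF this W0] have \<omega>0: "\<omega> \<longlonglongrightarrow> 0" by simp
  have FS: "sobolev2 (x k) (x (Suc k)) (F k) (F1 k) (\<lambda>t. - g t)" and Fae: "AE t in lebesgue_on (J k). f t = F k t"
    and Fc: "F (Suc k) (x (Suc k)) = F k (x (Suc k))"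
    and Fj: "F1 (Suc k) (x (Suc k)) - F1 k (x (Suc k)) = of_real (\<alpha> (Suc k)) * F k (x (Suc k))"
    and Fz: "F1 0 0 = 0" for k
    using F(3) unfolding delta_rep_def by blast+
  have VS: "sobolev2 (x k) (x (Suc k)) (V k) (V1 k) (\<lambda>t. - ?v t)" and Vae: "AE t in lebesgue_on (J k). ?u t = V k t"
    and Vc: "V (Suc k) (x (Suc k)) = V k (x (Suc k))"
    and Vj: "V1 (Suc k) (x (Suc k)) - V1 k (x (Suc k)) = of_real (\<alpha> (Suc k)) * V k (x (Suc k))"
    and Vz: "V1 0 0 = 0" for k
    using V(3) unfolding delta_rep_def by blast+
  let ?G = "\<lambda>t. f t * ?v t - g t * ?u t"
  have cellG: "integral (J n) ?G = \<omega> (Suc n) - \<omega> n" for n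
  proof -
    have "integral (J n) ?G = integral (J n) (\<lambda>t. - g t * V n t - F n t * - ?v t)"
    proof (rule AE_negligible_integral_cong)
      show "AE t in lebesgue_on (J n). ?G t = - g t * V n t - F n t * - ?v t"
        using Fae[of n] Vae[of n] by eventually_elim (simp add: algebra_simps)
    qed simp
    also have "\<dots> = (F1 n (x (Suc n)) * V n (x (Suc n)) - F n (x (Suc n)) * V1 n (x (Suc n))) - \<omega> n"
      unfolding \<omega>_def by (rule integral_unique[OF sobolev2_Green[OF FS VS]])
    also have "F1 n (x (Suc n)) * V n (x (Suc n)) - F n (x (Suc n)) * V1 n (x (Suc n)) = \<omega> (Suc n)"
    proof -
      have F1S: "F1 (Suc n) (x (Suc n)) = F1 n (x (Suc n)) + of_real (\<alpha> (Suc n)) * F n (x (Suc n))"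
        using Fj[of n] by (simp add: algebra_simps)
      have V1S: "V1 (Suc n) (x (Suc n)) = V1 n (x (Suc n)) + of_real (\<alpha> (Suc n)) * V n (x (Suc n))"
        using Vj[of n] by (simp add: algebra_simps)
      show ?thesis unfolding \<omega>_def Fc Vc F1S V1S by (simp add: algebra_simps)
    qed
    finally show ?thesis .
  qed
  note i = L2_mult_cnj_integrable[OF F(1) U(2)] L2_mult_cnj_integrable[OF F(2) U(1)]
  have "(\<lambda>n. \<omega> (Suc n) - \<omega> n) sums integral\<^sup>L M ?G"
    using integral_sums[OF Bochner_Integration.integrable_diff[OF i]] by (simp only: cellG)
  moreover have "(\<lambda>n. \<omega> (Suc n) - \<omega> n) sums (0 - \<omega> 0)"
    by (rule telescope_sums[OF \<omega>0])
  ultimately have "integral\<^sup>L M ?G = 0 - \<omega> 0" by (rule sums_unique2)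
  also have "\<omega> 0 = 0" using Fz Vz by (simp add: \<omega>_def x0)
  finally show ?thesis using i by (simp add: L2_inner_def)
qed

theorem self_adjoint_if_limit_point:
  assumes "summable (\<lambda>n. (gap x n)\<^sup>2)" and limit_point
  shows "self_adjoint M (H_delta b x \<alpha>)"
  unfolding H_delta_def
proof (rule self_adjoint_closureI)
  show "linear_graph M (H0_delta b x \<alpha>)" by (rule H0_linear)
  show "H0_delta b x \<alpha> \<subseteq> delta_max" by (rule H0_subset_delta_max)
  show "op_adjoint M (H0_delta b x \<alpha>) \<subseteq> delta_max" by (rule adjoint_subset_delta_max)
  show "delta_max \<subseteq> L2 M \<times> L2 M" by (auto simp: delta_max_def)
  show "L2_inner M g u = L2_inner M f v" if "(f, g) \<in> delta_max" "(u, v) \<in> delta_max" for f g u v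
    using delta_max_symmetric[OF assms that] .
  show "AE t in M. h t = 0" if "(\<lambda>_. 0, h) \<in> delta_max" for h
    using delta_max_zero[OF that] .
qed

end

section \<open>From the three conditions to the limit point property\<close>

theorem proposition5p11:
  fixes b :: ereal and x \<alpha> :: "nat \<Rightarrow> real"
  assumes "0 < b"
    and "x 0 = 0"
    and "strict_mono x"
    and "\<And>n. ereal (x n) < b"
    and "(\<lambda>n. ereal (x n)) \<longlonglongrightarrow> b"
    and "(\<lambda>n. (gap x n)\<^sup>2) summable_on {1..}"
    and "\<not> (\<lambda>n. \<bar>\<alpha> n\<bar> * gap x n * gap x (n + 1) * rad x (n - 1) * rad x (n + 1)) summable_on {2..}
       \<or> (\<exists>C1>0. \<forall>n\<ge>2.
            \<alpha> n + 1 / gap x n * (1 + rad x n / rad x (n - 1))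
                + 1 / gap x (n + 1) * (1 + rad x n / rad x (n + 1))
              \<le> C1 * (gap x n + gap x (n + 1)))
       \<or> (\<exists>C2>0. \<forall>n\<ge>2.
            \<alpha> n + 1 / gap x n * (1 - rad x n / rad x (n - 1))
                + 1 / gap x (n + 1) * (1 - rad x n / rad x (n + 1))
              \<ge> - C2 * (gap x n + gap x (n + 1)))"
  shows "self_adjoint (lebesgue_on (Ival b)) (H_delta b x \<alpha>)"
proof -
  interpret delta_points b x \<alpha>
    using assms(2-5) by unfold_locales
  have dsum: "summable (\<lambda>n. (gap x n)\<^sup>2)"
    using assms(6) summable_on_atLeast_iff_summable[of 1 "\<lambda>n. (gap x n)\<^sup>2"] summable_Suc_iff[of "\<lambda>n. (gap x n)\<^sup>2"] by simp
  show ?thesis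
  proof (rule self_adjoint_if_limit_point[OF dsum])
    show limit_point
      unfolding limit_point_def
    proof (intro allI impI)
      fix \<gamma> f g assume "jacobi_pair (gap x) \<alpha> (rad x) \<gamma> f g"
      then interpret jacobi_pair "gap x" \<alpha> "rad x" \<gamma> f g .
      \<comment> \<open>Used with \<open>\<sigma> = 1\<close> for the second condition and
        \<open>\<sigma> = -1\<close> for the third. Solving for the terms with quotients of radii
        reverses the sign, which gives the \<open>\<sigma>\<close> of
        \<open>W_tendsto_0_if_dominant\<close>.\<close>
      have split: "1 / a * (1 + \<sigma> * (r / r')) = 1 / a + \<sigma> * (r / (a * r'))" for a r r' \<sigma> :: real
        by (simp add: distrib_left)
      from assms(7) show "wronsk (gap x) f g \<longlonglongrightarrow> 0"
      proof (elim disjE exE conjE)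
        assume ns: "\<not> (\<lambda>n. \<bar>\<alpha> n\<bar> * gap x n * gap x (n + 1) * rad x (n - 1) * rad x (n + 1)) summable_on {2..}"
        show ?thesis
        proof (rule W_tendsto_0_if_not_summable[OF dsum])
          have nn: "0 \<le> \<bar>\<alpha> n\<bar> * gap x n * gap x (n + 1) * rad x (n - 1) * rad x (n + 1)" if "n \<ge> 2" for n
          proof -
            have "n - 1 \<ge> 1" using that by simp
            then show ?thesis
              using d_pos[of n] d_pos[of "n + 1"] r_pos[of "n - 1"] r_pos[of "n + 1"] that
              by (intro mult_nonneg_nonneg) auto
          qed
          show "\<not> summable (\<lambda>n. \<bar>\<alpha> (n + 2)\<bar> * gap x (n + 2) * gap x (n + 3) * rad x (n + 1) * rad x (n + 3))"
            using ns summable_on_atLeast_iff_summable[OF nn] by (simp add: numeral_eq_Suc)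
        qed
      next
        fix C1 :: real
        assume C: "\<forall>n\<ge>2. \<alpha> n + 1 / gap x n * (1 + rad x n / rad x (n - 1))
                + 1 / gap x (n + 1) * (1 + rad x n / rad x (n + 1)) \<le> C1 * (gap x n + gap x (n + 1))"
        show ?thesis
        proof (rule W_tendsto_0_if_dominant[of "-1" C1])
          fix n :: nat assume n: "n \<ge> 2"
          with C have "\<alpha> n + 1 / gap x n * (1 + rad x n / rad x (n - 1))
                + 1 / gap x (n + 1) * (1 + rad x n / rad x (n + 1)) \<le> C1 * (gap x n + gap x (n + 1))" by blast
          then show "rad x n / (gap x n * rad x (n - 1)) + rad x n / (gap x (n + 1) * rad x (n + 1))
              \<le> - 1 * (\<alpha> n + 1 / gap x n + 1 / gap x (n + 1)) + C1 * (rad x n)\<^sup>2"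
            using split[of "gap x n" 1 "rad x n" "rad x (n - 1)"] split[of "gap x (n + 1)" 1 "rad x n" "rad x (n + 1)"]
              r_square[of n] n by simp
        qed simp
      next
        fix C2 :: real
        assume C: "\<forall>n\<ge>2. - C2 * (gap x n + gap x (n + 1)) \<le> \<alpha> n + 1 / gap x n * (1 - rad x n / rad x (n - 1))
                + 1 / gap x (n + 1) * (1 - rad x n / rad x (n + 1))"
        show ?thesis
        proof (rule W_tendsto_0_if_dominant[of 1 C2])
          fix n :: nat assume n: "n \<ge> 2"
          with C have "- C2 * (gap x n + gap x (n + 1)) \<le> \<alpha> n + 1 / gap x n * (1 - rad x n / rad x (n - 1))
                + 1 / gap x (n + 1) * (1 - rad x n / rad x (n + 1))" by blast
          then show "rad x n / (gap x n * rad x (n - 1)) + rad x n / (gap x (n + 1) * rad x (n + 1))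
              \<le> 1 * (\<alpha> n + 1 / gap x n + 1 / gap x (n + 1)) + C2 * (rad x n)\<^sup>2"
            using split[of "gap x n" "-1" "rad x n" "rad x (n - 1)"] split[of "gap x (n + 1)" "-1" "rad x n" "rad x (n + 1)"]
              r_square[of n] n by simp
        qed simp
      qed
    qed
  qed
qed

end
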